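(* Let $k,p\in\mathbb{N}$, $s\in\mathbb{N}_0$, $Y_s=\{y_i\}_{i=1}^s$ with $-1<y_s<\dots<y_1<1$ (empty if $s=0$), $A_p=\{\alpha_i\}_{i=1}^p$ with $-1\le\alpha_p<\dots<\alpha_1\le1$, $Y_s\cap A_p=\emptyset$, and $$(r,m_1,m_2,m_3)\in\{(2j,2j-1,2j-2,2j-1): j\in\mathbb{N}\}\cup\{(2j+1,2j-1,2j,2j): j\in\mathbb{N}_0\}.$$ Let $f\in C^r[-1,1]$ and let $Z_n=\{z_j\}_{j=0}^n$, $-1=z_n<z_{n-1}<\dots<z_1<z_0=1$, be a knot sequence such that each nonempty open interval $(\beta_j,\beta_{j-1})$, $1\le j\le s+p+1$, contains at least $4(k+r-1)^2$ knots, where $Y_s\cup A_p=\{\beta_j\}_{j=1}^{s+p}$ with $\beta_{s+p}<\dots<\beta_1$, $\beta_0=1$, $\beta_{s+p+1}=-1$. Then there exists $S\in\Sigma_{k+r}(Z_n)\cap C^{k+r-2}[-1,1]$ such that $S-f\in\Delta^{(0)}(Y_s)$, $S^{(i)}(\alpha)=f^{(i)}(\alpha)$ for $\alpha\in A_p$, $0\le i\le m_1$ (vacuous if $m_1=-1$), $S^{(i)}(y)=f^{(i)}(y)$ for $y\in Y_s$, $0\le i\le m_2$, $S^{(i)}(\pm1)=f^{(i)}(\pm1)$ for $0\le i\le m_3$, and, for $0\le i\le n-1$, $$\|f-S\|_{C(J_i)}\le c\,|J_i|^r\,\omega_k(f^{(r)},|\widehat J_i|;\widehat J_i),\qquad c=c(k,r,\rho),$$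 where $\widehat J_i$ is an interval with $J_i\subset\widehat J_i\subseteq[z_{i+6(k+r-1)^2},z_{i-6(k+r-1)^2}]$.
   Context: Set $z_i:=-1$ for $i>n$, $z_i:=1$ for $i<0$, $J_i:=[z_i,z_{i-1}]$, and $\rho:=\max\{|J_{i\pm1}|/|J_i|: 1\le i\le n\}$. $\Sigma_m(Z_n)$ denotes the set of continuous piecewise polynomial functions on $[-1,1]$ which are polynomials of degree $\le m-1$ on each $[z_j,z_{j-1}]$. $\omega_k(g,t;J)$ is the $k$-th modulus of smoothness of $g$ on the interval $J$. With $y_0:=1$, $y_{s+1}:=-1$, $h\in\Delta^{(0)}(Y_s)$ iff $(-1)^ih\ge0$ on $[y_{i+1},y_i]$ for $0\le i\le s$ (for $s=0$ this means $h\ge0$ on $[-1,1]$). *)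

theory Defs
  imports "HOL-Analysis.Analysis" "HOL-Computational_Algebra.Polynomial"
begin

definition zext :: "(nat \<Rightarrow> real) \<Rightarrow> nat \<Rightarrow> int \<Rightarrow> real" where
  "zext z n i = (if i < 0 then 1 else if i > int n then -1 else z (nat i))"

definition Jlen :: "(nat \<Rightarrow> real) \<Rightarrow> nat \<Rightarrow> int \<Rightarrow> real" where
  "Jlen z n i = zext z n (i - 1) - zext z n i"

definition rho :: "(nat \<Rightarrow> real) \<Rightarrow> nat \<Rightarrow> real" where
  "rho z n = Max ((\<lambda>i. Jlen z n (i - 1) / Jlen z n i) ` {1..int n}
                 \<union> (\<lambda>i. Jlen z n (i + 1) / Jlen z n i) ` {1..int n})"

definition Cm_on :: "nat \<Rightarrow> real set \<Rightarrow> (real \<Rightarrow> real) \<Rightarrow> (nat \<Rightarrow> real \<Rightarrow> real) \<Rightarrow> bool" where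
  "Cm_on m I f D \<longleftrightarrow> (\<forall>x\<in>I. D 0 x = f x)
     \<and> (\<forall>i<m. \<forall>x\<in>I. (D i has_real_derivative D (Suc i) x) (at x within I))
     \<and> continuous_on I (D m)"

definition Sigma :: "nat \<Rightarrow> (nat \<Rightarrow> real) \<Rightarrow> nat \<Rightarrow> (real \<Rightarrow> real) set" where
  "Sigma m z n = {S. continuous_on {-1..1} S \<and>
     (\<forall>j\<in>{1..n}. \<exists>q :: real poly. degree q \<le> m - 1 \<and>
        (\<forall>x\<in>{z j..z (j - 1)}. S x = poly q x))}"

text \<open>k-th modulus of smoothness of g on [a,b] (Delta_h^k g(x) := 0 if x + kh is outside [a,b]).\<close>
definition omega :: "nat \<Rightarrow> (real \<Rightarrow> real) \<Rightarrow> real \<Rightarrow> real \<Rightarrow> real \<Rightarrow> real" where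
  "omega k g t a b = Sup ({0} \<union>
     {\<bar>\<Sum>i\<le>k. (-1) ^ (k - i) * real (k choose i) * g (x + real i * h)\<bar> | x h.
        0 < h \<and> h \<le> t \<and> a \<le> x \<and> x + real k * h \<le> b})"

definition yext :: "(nat \<Rightarrow> real) \<Rightarrow> nat \<Rightarrow> nat \<Rightarrow> real" where
  "yext y s i = (if i = 0 then 1 else if i = s + 1 then -1 else y i)"

definition Delta0 :: "(nat \<Rightarrow> real) \<Rightarrow> nat \<Rightarrow> (real \<Rightarrow> real) \<Rightarrow> bool" where
  "Delta0 y s h \<longleftrightarrow> (\<forall>i\<le>s. \<forall>x\<in>{yext y s (Suc i)..yext y s i}. (-1) ^ i * h x \<ge> 0)"

definition beta :: "real set \<Rightarrow> nat \<Rightarrow> real" where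
  "beta B j = (if j = 0 then 1 else if j = card B + 1 then -1
               else rev (sorted_list_of_set B) ! (j - 1))"

end

theory Submission
  imports Defs
begin

text \<open>
  Write \<open>m = k + r - 1\<close>. By Whitney's theorem the \<open>r\<close>-th derivative of \<open>f\<close> is within a multiple \<open>E\<close> of its
  \<open>k\<close>-th modulus of smoothness of a polynomial of degree less than \<open>k\<close>, and integrating \<open>r\<close> times from a
  point \<open>b\<close> gives a polynomial of degree at most \<open>m\<close> whose distance to \<open>f\<close> is at most \<open>E\<bar>x - b\<bar>\<^sup>r\<close>.
  On an interval of length \<open>h\<close>, adding \<open>\<plusminus>E h\<^sup>r\<^sup>-\<^sup>l (x - b)\<^sup>l\<close> with \<open>l \<le> r\<close> forces a sign of the error on
  either side of \<open>b\<close> and keeps the derivatives of order less than \<open>l\<close>. The parity of \<open>l\<close> decides whether the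
  sign changes at \<open>b\<close>, so \<open>l\<close> is \<open>r\<close> or \<open>r - 1\<close> at the points of \<open>Y\<close> and \<open>A\<close>, and \<open>l = 0\<close> where nothing is
  interpolated. These local polynomials are glued on the level of B-spline coefficients: each coefficient
  is the largest (or smallest, according to the sign wanted) of the corresponding coefficients of the
  local polynomials on the intervals of the support. As B-splines are nonnegative, the spline stays on
  the right side of every local polynomial, and it coincides with the polynomial belonging to \<open>b\<close> on
  the knot interval of \<open>b\<close>, because that polynomial is used on \<open>m\<close> further intervals on both sides.
\<close>

section \<open>Whitney's theorem\<close>

text \<open>In the code the splines have degree \<open>Suc m\<close>, so its \<open>m\<close> is one
  less than the m above. Knots decrease in the theorem but increase for the B-splines:
  \<open>t i\<close> is the knot with index -i, continued with equal gaps beyond both ends, and J_i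
  is [t (-i), t (-i + 1)].

  The obstacle is that an extremal coefficient serves one sign only, so the wanted sign must not
  change within the support of a B-spline. It changes only at points of Y, and there all pieces
  active on the support are the same polynomial: the coefficient is then exact and needs no sign.
  The many knots between consecutive points make these two situations exhaustive.

  The error estimate compares pieces on one knot interval. Two pieces used near J_i are both close
  to f there, and the coefficient functionals are bounded by the size of a polynomial on that
  interval, with a constant depending on the mesh ratio only.

  The admissible quadruples express the parity rule: l must be odd at Y and even at A, so one of the
  two sets gets r conditions and the other r - 1. At 1 and -1 only one side matters, hence l = r for
  either parity of r.\<close>

primrec fdiff :: "nat \<Rightarrow> real \<Rightarrow> (real \<Rightarrow> real) \<Rightarrow> real \<Rightarrow> real" where
  "fdiff 0 h g x = g x"
| "fdiff (Suc k) h g x = fdiff k h g (x + h) - fdiff k h g x"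

lemma fdiff_alt: "fdiff (Suc k) h g x = fdiff k h (\<lambda>u. g (u + h) - g u) x"
proof (induction k arbitrary: x)
  case (Suc k)
  have "fdiff (Suc (Suc k)) h g x = fdiff (Suc k) h g (x + h) - fdiff (Suc k) h g x"
    by simp
  also have "\<dots> = fdiff k h (\<lambda>u. g (u + h) - g u) (x + h) - fdiff k h (\<lambda>u. g (u + h) - g u) x"
    by (simp only: Suc.IH)
  finally show ?case by simp
qed simp

lemma fdiff_add: "fdiff k h (\<lambda>u. f u + g u) x = fdiff k h f x + fdiff k h g x"
  by (induction k arbitrary: x) simp_all

lemma fdiff_diff: "fdiff k h (\<lambda>u. f u - g u) x = fdiff k h f x - fdiff k h g x"
  by (induction k arbitrary: x) simp_all

lemma fdiff_cmult: "fdiff k h (\<lambda>u. c * f u) x = c * fdiff k h f x"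
  by (induction k arbitrary: x) (simp_all add: algebra_simps)

lemma fdiff_sum: "finite A \<Longrightarrow> fdiff k h (\<lambda>u. \<Sum>j\<in>A. f j u) x = (\<Sum>j\<in>A. fdiff k h (f j) x)"
proof (induction A rule: finite_induct)
  case empty
  show ?case using fdiff_cmult[of k h 0 "\<lambda>_. 0" x] by simp
qed (simp add: fdiff_add)

lemma fdiff_scale: "fdiff k h (\<lambda>u. f (a + c * u)) x = fdiff k (c * h) f (a + c * x)"
  by (induction k arbitrary: x) (simp_all add: algebra_simps)

lemma fdiff_eq_sum:
  "fdiff k h g x = (\<Sum>i\<le>k. (-1) ^ (k - i) * real (k choose i) * g (x + real i * h))"
proof (induction k arbitrary: x)
  case (Suc k)
  let ?u = "\<lambda>i. g (x + real i * h)"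
  have A: "fdiff k h g (x + h) = (\<Sum>i\<le>k. (-1) ^ (k - i) * real (k choose i) * ?u (Suc i))"
    by (simp add: Suc algebra_simps)
  have B: "- fdiff k h g x = (\<Sum>i\<le>k. (-1) ^ (Suc k - i) * real (k choose i) * ?u i)"
    by (simp add: Suc sum_negf [symmetric] Suc_diff_le)
  have "(\<Sum>i\<le>Suc k. (-1) ^ (Suc k - i) * real (Suc k choose i) * ?u i)
      = (-1) ^ Suc k * ?u 0
        + (\<Sum>i\<le>k. (-1) ^ (k - i) * real (Suc k choose Suc i) * ?u (Suc i))"
    by (subst sum.atMost_Suc_shift) simp
  also have "(\<Sum>i\<le>k. (-1) ^ (k - i) * real (Suc k choose Suc i) * ?u (Suc i))
     = (\<Sum>i\<le>k. (-1) ^ (k - i) * real (k choose i) * ?u (Suc i))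
       + (\<Sum>i\<le>k. (-1) ^ (k - i) * real (k choose Suc i) * ?u (Suc i))"
    by (simp add: sum.distrib [symmetric] algebra_simps)
  also have "(-1) ^ Suc k * ?u 0 + (\<dots>) = (\<Sum>i\<le>k. (-1) ^ (k - i) * real (k choose i) * ?u (Suc i))
     + ((-1) ^ Suc k * ?u 0 + (\<Sum>i\<le>k. (-1) ^ (k - i) * real (k choose Suc i) * ?u (Suc i)))"
    by simp
  also have "(-1) ^ Suc k * ?u 0 + (\<Sum>i\<le>k. (-1) ^ (k - i) * real (k choose Suc i) * ?u (Suc i))
     = (\<Sum>i\<le>Suc k. (-1) ^ (Suc k - i) * real (k choose i) * ?u i)"
    by (subst sum.atMost_Suc_shift) simp
  also have "\<dots> = - fdiff k h g x"
    by (simp add: B)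
  finally show ?case
    by (simp add: A)
qed simp

text \<open>By \<open>fdiff_alt\<close> a difference of order k + 1 is a k-th difference of a first
  difference. The induction hypothesis for the chain \<open>E\<close> of first differences gives a
  point, and one application of the mean value theorem there trades the remaining difference for one
  more derivative.\<close>

lemma fdiff_mean_value:
  assumes "h > 0"
    and "\<And>i u. i < k \<Longrightarrow> (D i has_real_derivative D (Suc i) u) (at u)"
  obtains \<xi> where "x \<le> \<xi>" "\<xi> \<le> x + real k * h" "fdiff k h (D 0) x = h ^ k * D k \<xi>"
proof -
  have "\<exists>\<xi>. x \<le> \<xi> \<and> \<xi> \<le> x + real k * h \<and> fdiff k h (D 0) x = h ^ k * D k \<xi>"
    using assms(2)
  proof (induction k arbitrary: D)
    case (Suc k)
    define E where "E = (\<lambda>i u. D i (u + h) - D i u)"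
    have "(E i has_real_derivative E (Suc i) u) (at u)" if "i < k" for i u
      unfolding E_def using Suc.prems[of i] that
      by (intro derivative_intros DERIV_shift[THEN iffD1]) auto
    from Suc.IH[of E, OF this] obtain \<xi> where \<xi>: "x \<le> \<xi>" "\<xi> \<le> x + real k * h"
      "fdiff k h (E 0) x = h ^ k * E k \<xi>"
      by blast
    have "\<exists>z>\<xi>. z < \<xi> + h \<and> D k (\<xi> + h) - D k \<xi> = (\<xi> + h - \<xi>) * D (Suc k) z"
      by (rule MVT2) (use \<open>h > 0\<close> Suc.prems in auto)
    then obtain z where z: "z > \<xi>" "z < \<xi> + h" "E k \<xi> = h * D (Suc k) z"
      by (auto simp: E_def)
    have "fdiff (Suc k) h (D 0) x = fdiff k h (E 0) x"
      by (simp only: fdiff_alt E_def)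
    then show ?case
      using \<xi> z by (intro exI[of _ z]) (auto simp: algebra_simps)
  qed auto
  then show ?thesis using that by blast
qed

section \<open>Polynomials, their derivatives and Taylor approximation\<close>

lemma higher_pderiv_eq_0:
  fixes p :: "real poly"
  assumes "degree p < k"
  shows "(pderiv ^^ k) p = 0"
  by (rule poly_eqI) (use assms in \<open>simp add: coeff_higher_pderiv coeff_eq_0\<close>)

lemma has_real_derivative_higher_pderiv:
  "(poly ((pderiv ^^ i) p) has_real_derivative poly ((pderiv ^^ Suc i) p) x) (at x within A)"
  by (rule has_field_derivative_at_within) (simp add: poly_DERIV)

lemma fdiff_poly_eq_0:
  assumes "degree p < k" "h > 0"
  shows "fdiff k h (poly p) x = 0"
proof -
  obtain \<xi> where "fdiff k h (poly p) x = h ^ k * poly ((pderiv ^^ k) p) \<xi>"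
    by (rule fdiff_mean_value[of h k "\<lambda>i. poly ((pderiv ^^ i) p)" x])
       (use assms has_real_derivative_higher_pderiv in auto)
  then show ?thesis by (simp add: higher_pderiv_eq_0[OF assms(1)])
qed

lemma exists_poly_antiderivative:
  fixes q :: "real poly"
  obtains p where "pderiv p = q" "degree p \<le> Suc (degree q)"
proof
  define p where "p = (\<Sum>i\<le>degree q. monom (coeff q i / real (Suc i)) (Suc i))"
  show "pderiv p = q"
    by (rule poly_eqI) (auto simp: p_def coeff_pderiv coeff_sum coeff_eq_0 if_distrib cong: if_cong)
  show "degree p \<le> Suc (degree q)"
    unfolding p_def by (intro degree_sum_le) (auto intro: order.trans[OF degree_monom_le])
qed

text \<open>Each integration fixes its constant by the value at \<open>c\<close>, and the mean value
  theorem between \<open>c\<close> and \<open>x\<close> gains one power of the distance. It serves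
  twice: with \<open>q\<close> from Whitney's theorem for the local polynomials, and with
  \<open>q = 0\<close> inside the proof of Whitney's theorem itself.\<close>

lemma taylor_poly_match:
  fixes D :: "nat \<Rightarrow> real \<Rightarrow> real"
  assumes der: "\<And>i x. i < r \<Longrightarrow> x \<in> {a..b} \<Longrightarrow> (D i has_real_derivative D (Suc i) x) (at x within {a..b})"
    and c: "c \<in> {a..b}"
    and q: "\<And>x. x \<in> {a..b} \<Longrightarrow> \<bar>D r x - poly q x\<bar> \<le> E"
  obtains p where "degree p \<le> degree q + r" "(pderiv ^^ r) p = q"
    "\<And>i. i < r \<Longrightarrow> poly ((pderiv ^^ i) p) c = D i c"
    "\<And>x. x \<in> {a..b} \<Longrightarrow> \<bar>D 0 x - poly p x\<bar> \<le> E * \<bar>x - c\<bar> ^ r"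
proof -
  have "\<exists>p. degree p \<le> degree q + r \<and> (pderiv ^^ r) p = q
    \<and> (\<forall>i<r. poly ((pderiv ^^ i) p) c = D i c)
    \<and> (\<forall>x\<in>{a..b}. \<bar>D 0 x - poly p x\<bar> \<le> E * \<bar>x - c\<bar> ^ r)"
    using der q
  proof (induction r arbitrary: D)
    case 0
    then show ?case by (intro exI[of _ q]) auto
  next
    case (Suc r)
    from Suc.IH[of "\<lambda>i. D (Suc i)"] Suc.prems
    obtain p' where p': "degree p' \<le> degree q + r" "(pderiv ^^ r) p' = q"
      "\<And>i. i < r \<Longrightarrow> poly ((pderiv ^^ i) p') c = D (Suc i) c"
      "\<And>x. x \<in> {a..b} \<Longrightarrow> \<bar>D (Suc 0) x - poly p' x\<bar> \<le> E * \<bar>x - c\<bar> ^ r"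
      by auto
    obtain p0 where p0: "pderiv p0 = p'" "degree p0 \<le> Suc (degree p')"
      by (rule exists_poly_antiderivative)
    define p where "p = p0 + [:D 0 c - poly p0 c:]"
    have pd: "pderiv p = p'"
      by (simp add: p_def p0 pderiv_add)
    have pc: "poly p c = D 0 c" by (simp add: p_def)
    have "degree p \<le> degree q + Suc r"
      unfolding p_def using p0(2) p'(1) by (intro degree_add_le) auto
    moreover have "(pderiv ^^ Suc r) p = q"
      by (simp add: funpow_swap1 pd p'(2))
    moreover have "poly ((pderiv ^^ i) p) c = D i c" if "i < Suc r" for i
      using that by (cases i) (simp_all add: pc funpow_swap1 pd p'(3))
    moreover have "\<bar>D 0 x - poly p x\<bar> \<le> E * \<bar>x - c\<bar> ^ Suc r" if x: "x \<in> {a..b}" for x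
    proof (cases "x = c")
      case True
      then show ?thesis by (simp add: pc)
    next
      case False
      define lo hi where "lo = min x c" and "hi = max x c"
      have lh: "lo < hi" "{lo..hi} \<subseteq> {a..b}"
        using False x c by (auto simp: lo_def hi_def)
      define g where "g = (\<lambda>u. D 0 u - poly p u)"
      have dg: "(g has_real_derivative D (Suc 0) u - poly p' u) (at u within {lo..hi})"
        if "u \<in> {lo..hi}" for u
      proof -
        have "(D 0 has_real_derivative D (Suc 0) u) (at u within {lo..hi})"
          using Suc.prems(1)[of 0 u] lh that by (auto intro: DERIV_subset)
        moreover have "(poly p has_real_derivative poly p' u) (at u within {lo..hi})"
          using poly_DERIV[of p u] pd by (auto intro: has_field_derivative_at_within)
        ultimately show ?thesis
          unfolding g_def by (intro derivative_intros)
      qed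
      have "\<exists>z\<in>{lo<..<hi}. g hi - g lo = (\<lambda>h. (D (Suc 0) z - poly p' z) * h) (hi - lo)"
        by (rule mvt_simple)
           (use lh(1) dg in \<open>auto simp: has_field_derivative_def\<close>)
      then obtain z where z: "z \<in> {lo<..<hi}" "g hi - g lo = (D (Suc 0) z - poly p' z) * (hi - lo)"
        by auto
      have "\<bar>g x\<bar> = \<bar>g hi - g lo\<bar>"
        using pc by (auto simp: g_def lo_def hi_def max_def min_def)
      also have "\<dots> = \<bar>D (Suc 0) z - poly p' z\<bar> * \<bar>x - c\<bar>"
        by (simp add: z(2) abs_mult) (auto simp: lo_def hi_def)
      also have "\<dots> \<le> (E * \<bar>z - c\<bar> ^ r) * \<bar>x - c\<bar>"
        using z(1) lh(2) by (intro mult_right_mono p'(4)) auto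
      also have "\<dots> \<le> (E * \<bar>x - c\<bar> ^ r) * \<bar>x - c\<bar>"
      proof (intro mult_right_mono mult_left_mono power_mono)
        show "\<bar>z - c\<bar> \<le> \<bar>x - c\<bar>"
          using z(1) by (auto simp: lo_def hi_def min_def max_def split: if_splits)
        show "0 \<le> E" using Suc.prems(2)[OF c] by linarith
      qed auto
      finally show ?thesis by (simp add: g_def mult_ac)
    qed
    ultimately show ?case by blast
  qed
  then show ?thesis using that by blast
qed

lemma fdiff_0_step: "k \<ge> 1 \<Longrightarrow> fdiff k 0 g x = 0"
  by (cases k) simp_all

lemma fdiff_has_real_derivative:
  assumes "\<And>u. (f has_real_derivative f' u) (at u)"
  shows "(fdiff k h f has_real_derivative fdiff k h f' x) (at x)"
proof (induction k arbitrary: x)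
  case (Suc k)
  have "fdiff (Suc k) h g = (\<lambda>x. fdiff k h g (x + h) - fdiff k h g x)" for g
    by (simp add: fun_eq_iff)
  then show ?case
    using Suc by (auto intro!: derivative_intros DERIV_shift[THEN iffD1])
next
  case 0
  have "fdiff 0 h g = g" for g
    by (simp add: fun_eq_iff)
  then show ?case using assms by simp
qed

lemma degree_less_of_higher_pderiv_eq_0:
  fixes p :: "real poly"
  assumes "(pderiv ^^ k) p = 0" "k \<ge> 1"
  shows "degree p < k"
proof (rule ccontr)
  assume "\<not> degree p < k"
  then obtain d where d: "degree p = d + k" using le_Suc_ex by (metis add.commute not_less)
  have "coeff ((pderiv ^^ k) p) d = pochhammer (of_nat (Suc d)) k * coeff p (d + k)"
    by (rule coeff_higher_pderiv)
  moreover have "pochhammer (of_nat (Suc d) :: real) k \<noteq> 0"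
    using pochhammer_pos[of "of_nat (Suc d) :: real" k] by simp
  ultimately have "lead_coeff p = 0" using d assms(1) by simp
  then have "p = 0" by (simp only: leading_coeff_0_iff)
  then show False using d assms(2) by simp
qed

lemma exists_antiderivative_chain:
  fixes g :: "real \<Rightarrow> real"
  assumes "continuous_on UNIV g"
  obtains F where "F 0 = g" "\<And>i x. (F (Suc i) has_real_derivative F i x) (at x)"
proof -
  have *: "\<exists>F. continuous_on UNIV F \<and> (\<forall>x. (F has_real_derivative f x) (at x))"
    if "continuous_on UNIV f" for f :: "real \<Rightarrow> real"
  proof -
    have "\<exists>F. \<forall>x. -\<infinity> < ereal x \<longrightarrow> ereal x < \<infinity> \<longrightarrow> (F has_vector_derivative f x) (at x)"
      by (rule einterval_antiderivative)
         (use that in \<open>auto simp: continuous_on_eq_continuous_at\<close>)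
    then obtain F where F: "\<And>x. (F has_real_derivative f x) (at x)"
      by (auto simp: has_real_derivative_iff_has_vector_derivative)
    then have "continuous_on UNIV F"
      by (meson DERIV_continuous_on has_field_derivative_at_within)
    with F show ?thesis by blast
  qed
  have "\<exists>F. \<forall>i. (continuous_on UNIV (F i) \<and> (i = 0 \<longrightarrow> F i = g)) \<and>
      (\<forall>x. (F (Suc i) has_real_derivative F i x) (at x))"
    by (rule dependent_nat_choice[where P = "\<lambda>i f. continuous_on UNIV f \<and> (i = 0 \<longrightarrow> f = g)"
          and Q = "\<lambda>i f f'. \<forall>x. (f' has_real_derivative f x) (at x)"])
       (use assms * in auto)
  then show ?thesis using that by blast
qed

lemma sum_real_choose: "(\<Sum>j\<le>k. real (k choose j)) = 2 ^ k"
  using choose_row_sum[of k] by (metis of_nat_numeral of_nat_power of_nat_sum)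

text \<open>\<open>D 0\<close> is a Steklov-type average of \<open>g\<close>:
  \<open>fdiff k h (F k) x / h ^ k\<close> is a mean of \<open>g\<close> over [x, x + k h], and the
  weights \<open>co j\<close> make \<open>g x - D 0 x\<close>, up to sign, a mean of k-th
  differences of \<open>g\<close> at \<open>x\<close>. So \<open>D 0\<close> is within
  \<open>w\<close> of \<open>g\<close>, while its k-th derivative combines k-th differences of
  \<open>g\<close> and is small; its Taylor polynomial at \<open>a\<close> is the approximation
  sought. The averages look to the right of \<open>x\<close>, which is why only the left half is
  reached.\<close>

lemma whitney_left_half:
  fixes g :: "real \<Rightarrow> real"
  assumes k: "k \<ge> 1" and ab: "a < b" and cont: "continuous_on UNIV g"
    and om: "\<And>h x. 0 < h \<Longrightarrow> a \<le> x \<Longrightarrow> x + real k * h \<le> b \<Longrightarrow> \<bar>fdiff k h g x\<bar> \<le> w"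
  obtains q where "degree q < k"
    "\<And>x. x \<in> {a..(a+b)/2} \<Longrightarrow> \<bar>g x - poly q x\<bar> \<le> (1 + (4 * real k ^ 2) ^ k) * w"
proof -
  obtain F where F: "F 0 = g" "\<And>i x. (F (Suc i) has_real_derivative F i x) (at x)"
    using exists_antiderivative_chain[OF cont] by blast
  have F': "(F (k - i) has_real_derivative F (k - Suc i) x) (at x)" if "i < k" for i x
    using F(2)[of "k - Suc i" x] that by (simp add: Suc_diff_Suc)
  \<comment> \<open>Steps up to \<open>k * d\<close>, taken \<open>k\<close> times, cover
    \<open>k ^ 2 * d\<close>, half of the interval, so differences started in the left half stay in
    [a, b].\<close>
  define d where "d = (b - a) / (2 * real k ^ 2)"
  have d: "d > 0" "real k ^ 2 * d = (b - a) / 2"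
    using ab k by (auto simp: d_def)
  have om0: "\<bar>fdiff k h g x\<bar> \<le> w" if "0 \<le> h" "a \<le> x" "x + real k * h \<le> b" for h x
  proof (cases "h = 0")
    case True
    have "0 \<le> w"
      using om[of "(b - a) / real k" a] ab k by (simp add: field_simps)
    with True show ?thesis by (simp add: fdiff_0_step[OF k])
  qed (use that om in auto)
  define co where "co = (\<lambda>j. (-1) ^ Suc j * real (k choose j) / (real j * d) ^ k)"
  define D where "D = (\<lambda>i x. \<Sum>j=1..k. co j * fdiff k (real j * d) (F (k - i)) x)"
  have D: "(D i has_real_derivative D (Suc i) x) (at x)" if "i < k" for i x
    unfolding D_def
    by (intro DERIV_sum DERIV_cmult fdiff_has_real_derivative F'[OF that])
  define E where "E = 2 ^ k / d ^ k * w"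
  have mid: "x + real k * (real j * d) \<le> b" if "x \<le> (a + b) / 2" "j \<le> k" for x j
  proof -
    have "real k * (real j * d) \<le> real k * (real k * d)"
      using that d by (intro mult_left_mono mult_right_mono) auto
    also have "\<dots> = (b - a) / 2" using d by (simp add: power2_eq_square)
    finally show ?thesis using that by (simp add: field_simps)
  qed
  have w0: "w \<ge> 0"
    using om0[of 0 a] ab by (simp add: fdiff_0_step[OF k])
  have DE: "\<bar>D k x - poly 0 x\<bar> \<le> E" if x: "x \<in> {a..(a+b)/2}" for x
  proof -
    have "\<bar>D k x\<bar> \<le> (\<Sum>j=1..k. real (k choose j) / d ^ k * w)"
      unfolding D_def
    proof (rule order.trans[OF sum_abs], rule sum_mono)
      fix j assume j: "j \<in> {1..k}"
      have "\<bar>co j\<bar> \<le> real (k choose j) / d ^ k"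
        using j d unfolding co_def
        by (auto simp: abs_mult power_mult_distrib divide_simps mult_le_cancel_left1)
      moreover have "\<bar>fdiff k (real j * d) (F (k - k)) x\<bar> \<le> w"
        using om0[of "real j * d" x] mid[of x j] x j d by (auto simp: F)
      ultimately show "\<bar>co j * fdiff k (real j * d) (F (k - k)) x\<bar> \<le> real (k choose j) / d ^ k * w"
        unfolding abs_mult by (intro mult_mono) auto
    qed
    also have "\<dots> = (\<Sum>j=1..k. real (k choose j)) / d ^ k * w"
      by (simp add: sum_divide_distrib sum_distrib_right)
    also have "\<dots> \<le> E"
      unfolding E_def
    proof (intro mult_right_mono divide_right_mono)
      have "(\<Sum>j=1..k. real (k choose j)) \<le> (\<Sum>j\<le>k. real (k choose j))"
        by (intro sum_mono2) auto
      also have "\<dots> = 2 ^ k" by (rule sum_real_choose)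
      finally show "(\<Sum>j=1..k. real (k choose j)) \<le> 2 ^ k" .
    qed (use d w0 in auto)
    finally show ?thesis by simp
  qed
  obtain p where p: "(pderiv ^^ k) p = 0"
    "\<And>x. x \<in> {a..(a+b)/2} \<Longrightarrow> \<bar>D 0 x - poly p x\<bar> \<le> E * \<bar>x - a\<bar> ^ k"
    by (rule taylor_poly_match[of k a "(a+b)/2" D a 0 E])
       (use D DE ab in \<open>auto intro: has_field_derivative_at_within\<close>)
  have gD: "\<bar>g x - D 0 x\<bar> \<le> w" if x: "x \<in> {a..(a+b)/2}" for x
  proof -
    define P where "P = (\<lambda>i u::real. u ^ (k - i) / fact (k - i))"
    have P: "(P i has_real_derivative P (Suc i) u) (at u)" if "i < k" for i u
    proof -
      obtain l where l: "k - i = Suc l" "k - Suc i = l" using \<open>i < k\<close> by (metis Suc_diff_Suc)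
      have "((\<lambda>u. u ^ Suc l / fact (Suc l)) has_real_derivative u ^ l / fact l) (at u)"
        by (rule derivative_eq_intros refl | simp del: of_nat_Suc)+
      then show ?thesis by (simp only: P_def l)
    qed
    obtain \<xi>0 where "fdiff k d (P 0) 0 = d ^ k * P k \<xi>0"
      by (rule fdiff_mean_value[of d k P 0]) (use d P in auto)
    then have P0: "fdiff k d (P 0) 0 = d ^ k" by (simp add: P_def)
    define Q where "Q = (\<lambda>i j u. F (k - i) (x + real j * u))"
    define c where "c = (\<lambda>i j. (-1) ^ j * real (k choose j) * real j ^ i / real j ^ k)"
    \<comment> \<open>As a function of \<open>u\<close>, \<open>K 0\<close> has k-th derivative
      \<open>(-1) ^ k * fdiff k u g x\<close>, while its k-th difference at 0 with step
      \<open>d\<close> is \<open>d ^ k * (g x - D 0 x)\<close>. Equating the two by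
      \<open>fdiff_mean_value\<close> replaces a k-fold integral.\<close>
    define K where "K = (\<lambda>i u. g x * P i u + (\<Sum>j=1..k. c i j * Q i j u))"
    have Q: "(Q i j has_real_derivative real j * Q (Suc i) j u) (at u)" if "i < k" for i j u
    proof -
      have "((\<lambda>u. x + real j * u) has_real_derivative real j) (at u)"
        by (auto intro!: derivative_eq_intros)
      from DERIV_chain2[OF F'[OF that] this] show ?thesis
        by (simp add: Q_def mult.commute)
    qed
    have K: "(K i has_real_derivative K (Suc i) u) (at u)" if "i < k" for i u
      unfolding K_def
      by (rule derivative_eq_intros DERIV_cmult P Q that refl)+
         (auto simp: c_def intro!: sum.cong)
    obtain \<xi> where \<xi>: "0 \<le> \<xi>" "\<xi> \<le> 0 + real k * d" "fdiff k d (K 0) 0 = d ^ k * K k \<xi>"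
      by (rule fdiff_mean_value[of d k K 0]) (use d K in auto)
    have "K k \<xi> = g x + (\<Sum>j=1..k. (-1) ^ j * real (k choose j) * g (x + real j * \<xi>))"
      by (auto simp: K_def P_def c_def Q_def F intro!: sum.cong)
    also have "\<dots> = (\<Sum>j\<le>k. (-1) ^ j * real (k choose j) * g (x + real j * \<xi>))"
      unfolding atMost_atLeast0 by (subst (2) sum.atLeast_Suc_atMost) auto
    also have "\<dots> = (-1) ^ k * fdiff k \<xi> g x"
      unfolding fdiff_eq_sum sum_distrib_left
      by (rule sum.cong) (auto simp: mult.assoc[symmetric] power_add[symmetric] minus_one_power_iff)
    finally have "\<bar>K k \<xi>\<bar> = \<bar>fdiff k \<xi> g x\<bar>" by (simp add: abs_mult)
    moreover have "real k * \<xi> \<le> real k * (real k * d)"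
      using \<xi> by (intro mult_left_mono) auto
    ultimately have "\<bar>K k \<xi>\<bar> \<le> w"
      using om0[of \<xi> x] \<xi> x mid[of x k] by auto
    moreover have "fdiff k d (K 0) 0 = d ^ k * (g x - D 0 x)"
    proof -
      have "fdiff k d (K 0) 0 = g x * d ^ k + (\<Sum>j=1..k. c 0 j * fdiff k d (Q 0 j) 0)"
        by (simp add: K_def fdiff_add fdiff_cmult fdiff_sum P0)
      also have "(\<Sum>j=1..k. c 0 j * fdiff k d (Q 0 j) 0) = - (d ^ k * D 0 x)"
        unfolding D_def sum_distrib_left sum_negf[symmetric]
      proof (rule sum.cong)
        fix j assume "j \<in> {1..k}"
        have "fdiff k d (Q 0 j) 0 = fdiff k (real j * d) (F k) x"
          unfolding Q_def by (subst fdiff_scale) simp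
        then show "c 0 j * fdiff k d (Q 0 j) 0 = - (d ^ k * (co j * fdiff k (real j * d) (F (k - 0)) x))"
          using d by (simp add: c_def co_def power_mult_distrib)
      qed simp
      finally show ?thesis by (simp add: algebra_simps)
    qed
    ultimately show ?thesis using \<xi> d by simp
  qed
  show ?thesis
  proof (rule that[of p])
    show "degree p < k" using degree_less_of_higher_pderiv_eq_0[OF p(1) k] .
    fix x assume x: "x \<in> {a..(a+b)/2}"
    have "E * \<bar>x - a\<bar> ^ k \<le> E * (real k ^ 2 * d) ^ k"
      using x d w0 by (intro mult_left_mono power_mono) (auto simp: E_def field_simps)
    also have "\<dots> \<le> (4 * real k ^ 2) ^ k * w"
    proof -
      have "E * (real k ^ 2 * d) ^ k = (2 * real k ^ 2) ^ k * w"
        using d by (simp add: E_def power_mult_distrib)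
      also have "\<dots> \<le> (4 * real k ^ 2) ^ k * w"
        using w0 by (intro mult_right_mono power_mono) auto
      finally show ?thesis .
    qed
    finally show "\<bar>g x - poly p x\<bar> \<le> (1 + (4 * real k ^ 2) ^ k) * w"
      using p(2)[OF x] gD[OF x] by (simp add: algebra_simps)
  qed
qed

text \<open>A bound on \<open>{a..a+L}\<close> propagates to points \<open>x\<close> further right: the other points \<open>x - j t\<close>
  of the difference with \<open>t = (x - a) / k\<close> still lie in \<open>{a..a+L}\<close>.\<close>
lemma fdiff_bound_extend:
  assumes k: "k \<ge> 1" and ab: "a < b"
    and om: "\<And>h x. 0 < h \<Longrightarrow> a \<le> x \<Longrightarrow> x + real k * h \<le> b \<Longrightarrow> \<bar>fdiff k h g x\<bar> \<le> w"
    and half: "\<And>x. x \<in> {a..(a+b)/2} \<Longrightarrow> \<bar>g x\<bar> \<le> M"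
  obtains C where "C = (1 + 2 ^ k) ^ k" "\<And>x. x \<in> {a..b} \<Longrightarrow> \<bar>g x\<bar> \<le> C * (w + M)"
proof -
  define L where "L = (b - a) / 2"
  have L: "L > 0" "a + L = (a + b) / 2" "a + 2 * L = b"
    using ab by (auto simp: L_def field_simps)
  have M0: "M \<ge> 0" using half[of a] ab by auto
  have w0: "w \<ge> 0" using om[of "(b - a) / real k" a] ab k by (simp add: field_simps)
  \<comment> \<open>Stage \<open>i\<close> reaches \<open>L * i / k\<close> beyond the midpoint, and
    each stage costs a factor \<open>1 + 2 ^ k\<close>. After \<open>k\<close> stages the whole of
    [a, b] is covered.\<close>
  have "\<forall>x\<in>{a..a + L * (1 + real i / real k)}. \<bar>g x\<bar> \<le> (1 + 2 ^ k) ^ i * (w + M)" if "i \<le> k" for i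
    using that
  proof (induction i)
    case 0
    then show ?case using half w0 L by force
  next
    case (Suc i)
    define c where "c = a + L * (1 + real i / real k)"
    have IH: "\<bar>g x\<bar> \<le> (1 + 2 ^ k) ^ i * (w + M)" if "x \<in> {a..c}" for x
      using Suc that by (auto simp: c_def)
    let ?B = "(1 + 2 ^ k) ^ i * (w + M)"
    have pow1: "(1::real) \<le> (1 + 2 ^ k) ^ i" by (intro one_le_power) auto
    have wB: "w \<le> ?B"
      using mult_mono[OF pow1, of w "w + M"] M0 w0 by auto
    have B0: "0 \<le> ?B" using w0 M0 by auto
    show ?case
    proof
      fix x assume x: "x \<in> {a..a + L * (1 + real (Suc i) / real k)}"
      show "\<bar>g x\<bar> \<le> (1 + 2 ^ k) ^ Suc i * (w + M)"
      proof (cases "x \<le> c")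
        case True
        then have "\<bar>g x\<bar> \<le> ?B" using IH x by auto
        also have "\<dots> \<le> (1 + 2 ^ k) * ?B" using mult_right_mono[OF _ B0, of 1 "1 + 2 ^ k"] by simp
        finally show ?thesis by simp
      next
        case False
        define t where "t = (x - a) / real k"
        have xa: "x - a > 0"
        proof -
          have "0 \<le> L * (1 + real i / real k)" using L by (intro mult_nonneg_nonneg) auto
          then show ?thesis using False by (simp add: c_def)
        qed
        have t: "t > 0" "a + real k * t = x" using xa k by (auto simp: t_def)
        have "L * (1 + real (Suc i) / real k) \<le> L * 2"
          using L Suc.prems k by (intro mult_left_mono) (auto simp: field_simps)
        then have xb: "x \<le> b" using x L unfolding atLeastAtMost_iff by linarith
        have dk: "\<bar>fdiff k t g a\<bar> \<le> w" using om[of t a] t xb by auto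
        have pts: "\<bar>g (a + real j * t)\<bar> \<le> ?B" if "j < k" for j
        proof (rule IH)
          have "real j * t \<le> (real k - 1) * t" using that t by (intro mult_right_mono) auto
          also have "\<dots> = (x - a) * (1 - 1 / real k)"
            using k by (simp add: t_def field_simps)
          also have "\<dots> \<le> L * (1 + real (Suc i) / real k) * (1 - 1 / real k)"
            using x k by (intro mult_right_mono) auto
          also have "\<dots> = L * ((1 + real (Suc i) / real k) * (1 - 1 / real k))"
            by simp
          also have "\<dots> \<le> L * (1 + real i / real k)"
          proof (intro mult_left_mono)
            have "(1 + real (Suc i) / real k) * (1 - 1 / real k)
                = 1 + real i / real k - (real i + 1) / real k ^ 2"
              using k by (simp add: field_simps power2_eq_square)
            moreover have "(real i + 1) / real k ^ 2 \<ge> 0" by simp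
            ultimately show "(1 + real (Suc i) / real k) * (1 - 1 / real k) \<le> 1 + real i / real k"
              by linarith
          qed (use L in auto)
          finally show "a + real j * t \<in> {a..c}" using t by (auto simp: c_def)
        qed
        have "fdiff k t g a = (\<Sum>j\<le>k. (-1) ^ (k - j) * real (k choose j) * g (a + real j * t))"
          by (rule fdiff_eq_sum)
        also have "\<dots> = g x + (\<Sum>j<k. (-1) ^ (k - j) * real (k choose j) * g (a + real j * t))"
          using t(2) by (simp flip: lessThan_Suc_atMost)
        finally have "\<bar>g x\<bar> \<le> w + \<bar>\<Sum>j<k. (-1) ^ (k - j) * real (k choose j) * g (a + real j * t)\<bar>"
          using dk by linarith
        also have "\<bar>\<Sum>j<k. (-1) ^ (k - j) * real (k choose j) * g (a + real j * t)\<bar>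
            \<le> (\<Sum>j<k. real (k choose j) * ?B)"
          by (rule order.trans[OF sum_abs], rule sum_mono)
             (use pts in \<open>auto simp: abs_mult intro!: mult_left_mono\<close>)
        also have "\<dots> \<le> (\<Sum>j\<le>k. real (k choose j) * ?B)"
          using B0 by (intro sum_mono2) auto
        also have "\<dots> = 2 ^ k * ?B"
          by (simp only: sum_distrib_right[symmetric] sum_real_choose)
        finally show ?thesis using wB by (simp add: algebra_simps)
      qed
    qed
  qed
  from this[of k] have "\<bar>g x\<bar> \<le> (1 + 2 ^ k) ^ k * (w + M)" if "x \<in> {a..b}" for x
    using that k L by (auto simp: mult.commute)
  then show ?thesis using that by blast
qed

text \<open>\<open>omega\<close> is a supremum of reals, so it bounds the individual differences
  only once the set is known to be bounded; continuity on a compact interval gives this.\<close>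

lemma omega_bdd_above:
  assumes "continuous_on {a..b} g"
  shows "bdd_above ({0} \<union>
     {\<bar>\<Sum>i\<le>k. (-1) ^ (k - i) * real (k choose i) * g (x + real i * h)\<bar> | x h.
        0 < h \<and> h \<le> t \<and> a \<le> x \<and> x + real k * h \<le> b})"
proof -
  have "bounded (g ` {a..b})"
    using assms by (intro compact_imp_bounded compact_continuous_image) auto
  then obtain M where "\<forall>y\<in>g ` {a..b}. norm y \<le> M"
    unfolding bounded_iff by blast
  then have M: "\<And>x. x \<in> {a..b} \<Longrightarrow> \<bar>g x\<bar> \<le> M" by simp
  have "\<bar>\<Sum>i\<le>k. (-1) ^ (k - i) * real (k choose i) * g (x + real i * h)\<bar> \<le> (\<Sum>i\<le>k. real (k choose i) * M)"
    if "0 < h" "a \<le> x" "x + real k * h \<le> b" for x h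
  proof (rule order.trans[OF sum_abs], rule sum_mono)
    fix i assume "i \<in> {..k}"
    then have "0 \<le> real i * h" "real i * h \<le> real k * h"
      using that by (auto intro!: mult_right_mono)
    with that have "x + real i * h \<in> {a..b}" unfolding atLeastAtMost_iff by linarith
    then show "\<bar>(-1) ^ (k - i) * real (k choose i) * g (x + real i * h)\<bar> \<le> real (k choose i) * M"
      by (auto simp: abs_mult intro!: mult_left_mono M)
  qed
  then have "bdd_above {\<bar>\<Sum>i\<le>k. (-1) ^ (k - i) * real (k choose i) * g (x + real i * h)\<bar> | x h.
        0 < h \<and> h \<le> t \<and> a \<le> x \<and> x + real k * h \<le> b}"
    by (intro bdd_aboveI[of _ "\<Sum>i\<le>k. real (k choose i) * M"]) auto
  then show ?thesis by (subst bdd_above_Un) auto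
qed

lemma fdiff_le_omega:
  assumes "continuous_on {a..b} g" "0 < h" "h \<le> t" "a \<le> x" "x + real k * h \<le> b"
  shows "\<bar>fdiff k h g x\<bar> \<le> omega k g t a b"
  unfolding omega_def fdiff_eq_sum
  by (rule cSup_upper[OF _ omega_bdd_above]) (use assms in auto)

lemma omega_nonneg:
  assumes "continuous_on {a..b} g"
  shows "0 \<le> omega k g t a b"
  unfolding omega_def by (rule cSup_upper[OF _ omega_bdd_above]) (use assms in auto)

lemma omega_mono:
  assumes "continuous_on {a'..b'} g" "a' \<le> a" "b \<le> b'" "t \<le> t'"
  shows "omega k g t a b \<le> omega k g t' a' b'"
  unfolding omega_def
proof (rule cSup_subset_mono[OF _ omega_bdd_above[OF assms(1)]])
  show "{0} \<union> {\<bar>\<Sum>i\<le>k. (-1) ^ (k - i) * real (k choose i) * g (x + real i * h)\<bar> | x h.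
        0 < h \<and> h \<le> t \<and> a \<le> x \<and> x + real k * h \<le> b}
    \<subseteq> {0} \<union> {\<bar>\<Sum>i\<le>k. (-1) ^ (k - i) * real (k choose i) * g (x + real i * h)\<bar> | x h.
        0 < h \<and> h \<le> t' \<and> a' \<le> x \<and> x + real k * h \<le> b'}"
    using assms(2-4) by (intro Un_mono subset_refl Collect_mono impI) (elim exE conjE, intro exI conjI, assumption, auto)
qed auto

text \<open>Subtracting a polynomial of degree less than \<open>k\<close> leaves k-th differences
  unchanged. Hence the estimate on the left half, applied to \<open>g' - q\<close>, spreads to the
  whole interval by \<open>fdiff_bound_extend\<close>. All constants depend on \<open>k\<close>
  alone.\<close>

theorem whitney:
  assumes k: "k \<ge> 1"
  obtains C where "C \<ge> 0" "\<And>g a b. a < b \<Longrightarrow> continuous_on {a..b} g \<Longrightarrow>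
    \<exists>q. degree q < k \<and> (\<forall>x\<in>{a..b}. \<bar>g x - poly q x\<bar> \<le> C * omega k g (b - a) a b)"
proof -
  define C1 where "C1 = 1 + (4 * real k ^ 2) ^ k"
  define C2 where "C2 = (1 + 2 ^ k :: real) ^ k"
  have "\<exists>q. degree q < k \<and> (\<forall>x\<in>{a..b}. \<bar>g x - poly q x\<bar> \<le> C2 * (1 + C1) * omega k g (b - a) a b)"
    if ab: "a < b" and cont: "continuous_on {a..b} g" for g a b
  proof -
    define w where "w = omega k g (b - a) a b"
    \<comment> \<open>Clamping the argument makes the function continuous on the whole line, as the
      antiderivatives require; differences taken inside [a, b] do not see the change.\<close>
    define g' where "g' = (\<lambda>x. g (max a (min b x)))"
    have cont': "continuous_on UNIV g'"
      unfolding g'_def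
      by (rule continuous_on_compose2[OF cont]) (use ab in \<open>auto intro!: continuous_intros\<close>)
    have gg: "g' x = g x" if "x \<in> {a..b}" for x
      using that by (auto simp: g'_def)
    have om: "\<bar>fdiff k h g' x\<bar> \<le> w" if "0 < h" "a \<le> x" "x + real k * h \<le> b" for h x
    proof -
      have le: "x + real i * h \<le> x + real k * h" if "i \<le> k" for i
        using that \<open>0 < h\<close> by (auto intro!: mult_right_mono)
      then have "fdiff k h g' x = fdiff k h g x"
        unfolding fdiff_eq_sum
      proof (intro sum.cong refl)
        fix i assume "i \<in> {..k}"
        then have "0 \<le> real i * h" "x + real i * h \<le> x + real k * h" using le[of i] that by auto
        then have "x + real i * h \<in> {a..b}" using that unfolding atLeastAtMost_iff by linarith
        then show "(-1) ^ (k - i) * real (k choose i) * g' (x + real i * h)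
            = (-1) ^ (k - i) * real (k choose i) * g (x + real i * h)"
          by (simp add: gg)
      qed
      have "1 * h \<le> real k * h" using k that by (intro mult_right_mono) auto
      then have "h \<le> b - a" using that by linarith
      show ?thesis
        using fdiff_le_omega[OF cont] that \<open>h \<le> b - a\<close> \<open>fdiff k h g' x = fdiff k h g x\<close>
        by (simp add: w_def)
    qed
    obtain q where q: "degree q < k"
      "\<And>x. x \<in> {a..(a+b)/2} \<Longrightarrow> \<bar>g' x - poly q x\<bar> \<le> C1 * w"
      using whitney_left_half[OF k ab cont' om] unfolding C1_def by blast
    have "\<bar>fdiff k h (\<lambda>x. g' x - poly q x) x\<bar> \<le> w" if "0 < h" "a \<le> x" "x + real k * h \<le> b" for h x
      using om[OF that] q(1) that by (simp add: fdiff_diff fdiff_poly_eq_0)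
    from fdiff_bound_extend[OF k ab this q(2)]
    have "\<bar>g' x - poly q x\<bar> \<le> C2 * (w + C1 * w)" if "x \<in> {a..b}" for x
      unfolding C2_def using that by blast
    then show ?thesis
      using q(1) gg by (intro exI[of _ q]) (auto simp: w_def algebra_simps)
  qed
  moreover have "C2 * (1 + C1) \<ge> 0" by (auto simp: C2_def C1_def)
  ultimately show ?thesis using that by blast
qed

section \<open>B-splines\<close>

text \<open>The Cox-de Boor recursion for normalised B-splines. A bi-infinite knot sequence avoids
  boundary cases, and half-open intervals let exactly one B-spline of degree 0 be nonzero at each
  point between knots of the sequence.\<close>

primrec bspline :: "nat \<Rightarrow> (int \<Rightarrow> real) \<Rightarrow> int \<Rightarrow> real \<Rightarrow> real" where
  "bspline 0 t i x = (if t i \<le> x \<and> x < t (i + 1) then 1 else 0)"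
| "bspline (Suc m) t i x =
     (x - t i) / (t (i + int m + 1) - t i) * bspline m t i x
     + (t (i + int m + 2) - x) / (t (i + int m + 2) - t (i + 1)) * bspline m t (i + 1) x"

text \<open>The dual polynomial of Marsden's identity, built from the knots interior to the support
  of the B-spline with index \<open>i\<close>.\<close>

definition knot_poly :: "nat \<Rightarrow> (int \<Rightarrow> real) \<Rightarrow> int \<Rightarrow> real poly" where
  "knot_poly m t i = (\<Prod>l<m. [:t (i + int l + 1), -1:])"

text \<open>The de Boor--Fix functional giving the B-spline coefficients of a polynomial; by
  \<open>bcoeff_eq\<close> below the derivatives may be evaluated at any point instead of \<open>0\<close>.\<close>
definition bcoeff :: "nat \<Rightarrow> (int \<Rightarrow> real) \<Rightarrow> int \<Rightarrow> real poly \<Rightarrow> real" where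
  "bcoeff m t i q = (\<Sum>j\<le>m. (-1) ^ (m + j) * poly ((pderiv ^^ (m - j)) (knot_poly m t i)) 0
      * poly ((pderiv ^^ j) q) 0) / fact m"

lemma degree_knot_poly: "degree (knot_poly m t i) \<le> m"
  using degree_prod_sum_le[of "{..<m}" "\<lambda>l. [:t (i + int l + 1), -1:]"]
  by (simp add: knot_poly_def o_def)

text \<open>As a function of the evaluation point the alternating sum is a polynomial
  \<open>P\<close> whose derivative telescopes. The two end terms contain a derivative of order m +
  1 of \<open>knot_poly\<close> or of \<open>q\<close>, so they vanish and \<open>P\<close> is
  constant.\<close>

lemma bcoeff_eq:
  assumes "degree q \<le> m"
  shows "bcoeff m t i q = (\<Sum>j\<le>m. (-1) ^ (m + j) * poly ((pderiv ^^ (m - j)) (knot_poly m t i)) x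
      * poly ((pderiv ^^ j) q) x) / fact m"
proof -
  let ?\<psi> = "knot_poly m t i"
  define P where "P = (\<Sum>j\<le>m. smult ((-1) ^ (m + j)) ((pderiv ^^ (m - j)) ?\<psi> * (pderiv ^^ j) q))"
  define b where "b = (\<lambda>j. smult ((-1) ^ (m + j)) ((pderiv ^^ (Suc m - j)) ?\<psi> * (pderiv ^^ j) q))"
  have "pderiv P = (\<Sum>j\<le>m. b j - b (Suc j))"
    unfolding P_def higher_pderiv_sum[of 1, simplified]
  proof (rule sum.cong[OF refl])
    fix j assume "j \<in> {..m}"
    then have j: "Suc m - j = Suc (m - j)" by auto
    show "pderiv (smult ((-1) ^ (m + j)) ((pderiv ^^ (m - j)) ?\<psi> * (pderiv ^^ j) q)) = b j - b (Suc j)"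
      by (simp add: b_def j pderiv_smult pderiv_mult smult_add_right mult.commute del: funpow.simps(2))
         (simp add: mult.commute)
  qed
  also have "\<dots> = b 0 - b (Suc m)"
    by (rule sum_telescope)
  also have "\<dots> = 0"
    using assms degree_knot_poly[of m t i] by (simp add: b_def higher_pderiv_eq_0 del: funpow.simps(2))
  finally obtain c where c: "P = [:c:]"
    using pderiv_iszero by blast
  have "poly P x = poly P 0" by (simp add: c)
  then show ?thesis
    by (simp add: P_def bcoeff_def poly_sum mult.assoc)
qed

lemma bcoeff_diff: "bcoeff m t i (p - q) = bcoeff m t i p - bcoeff m t i q"
proof -
  have "(pderiv ^^ j) (p - q) = (pderiv ^^ j) p - (pderiv ^^ j) q" for j
    by (induction j) (simp_all add: pderiv_diff)
  then show ?thesis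
    by (simp add: bcoeff_def right_diff_distrib sum_subtractf diff_divide_distrib)
qed

lemma higher_pderiv_linear_power:
  fixes a :: real
  shows "l \<le> m \<Longrightarrow> (pderiv ^^ l) ([:a, -1:] ^ m) = smult ((-1) ^ l * fact m / fact (m - l)) ([:a, -1:] ^ (m - l))"
proof (induction l)
  case (Suc l)
  then obtain d where d: "m - l = Suc d" "m - Suc l = d" by (metis Suc_diff_Suc Suc_le_lessD)
  have "pderiv [:a, -1:] = [:-1:]" by (simp add: pderiv_pCons)
  then have "pderiv ([:a, -1:] ^ Suc d) = smult (- real (Suc d)) ([:a, -1:] ^ d)"
    by (simp only: pderiv_power_Suc) simp
  moreover have "(-1) ^ l * fact m / fact (Suc d) * - real (Suc d) = (-1) ^ Suc l * fact m / fact d"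
    by (simp add: divide_simps del: of_nat_Suc)
  moreover have "(pderiv ^^ Suc l) ([:a, -1:] ^ m)
      = pderiv (smult ((-1) ^ l * fact m / fact (Suc d)) ([:a, -1:] ^ Suc d))"
    using Suc d by simp
  ultimately show ?case
    by (simp only: pderiv_smult smult_smult d)
qed simp

lemma knot_poly_Suc:
  "knot_poly (Suc m) t i = knot_poly m t i * [:t (i + int m + 1), -1:]"
  "knot_poly (Suc m) t (i - 1) = [:t i, -1:] * knot_poly m t i"
proof -
  show "knot_poly (Suc m) t i = knot_poly m t i * [:t (i + int m + 1), -1:]"
    by (simp add: knot_poly_def mult.commute)
  show "knot_poly (Suc m) t (i - 1) = [:t i, -1:] * knot_poly m t i"
    unfolding knot_poly_def by (subst prod.lessThan_Suc_shift) (simp add: add.commute add.left_commute)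
qed

locale knot_sequence =
  fixes t :: "int \<Rightarrow> real"
  assumes knots: "strict_mono t"
begin

lemma knots_less [simp]: "t i < t j \<longleftrightarrow> i < j"
  using knots by (rule strict_mono_less)

lemma knots_le [simp]: "t i \<le> t j \<longleftrightarrow> i \<le> j"
  using knots by (rule strict_mono_less_eq)

lemma bspline_support: "bspline m t i x \<noteq> 0 \<Longrightarrow> t i \<le> x \<and> x < t (i + int m + 1)"
proof (induction m arbitrary: i)
  case (Suc m)
  from Suc.prems have "bspline m t i x \<noteq> 0 \<or> bspline m t (i + 1) x \<noteq> 0" by auto
  then show ?case
  proof
    assume "bspline m t i x \<noteq> 0"
    moreover have "t (i + int m + 1) \<le> t (i + int (Suc m) + 1)" by simp
    ultimately show ?thesis
      using Suc.IH[of i] by (metis order.strict_trans2)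
  next
    assume "bspline m t (i + 1) x \<noteq> 0"
    moreover have "t i \<le> t (i + 1)" "i + 1 + int m + 1 = i + int (Suc m) + 1" by simp_all
    ultimately show ?thesis
      using Suc.IH[of "i + 1"] by (metis order.trans)
  qed
qed (auto split: if_splits)

lemma bspline_eq_0: "x < t i \<or> t (i + int m + 1) \<le> x \<Longrightarrow> bspline m t i x = 0"
  using bspline_support[of m i x] by linarith

lemma bspline_Suc_left_knot [simp]: "bspline (Suc m) t i (t i) = 0"
  by (simp add: bspline_eq_0)

lemma bspline_nonneg: "0 \<le> bspline m t i x"
proof (induction m arbitrary: i)
  case (Suc m)
  have "0 \<le> (x - t i) / (t (i + int m + 1) - t i) * bspline m t i x"
    using Suc[of i] bspline_support[of m i x]
    by (cases "bspline m t i x = 0") (auto intro!: mult_nonneg_nonneg divide_nonneg_nonneg)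
  moreover have "0 \<le> (t (i + int m + 2) - x) / (t (i + int m + 2) - t (i + 1)) * bspline m t (i + 1) x"
    using Suc[of "i + 1"] bspline_support[of m "i + 1" x]
    by (cases "bspline m t (i + 1) x = 0")
       (auto intro!: mult_nonneg_nonneg divide_nonneg_nonneg simp: algebra_simps)
  ultimately show ?case by simp
qed auto

text \<open>Inserting the recursion and shifting the index in its second part collects, at each
  B-spline of degree \<open>m\<close>, a convex-type combination of two dual polynomials with the
  common factor \<open>knot_poly m t i\<close>. The combination equals x - y times that factor,
  whatever \<open>i\<close> is.\<close>

lemma marsden_identity:
  assumes "t j \<le> x" "x < t (j + 1)" "lo \<le> j - int m" "j \<le> hi"
  shows "(\<Sum>i\<in>{lo..hi}. poly (knot_poly m t i) y * bspline m t i x) = (x - y) ^ m"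
  using assms(3)
proof (induction m)
  case 0
  have eq: "bspline 0 t i x = (if i = j then 1 else 0)" for i
  proof -
    have "i = j" if "t i \<le> x" "x < t (i + 1)"
    proof -
      have "t i < t (j + 1)" "t j < t (i + 1)" using that assms(1,2) by linarith+
      then show ?thesis by simp
    qed
    then show ?thesis using assms(1,2) by (simp only: bspline.simps split: if_split) blast
  qed
  show ?case using 0 assms(4) by (simp add: eq knot_poly_def del: bspline.simps)
next
  case (Suc m)
  define w where "w = (\<lambda>i. (x - t i) / (t (i + int m + 1) - t i))"
  define B where "B = (\<lambda>i. bspline m t i x)"
  define \<psi> where "\<psi> = (\<lambda>m i. poly (knot_poly m t i) y)"
  have w1: "(t (i + int m + 2) - x) / (t (i + int m + 2) - t (i + 1)) = 1 - w (i + 1)" for i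
  proof -
    have "t (i + int m + 2) - t (i + 1) \<noteq> 0" "i + 1 + int m + 1 = i + int m + 2"
      using knots_less[of "i + 1" "i + int m + 2"] by (auto simp del: knots_less)
    then show ?thesis by (simp only: w_def) (simp add: divide_simps)
  qed
  have rec: "bspline (Suc m) t i x = w i * B i + (1 - w (i + 1)) * B (i + 1)" for i
    unfolding bspline.simps(2) w1 by (simp only: w_def B_def)
  \<comment> \<open>The shifted sum differs from the original one only in these two boundary terms,
    whose supports do not contain \<open>x\<close>.\<close>
  have z: "B lo = 0" "B (hi + 1) = 0"
  proof -
    have "t (lo + int m + 1) \<le> t j" "t (j + 1) \<le> t (hi + 1)" using Suc.prems assms(4) by simp_all
    then have "t (lo + int m + 1) \<le> x" "x < t (hi + 1)" using assms(1,2) by linarith+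
    then show "B lo = 0" "B (hi + 1) = 0" by (simp_all add: B_def bspline_eq_0)
  qed
  have "(\<Sum>i\<in>{lo..hi}. \<psi> (Suc m) i * bspline (Suc m) t i x)
      = (\<Sum>i\<in>{lo..hi}. \<psi> (Suc m) i * w i * B i)
        + (\<Sum>i\<in>{lo..hi}. \<psi> (Suc m) i * (1 - w (i + 1)) * B (i + 1))"
    unfolding rec distrib_left sum.distrib by (simp only: mult.assoc)
  also have "(\<Sum>i\<in>{lo..hi}. \<psi> (Suc m) i * (1 - w (i + 1)) * B (i + 1))
      = (\<Sum>i\<in>{lo+1..hi+1}. \<psi> (Suc m) (i - 1) * (1 - w i) * B i)"
    by (rule sum.reindex_bij_witness[of _ "\<lambda>i. i - 1" "\<lambda>i. i + 1"]) auto
  also have "\<dots> = (\<Sum>i\<in>{lo..hi}. \<psi> (Suc m) (i - 1) * (1 - w i) * B i)"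
  proof (rule sum.mono_neutral_cong)
    fix i
    show "\<psi> (Suc m) (i - 1) * (1 - w i) * B i = 0" if "i \<in> {lo+1..hi+1} - {lo..hi}"
    proof -
      have "i = hi + 1" using that by auto
      then show ?thesis using z by simp
    qed
    show "\<psi> (Suc m) (i - 1) * (1 - w i) * B i = 0" if "i \<in> {lo..hi} - {lo+1..hi+1}"
    proof -
      have "i = lo" using that by auto
      then show ?thesis using z by simp
    qed
  qed auto
  also have "(\<Sum>i\<in>{lo..hi}. \<psi> (Suc m) i * w i * B i) + \<dots>
      = (\<Sum>i\<in>{lo..hi}. (\<psi> (Suc m) i * w i + \<psi> (Suc m) (i - 1) * (1 - w i)) * B i)"
    by (simp only: sum.distrib[symmetric] distrib_right[symmetric])
  also have "\<dots> = (\<Sum>i\<in>{lo..hi}. (x - y) * (\<psi> m i * B i))"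
  proof (rule sum.cong[OF refl])
    fix i
    have d: "t (i + int m + 1) - t i \<noteq> 0" using knots_less[of i "i + int m + 1"] by (auto simp del: knots_less)
    \<comment> \<open>Linear interpolation of u - y at the nodes \<open>t i\<close> and
      \<open>t (i + int m + 1)\<close>, evaluated at \<open>x\<close>, is exact.\<close>
    have E: "(t (i + int m + 1) - y) * w i + (t i - y) * (1 - w i) = x - y"
    proof -
      have "(t (i + int m + 1) - t i) * w i = x - t i" using d by (simp add: w_def)
      then show ?thesis by (simp add: algebra_simps)
    qed
    have P1: "\<psi> (Suc m) i = \<psi> m i * (t (i + int m + 1) - y)"
      by (simp add: \<psi>_def knot_poly_Suc(1) algebra_simps)
    have P2: "\<psi> (Suc m) (i - 1) = \<psi> m i * (t i - y)"
      unfolding \<psi>_def knot_poly_Suc(2) by (simp add: algebra_simps)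
    have "\<psi> (Suc m) i * w i + \<psi> (Suc m) (i - 1) * (1 - w i)
        = \<psi> m i * ((t (i + int m + 1) - y) * w i + (t i - y) * (1 - w i))"
      by (simp only: P1 P2 mult.assoc distrib_left)
    also have "\<dots> = \<psi> m i * (x - y)" by (simp only: E)
    finally have F: "\<psi> (Suc m) i * w i + \<psi> (Suc m) (i - 1) * (1 - w i) = \<psi> m i * (x - y)" .
    show "(\<psi> (Suc m) i * w i + \<psi> (Suc m) (i - 1) * (1 - w i)) * B i = (x - y) * (\<psi> m i * B i)"
      unfolding F by (simp only: mult_ac)
  qed
  also have "\<dots> = (x - y) * (x - y) ^ m"
    using Suc by (simp add: sum_distrib_left[symmetric] \<psi>_def B_def)
  finally show ?case by (simp add: \<psi>_def del: bspline.simps)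
qed

text \<open>Marsden's identity is differentiated in y and evaluated at y = x: only the derivative of
  order \<open>m\<close> survives. Since \<open>bcoeff_eq\<close> permits evaluating the de Boor-Fix
  functional at \<open>x\<close>, just its term with j = 0 remains, which is the value of
  \<open>q\<close> at \<open>x\<close>.\<close>

lemma bspline_reproduces_poly_half_open:
  assumes "t j \<le> x" "x < t (j + 1)" "lo \<le> j - int m" "j \<le> hi" "degree q \<le> m"
  shows "(\<Sum>i\<in>{lo..hi}. bcoeff m t i q * bspline m t i x) = poly q x"
proof -
  have id: "(\<Sum>i\<in>{lo..hi}. smult (bspline m t i x) (knot_poly m t i)) = [:x, -1:] ^ m"
    by (rule poly_eq_poly_eq_iff[THEN iffD1])
       (auto simp: fun_eq_iff poly_sum marsden_identity[OF assms(1-4), symmetric] mult.commute)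
  have D: "(\<Sum>i\<in>{lo..hi}. bspline m t i x * poly ((pderiv ^^ l) (knot_poly m t i)) x)
      = (if l = m then (-1) ^ m * fact m else 0)" if "l \<le> m" for l
  proof -
    have "(\<Sum>i\<in>{lo..hi}. bspline m t i x * poly ((pderiv ^^ l) (knot_poly m t i)) x)
        = poly ((pderiv ^^ l) ([:x, -1:] ^ m)) x"
      unfolding id[symmetric] by (simp add: higher_pderiv_sum higher_pderiv_smult poly_sum)
    then show ?thesis using that by (simp add: higher_pderiv_linear_power)
  qed
  have "(\<Sum>i\<in>{lo..hi}. bcoeff m t i q * bspline m t i x)
      = (\<Sum>i\<in>{lo..hi}. \<Sum>j\<le>m. (-1) ^ (m + j) * poly ((pderiv ^^ j) q) x / fact m
          * (bspline m t i x * poly ((pderiv ^^ (m - j)) (knot_poly m t i)) x))"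
    unfolding bcoeff_eq[OF assms(5), of t _ x] sum_divide_distrib sum_distrib_right
    by (intro sum.cong refl) simp
  also have "\<dots> = (\<Sum>j\<le>m. (-1) ^ (m + j) * poly ((pderiv ^^ j) q) x / fact m
      * (if m - j = m then (-1) ^ m * fact m else 0))"
    by (subst sum.swap) (simp add: sum_distrib_left[symmetric] D del: times_divide_eq_left)
  also have "\<dots> = (\<Sum>j\<le>m. if j = 0 then poly q x else 0)"
    by (intro sum.cong refl) (auto simp: power_add[symmetric] mult_2[symmetric])
  finally show ?thesis by simp
qed

text \<open>Closed knot intervals are possible because the degree is at least 1: at the right end
  point the next B-spline is only about to start and is still 0.\<close>

lemma sum_bspline_restrict:
  assumes "t j \<le> x" "x \<le> t (j + 1)" "lo \<le> j - int (Suc m)" "j \<le> hi"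
  shows "(\<Sum>i\<in>{lo..hi}. c i * bspline (Suc m) t i x)
    = (\<Sum>i\<in>{j - int (Suc m)..j}. c i * bspline (Suc m) t i x)"
proof (rule sum.mono_neutral_right)
  show "\<forall>i\<in>{lo..hi} - {j - int (Suc m)..j}. c i * bspline (Suc m) t i x = 0"
  proof
    fix i assume "i \<in> {lo..hi} - {j - int (Suc m)..j}"
    then consider "i + int (Suc m) + 1 \<le> j" | "j + 1 \<le> i" by force
    then have "bspline (Suc m) t i x = 0"
    proof cases
      case 1
      then have "t (i + int (Suc m) + 1) \<le> t j" by simp
      then show ?thesis using assms by (intro bspline_eq_0) linarith
    next
      case 2
      then have "t (j + 1) \<le> t i" by simp
      then have "x \<le> t i" using assms by linarith
      then show ?thesis by (cases "x = t i") (auto intro: bspline_eq_0 simp del: bspline.simps)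
    qed
    then show "c i * bspline (Suc m) t i x = 0" by simp
  qed
qed (use assms in auto)

lemma bspline_reproduces_poly:
  assumes "t j \<le> x" "x \<le> t (j + 1)" "degree q \<le> Suc m"
  shows "(\<Sum>i\<in>{j - int (Suc m)..j}. bcoeff (Suc m) t i q * bspline (Suc m) t i x) = poly q x"
proof (cases "x = t (j + 1)")
  case False
  then show ?thesis using assms by (intro bspline_reproduces_poly_half_open) auto
next
  case True
  have "(\<Sum>i\<in>{j - int (Suc m)..j + 1}. bcoeff (Suc m) t i q * bspline (Suc m) t i x) = poly q x"
    by (rule bspline_reproduces_poly_half_open[of "j + 1"]) (use assms True in auto)
  then show ?thesis using assms by (subst (asm) sum_bspline_restrict[of j]) auto
qed

text \<open>The de Boor-Fix functional gives 1 on the constant polynomial 1, since only the leading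
  coefficient of \<open>knot_poly\<close> enters. Partition of unity turns a uniform bound on
  coefficient errors into the same bound for the spline.\<close>

lemma sum_bspline_eq_1:
  assumes "t j \<le> x" "x \<le> t (j + 1)"
  shows "(\<Sum>i\<in>{j - int (Suc m)..j}. bspline (Suc m) t i x) = 1"
proof -
  have "coeff (knot_poly m t i) m = (-1) ^ m" for i m
  proof (induction m)
    case (Suc m)
    then show ?case
      using degree_knot_poly[of m t i] by (simp add: knot_poly_Suc coeff_eq_0)
  qed (simp add: knot_poly_def)
  then have "poly ((pderiv ^^ m) (knot_poly m t i)) 0 = (-1) ^ m * fact m" for i m
    by (simp add: poly_0_coeff_0 coeff_higher_pderiv pochhammer_fact)
  moreover have "(pderiv ^^ j) (1::real poly) = 0" if "j > 0" for j
    using that by (intro higher_pderiv_eq_0) auto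
  ultimately have "bcoeff (Suc m) t i 1 = 1" for i
    unfolding bcoeff_def
    by (subst sum.atMost_Suc_shift) (simp add: power_add[symmetric] mult_2[symmetric] del: funpow.simps(2) power_Suc)
  then show ?thesis using bspline_reproduces_poly[OF assms, of 1 m] by (simp del: bspline.simps)
qed

end

declare bspline.simps(2) [simp del]

section \<open>Derivatives up to finitely many points, and scale-invariant bounds for B-spline
  coefficients\<close>

lemma DERIV_of_DERIV_off_finite:
  fixes f g :: "real \<Rightarrow> real"
  assumes "finite S" "continuous_on UNIV f" "continuous_on UNIV g"
    and "\<And>x. x \<notin> S \<Longrightarrow> (f has_real_derivative g x) (at x)"
  shows "(f has_real_derivative g x) (at x)"
proof -
  define a where "a = x - 1"
  have int: "(g has_integral (f u - f a)) {a..u}" if "a \<le> u" for u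
    by (rule fundamental_theorem_of_calculus_strong[OF assms(1) that])
       (use assms in \<open>auto simp: has_real_derivative_iff_has_vector_derivative[symmetric]
          intro: continuous_on_subset\<close>)
  have int': "integral {a..u} g + f a = f u" if "a \<le> u" for u
    using integral_unique[OF int[OF that]] by simp
  have "((\<lambda>u. integral {a..u} g) has_real_derivative g x) (at x within {a..x + 1})"
    using assms(3) by (intro integral_has_real_derivative) (auto simp: a_def intro: continuous_on_subset)
  then have "((\<lambda>u. integral {a..u} g + f a) has_real_derivative g x) (at x within {a..x + 1})"
    by (auto intro!: derivative_eq_intros)
  then have "(f has_real_derivative g x) (at x within {a..x + 1})"
    by (rule has_field_derivative_transform_within[where d = 1])
       (use int' in \<open>auto simp: a_def\<close>)
  moreover have "at x within {a..x + 1} = at x"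
    by (rule at_within_Icc_at) (auto simp: a_def)
  ultimately show ?thesis by simp
qed

text \<open>For degree d + 1 the combination p(x) - 2^(d+1) p(x/2) kills the top coefficient and
  multiplies the coefficient of order j \<le> d by 1 - 2^(d+1-j), which has modulus at least 1. So
  the lower coefficients are bounded by induction, and the top one by p(1) minus their sum.\<close>

lemma poly_coeff_bound:
  obtains C :: real where "C \<ge> 0"
    "\<And>p M j. degree p \<le> d \<Longrightarrow> (\<And>x. x \<in> {0..1} \<Longrightarrow> \<bar>poly p x\<bar> \<le> M) \<Longrightarrow> \<bar>coeff p j\<bar> \<le> C * M"
proof -
  have "\<exists>C::real. C \<ge> 0 \<and> (\<forall>p M. degree p \<le> d \<longrightarrow> (\<forall>x\<in>{0..1}. \<bar>poly p x\<bar> \<le> M) \<longrightarrow> (\<forall>j. \<bar>coeff p j\<bar> \<le> C * M))"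
  proof (induction d)
    case 0
    show ?case
    proof (intro exI[of _ 1] conjI allI impI)
      fix p :: "real poly" and M j
      assume p: "degree p \<le> 0" "\<forall>x\<in>{0..1}. \<bar>poly p x\<bar> \<le> M"
      then obtain c where c: "p = [:c:]" by (metis degree_eq_zeroE le_zero_eq)
      then have "\<bar>c\<bar> \<le> M" using bspec[OF p(2), of 0] by simp
      then show "\<bar>coeff p j\<bar> \<le> 1 * M" using c by (cases j) auto
    qed simp
  next
    case (Suc d)
    then obtain C :: real where C: "C \<ge> 0" and IH: "\<And>p M j. degree p \<le> d \<Longrightarrow>
        \<forall>x\<in>{0..1}. \<bar>poly p x\<bar> \<le> M \<Longrightarrow> \<bar>coeff p j\<bar> \<le> C * M"
      by blast
    let ?e = "2 ^ Suc d :: real"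
    define C' where "C' = C * (1 + ?e)"
    show ?case
    proof (intro exI[of _ "1 + real (d + 2) * C'"] conjI allI impI)
      show "0 \<le> 1 + real (d + 2) * C'" using C by (simp add: C'_def)
      fix p :: "real poly" and M j
      assume p: "degree p \<le> Suc d" "\<forall>x\<in>{0..1}. \<bar>poly p x\<bar> \<le> M"
      have M0: "M \<ge> 0" using p(2)[THEN bspec, of 0] by auto
      define p' where "p' = p - smult ?e (pcompose p [:0, 1/2:])"
      have cp': "coeff p' j = (1 - ?e * (1/2) ^ j) * coeff p j" for j
        by (simp add: p'_def coeff_pcompose_linear algebra_simps)
      have "degree p' \<le> d"
      proof (rule degree_le, intro allI impI)
        fix i assume "d < i"
        then show "coeff p' i = 0"
          using p(1) by (cases "i = Suc d") (auto simp: cp' coeff_eq_0 power_divide)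
      qed
      moreover have "\<forall>x\<in>{0..1}. \<bar>poly p' x\<bar> \<le> (1 + ?e) * M"
      proof
        fix x :: real assume x: "x \<in> {0..1}"
        have "\<bar>poly p' x\<bar> \<le> \<bar>poly p x\<bar> + ?e * \<bar>poly p (x / 2)\<bar>"
          by (simp add: p'_def poly_pcompose mult.commute abs_mult order.trans[OF abs_triangle_ineq4])
        also have "\<dots> \<le> M + ?e * M"
          using x p(2) by (intro add_mono mult_left_mono) auto
        finally show "\<bar>poly p' x\<bar> \<le> (1 + ?e) * M" by (simp add: algebra_simps)
      qed
      ultimately have bound: "\<bar>coeff p' j\<bar> \<le> C' * M" for j
        using IH[of p' "(1 + ?e) * M" j] by (simp add: C'_def mult.assoc)
      have low: "\<bar>coeff p j\<bar> \<le> C' * M" if "j \<le> d" for j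
      proof -
        have "?e * (1/2) ^ j = 2 ^ (Suc d - j)"
          using that by (simp add: power_diff power_divide)
        moreover have "(2::real) ^ 1 \<le> 2 ^ (Suc d - j)" using that by (intro power_increasing) auto
        ultimately have "1 \<le> \<bar>1 - ?e * (1/2) ^ j\<bar>" by simp
        then have "1 * \<bar>coeff p j\<bar> \<le> \<bar>1 - ?e * (1/2) ^ j\<bar> * \<bar>coeff p j\<bar>"
          by (intro mult_right_mono) auto
        also have "\<dots> = \<bar>coeff p' j\<bar>" by (simp only: cp' abs_mult)
        also have "\<dots> \<le> C' * M" by (rule bound)
        finally show ?thesis by simp
      qed
      have C'0: "0 \<le> C' * M" using M0 C by (simp add: C'_def)
      have "poly p 1 = (\<Sum>i\<le>degree p. coeff p i)"
        by (simp add: poly_altdef)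
      also have "\<dots> = (\<Sum>i\<le>Suc d. coeff p i)"
        by (rule sum.mono_neutral_left) (use p(1) in \<open>auto simp: coeff_eq_0\<close>)
      finally have "poly p 1 = (\<Sum>i\<le>Suc d. coeff p i)" .
      then have "coeff p (Suc d) = poly p 1 - (\<Sum>i\<le>d. coeff p i)" by simp
      also have "\<bar>\<dots>\<bar> \<le> M + (\<Sum>i\<le>d. C' * M)"
        using p(2) low
        by (intro order.trans[OF abs_triangle_ineq4] add_mono order.trans[OF sum_abs] sum_mono) auto
      finally have top: "\<bar>coeff p (Suc d)\<bar> \<le> M + real (d + 1) * (C' * M)" by simp
      have "\<bar>coeff p j\<bar> \<le> M + real (d + 2) * (C' * M)"
      proof -
        consider "j \<le> d" | "j = Suc d" | "j > Suc d" by linarith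
        then show ?thesis
        proof cases
          case 1
          have "0 \<le> real (d + 1) * (C' * M)" by (rule mult_nonneg_nonneg[OF of_nat_0_le_iff C'0])
          then show ?thesis using low[OF 1] M0 by (simp add: algebra_simps)
        next
          case 2
          then show ?thesis using top C'0 by (simp add: algebra_simps)
        next
          case 3
          have "0 \<le> real (d + 2) * (C' * M)" by (rule mult_nonneg_nonneg[OF of_nat_0_le_iff C'0])
          then show ?thesis using 3 p(1) M0 by (simp add: coeff_eq_0)
        qed
      qed
      then show "\<bar>coeff p j\<bar> \<le> (1 + real (d + 2) * C') * M" by (simp add: algebra_simps)
    qed
  qed
  then show ?thesis using that by blast
qed

text \<open>A Markov-type inequality obtained by rescaling to [0, 1], where derivatives at the left
  end are multiples of coefficients. The left end suffices, as the coefficient functional is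
  evaluated there.\<close>

lemma markov_bound:
  obtains C :: real where "C \<ge> 0"
    "\<And>p M j a h. degree p \<le> d \<Longrightarrow> 0 < h \<Longrightarrow> (\<And>x. x \<in> {a..a + h} \<Longrightarrow> \<bar>poly p x\<bar> \<le> M)
      \<Longrightarrow> j \<le> d \<Longrightarrow> \<bar>poly ((pderiv ^^ j) p) a\<bar> * h ^ j \<le> C * M"
proof -
  obtain C :: real where C: "C \<ge> 0"
    "\<And>p M j. degree p \<le> d \<Longrightarrow> (\<And>x. x \<in> {0..1} \<Longrightarrow> \<bar>poly p x\<bar> \<le> M) \<Longrightarrow> \<bar>coeff p j\<bar> \<le> C * M"
    by (rule poly_coeff_bound[where d = d]) blast
  have "\<bar>poly ((pderiv ^^ j) p) a\<bar> * h ^ j \<le> fact d * C * M"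
    if p: "degree p \<le> d" "0 < h" "\<And>x. x \<in> {a..a + h} \<Longrightarrow> \<bar>poly p x\<bar> \<le> M" and j: "j \<le> d" for p M j a h
  proof -
    define p' where "p' = pcompose p [:a, h:]"
    have lin: "pderiv [:a, h:] = [:h:]" by (simp add: pderiv_pCons)
    have der: "(pderiv ^^ j) p' = smult (h ^ j) (pcompose ((pderiv ^^ j) p) [:a, h:])" for j
      by (induction j) (simp_all add: p'_def pderiv_smult pderiv_pcompose lin mult.commute)
    have "\<bar>poly p' x\<bar> \<le> M" if "x \<in> {0..1}" for x
      using p(3)[of "a + h * x"] p(2) that mult_left_mono[of x 1 h]
      by (simp add: p'_def poly_pcompose mult.commute)
    moreover have "degree p' \<le> d" using p(1) by (simp add: p'_def degree_pcompose)
    ultimately have cb: "\<bar>coeff p' j\<bar> \<le> C * M" using C(2) by blast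
    have "poly ((pderiv ^^ j) p) a * h ^ j = poly ((pderiv ^^ j) p') 0"
      by (simp add: der poly_pcompose)
    also have "\<dots> = fact j * coeff p' j"
      by (simp add: poly_0_coeff_0 coeff_higher_pderiv pochhammer_fact)
    finally have "\<bar>poly ((pderiv ^^ j) p) a\<bar> * h ^ j = fact j * \<bar>coeff p' j\<bar>"
      using p(2) by (metis abs_mult abs_of_nonneg fact_ge_zero less_imp_le zero_le_power)
    also have "\<dots> \<le> fact d * (C * M)"
      using cb j by (intro mult_mono fact_mono) auto
    finally show ?thesis by (simp add: mult.assoc)
  qed
  moreover have "fact d * C \<ge> 0" using C by simp
  ultimately show ?thesis using that by blast
qed

text \<open>Evaluated at \<open>a\<close>, the j-th derivative of \<open>q\<close> costs h^(-j) and
  the complementary derivative of \<open>knot_poly\<close> costs h^(-(m-j)), while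
  \<open>knot_poly\<close> itself has size ((K + 1) h)^m. The powers of \<open>h\<close> cancel, and
  the knots enter only through \<open>K\<close>.\<close>

lemma bcoeff_bound:
  obtains C :: real where "C \<ge> 0"
    "\<And>t i q a h K M. degree q \<le> m \<Longrightarrow> 0 < h \<Longrightarrow> 0 \<le> K \<Longrightarrow> (\<And>x. x \<in> {a..a + h} \<Longrightarrow> \<bar>poly q x\<bar> \<le> M)
      \<Longrightarrow> (\<And>l. l < m \<Longrightarrow> \<bar>t (i + int l + 1) - a\<bar> \<le> K * h)
      \<Longrightarrow> \<bar>bcoeff m t i q\<bar> \<le> C * (K + 1) ^ m * M"
proof -
  obtain C :: real where C: "C \<ge> 0"
    "\<And>p M j a h. degree p \<le> m \<Longrightarrow> 0 < h \<Longrightarrow> (\<And>x. x \<in> {a..a + h} \<Longrightarrow> \<bar>poly p x\<bar> \<le> M)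
      \<Longrightarrow> j \<le> m \<Longrightarrow> \<bar>poly ((pderiv ^^ j) p) a\<bar> * h ^ j \<le> C * M"
    by (rule markov_bound[where d = m]) blast
  have "\<bar>bcoeff m t i q\<bar> \<le> (real (m + 1) * C\<^sup>2) * (K + 1) ^ m * M"
    if q: "degree q \<le> m" "0 < h" "0 \<le> K" "\<And>x. x \<in> {a..a + h} \<Longrightarrow> \<bar>poly q x\<bar> \<le> M"
      and kn: "\<And>l. l < m \<Longrightarrow> \<bar>t (i + int l + 1) - a\<bar> \<le> K * h" for t i q a h K M
  proof -
    have M0: "M \<ge> 0" using q(4)[of a] q(2) by auto
    have psi: "\<bar>poly (knot_poly m t i) x\<bar> \<le> ((K + 1) * h) ^ m" if x: "x \<in> {a..a + h}" for x
    proof -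
      have "\<bar>poly (knot_poly m t i) x\<bar> = (\<Prod>l<m. \<bar>t (i + int l + 1) - x\<bar>)"
        by (simp add: knot_poly_def poly_prod abs_prod)
      also have "\<dots> \<le> (\<Prod>l<m. (K + 1) * h)"
      proof (rule prod_mono)
        fix l assume "l \<in> {..<m}"
        with kn[of l] x show "0 \<le> \<bar>t (i + int l + 1) - x\<bar> \<and> \<bar>t (i + int l + 1) - x\<bar> \<le> (K + 1) * h"
          by (auto simp: algebra_simps)
      qed
      finally show ?thesis by simp
    qed
    have summand: "\<bar>(-1) ^ (m + j) * poly ((pderiv ^^ (m - j)) (knot_poly m t i)) a * poly ((pderiv ^^ j) q) a\<bar>
        \<le> C\<^sup>2 * (K + 1) ^ m * M" if j: "j \<le> m" for j
    proof -
      let ?A = "\<bar>poly ((pderiv ^^ (m - j)) (knot_poly m t i)) a\<bar>" and ?B = "\<bar>poly ((pderiv ^^ j) q) a\<bar>"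
      have "?A * h ^ (m - j) * (?B * h ^ j) \<le> C * ((K + 1) * h) ^ m * (C * M)"
        using q j C(1) M0
        by (intro mult_mono C(2) psi) (auto simp: degree_knot_poly)
      also have "?A * h ^ (m - j) * (?B * h ^ j) = ?A * ?B * h ^ m"
        using j by (simp add: power_add[symmetric] mult_ac)
      finally have "?A * ?B * h ^ m \<le> (C\<^sup>2 * (K + 1) ^ m * M) * h ^ m"
        by (simp add: power_mult_distrib power2_eq_square mult_ac)
      then have "?A * ?B \<le> C\<^sup>2 * (K + 1) ^ m * M" using q(2) by simp
      then show ?thesis by (simp add: abs_mult)
    qed
    have "\<bar>bcoeff m t i q\<bar> \<le> (\<Sum>j\<le>m. C\<^sup>2 * (K + 1) ^ m * M) / fact m"
    proof -
      have "\<bar>\<Sum>j\<le>m. (-1) ^ (m + j) * poly ((pderiv ^^ (m - j)) (knot_poly m t i)) a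
          * poly ((pderiv ^^ j) q) a\<bar> \<le> (\<Sum>j\<le>m. C\<^sup>2 * (K + 1) ^ m * M)"
        by (rule order.trans[OF sum_abs sum_mono]) (use summand in auto)
      then show ?thesis
        unfolding bcoeff_eq[OF q(1), of t i a] abs_divide by (simp add: divide_right_mono)
    qed
    also have "\<dots> \<le> (\<Sum>j\<le>m. C\<^sup>2 * (K + 1) ^ m * M) / 1"
      using M0 q(3) by (intro divide_left_mono sum_nonneg) (auto simp: fact_ge_1)
    finally show ?thesis by (simp add: algebra_simps)
  qed
  moreover have "real (m + 1) * C\<^sup>2 \<ge> 0" by simp
  ultimately show ?thesis using that by blast
qed

section \<open>Derivatives and smoothness of B-splines\<close>

lemma DERIV_ratio_left: "((\<lambda>x. (x - a) / c) has_real_derivative 1 / c) (at x)"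
  for a c x :: real
  by (rule DERIV_cdivide) (auto intro!: derivative_eq_intros)

lemma DERIV_ratio_right: "((\<lambda>x. (a - x) / c) has_real_derivative - 1 / c) (at x)"
  for a c x :: real
  by (rule DERIV_cdivide) (auto intro!: derivative_eq_intros)

context knot_sequence
begin

definition dbspline :: "nat \<Rightarrow> int \<Rightarrow> real \<Rightarrow> real" where
  "dbspline m i x = real (Suc m) * (bspline m t i x / (t (i + int m + 1) - t i)
     - bspline m t (i + 1) x / (t (i + int m + 2) - t (i + 1)))"

lemma bspline_0_DERIV:
  assumes "x \<noteq> t i" "x \<noteq> t (i + 1)"
  shows "(bspline 0 t i has_real_derivative 0) (at x)"
proof -
  define S where "S = (if x < t i then {..<t i} else if x < t (i + 1) then {t i<..<t (i + 1)} else {t (i + 1)<..})"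
  have S: "open S" "x \<in> S" using assms by (auto simp: S_def)
  have "bspline 0 t i x = bspline 0 t i u" if "u \<in> S" for u
  proof -
    have "t i < t (i + 1)" by simp
    then show ?thesis using that assms by (auto simp: S_def split: if_splits)
  qed
  then show ?thesis
    by (rule has_field_derivative_transform_within_open[OF DERIV_const S])
qed

lemma bspline_DERIV_off_knots:
  "x \<notin> t ` {i..i + int m + 2} \<Longrightarrow> (bspline (Suc m) t i has_real_derivative dbspline m i x) (at x)"
proof (induction m arbitrary: i)
  case 0
  have eq: "bspline (Suc 0) t i = (\<lambda>x. (x - t i) / (t (i + 1) - t i) * bspline 0 t i x
     + (t (i + 2) - x) / (t (i + 2) - t (i + 1)) * bspline 0 t (i + 1) x)"
    by (simp add: fun_eq_iff bspline.simps(2))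
  have k: "x \<noteq> t i" "x \<noteq> t (i + 1)" "x \<noteq> t (i + 1 + 1)"
    using 0 by auto
  show ?case
    unfolding eq dbspline_def
    by (rule DERIV_cong[OF DERIV_add[OF DERIV_mult[OF DERIV_ratio_left bspline_0_DERIV[OF k(1,2)]]
            DERIV_mult[OF DERIV_ratio_right bspline_0_DERIV[OF k(2,3)]]]])
       simp
next
  case (Suc m)
  have eq: "bspline (Suc (Suc m)) t i = (\<lambda>x. (x - t i) / (t (i + int m + 2) - t i) * bspline (Suc m) t i x
     + (t (i + int m + 3) - x) / (t (i + int m + 3) - t (i + 1)) * bspline (Suc m) t (i + 1) x)"
    by (simp add: fun_eq_iff bspline.simps(2) add_ac)
  have IH1: "(bspline (Suc m) t i has_real_derivative dbspline m i x) (at x)"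
    by (rule Suc.IH) (use Suc.prems in auto)
  have IH2: "(bspline (Suc m) t (i + 1) has_real_derivative dbspline m (i + 1) x) (at x)"
    by (rule Suc.IH) (use Suc.prems in auto)
  define a where "a = t i"
  define b where "b = t (i + 1)"
  define c where "c = t (i + 2)"
  define d where "d = t (i + int m + 1)"
  define e where "e = t (i + int m + 2)"
  define f where "f = t (i + int m + 3)"
  note defs = a_def b_def c_def d_def e_def f_def
  define B0 B1 B2 where "B0 = bspline m t i x" and "B1 = bspline m t (i + 1) x" and "B2 = bspline m t (i + 2) x"
  have less: "a < d" "a < e" "b < e" "b < f" "c < f" by (simp_all add: defs)
  have S0: "bspline (Suc m) t i x = (x - a) / (d - a) * B0 + (e - x) / (e - b) * B1"
    by (simp add: defs B0_def B1_def bspline.simps(2))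
  have S1: "bspline (Suc m) t (i + 1) x = (x - b) / (e - b) * B1 + (f - x) / (f - c) * B2"
    by (simp add: defs B1_def B2_def bspline.simps(2) add_ac)
  have D0: "dbspline m i x = real (Suc m) * (B0 / (d - a) - B1 / (e - b))"
    by (simp add: defs dbspline_def B0_def B1_def)
  have D1: "dbspline m (i + 1) x = real (Suc m) * (B1 / (e - b) - B2 / (f - c))"
    by (simp add: defs dbspline_def B1_def B2_def add_ac)
  have D: "dbspline (Suc m) i x = real (Suc (Suc m)) * (bspline (Suc m) t i x / (e - a)
      - bspline (Suc m) t (i + 1) x / (f - b))"
    by (simp add: defs dbspline_def add_ac)
  \<comment> \<open>The terms with \<open>B0\<close> and \<open>B2\<close> agree by the recursion.
    The coefficient of \<open>B1\<close> in the difference vanishes, because the two ratios over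
    \<open>e - a\<close> and the two over \<open>f - b\<close> both add up to 1.\<close>
  have main: "(x - a) / (e - a) * (B0 / (d - a) - B1 / (e - b)) + (f - x) / (f - b) * (B1 / (e - b) - B2 / (f - c))
      = bspline (Suc m) t i x / (e - a) - bspline (Suc m) t (i + 1) x / (f - b)" (is "?L = ?R")
  proof -
    have "?R - ?L = B1 / (e - b) * ((e - x) / (e - a) + (x - a) / (e - a) - (x - b) / (f - b) - (f - x) / (f - b))"
      unfolding S0 S1 by (simp add: algebra_simps add_divide_distrib diff_divide_distrib)
    also have "(e - x) / (e - a) + (x - a) / (e - a) = 1"
      using less by (simp add: add_divide_distrib[symmetric])
    also have "1 - (x - b) / (f - b) - (f - x) / (f - b) = 0"
      using less by (simp add: diff_divide_distrib[symmetric] diff_diff_eq add_divide_distrib[symmetric])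
    finally show ?thesis by simp
  qed
  have "(bspline (Suc (Suc m)) t i has_real_derivative
      (bspline (Suc m) t i x / (e - a) + (x - a) / (e - a) * dbspline m i x)
      + (- bspline (Suc m) t (i + 1) x / (f - b) + (f - x) / (f - b) * dbspline m (i + 1) x)) (at x)"
    unfolding eq defs
    by (rule DERIV_cong[OF DERIV_add[OF DERIV_mult[OF DERIV_ratio_left IH1] DERIV_mult[OF DERIV_ratio_right IH2]]])
       (simp add: mult.commute)
  also have "(bspline (Suc m) t i x / (e - a) + (x - a) / (e - a) * dbspline m i x)
      + (- bspline (Suc m) t (i + 1) x / (f - b) + (f - x) / (f - b) * dbspline m (i + 1) x)
      = (bspline (Suc m) t i x / (e - a) - bspline (Suc m) t (i + 1) x / (f - b)) + real (Suc m) * ?L"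
    unfolding D0 D1 by (simp only: algebra_simps)
  also have "\<dots> = dbspline (Suc m) i x"
  proof -
    have "z + real (Suc m) * z = real (Suc (Suc m)) * z" for z by (simp add: algebra_simps)
    then show ?thesis unfolding main D .
  qed
  finally show ?case .
qed

text \<open>In degree 1 the recursion multiplies discontinuous step functions, so the hat function
  is first written with \<open>max\<close> and \<open>min\<close>; from there on the recursion
  preserves continuity.\<close>

lemma continuous_on_bspline: "continuous_on UNIV (bspline (Suc m) t i)"
proof (induction m arbitrary: i)
  case 0
  define a where "a = t i"
  define b where "b = t (i + 1)"
  define c where "c = t (i + 2)"
  have less: "a < b" "b < c" by (simp_all add: a_def b_def c_def)
  have "bspline (Suc 0) t i x = max 0 (min ((x - a) / (b - a)) ((c - x) / (c - b)))" for x
  proof -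
    have eq: "bspline (Suc 0) t i x = (x - a) / (b - a) * (if a \<le> x \<and> x < b then 1 else 0)
       + (c - x) / (c - b) * (if b \<le> x \<and> x < c then 1 else 0)"
      by (simp add: a_def b_def c_def bspline.simps add_ac)
    consider "x < a" | "a \<le> x" "x < b" | "b \<le> x" "x < c" | "c \<le> x" by linarith
    then show ?thesis
    proof cases
      case 1
      have "(x - a) / (b - a) \<le> 0" "0 \<le> (c - x) / (c - b)" using less 1 by (simp_all add: divide_le_0_iff)
      then have "min ((x - a) / (b - a)) ((c - x) / (c - b)) \<le> 0" by linarith
      then show ?thesis using 1 less unfolding eq by simp
    next
      case 2
      have "(x - a) / (b - a) \<le> 1" "0 \<le> (x - a) / (b - a)" "1 \<le> (c - x) / (c - b)"
        using less 2 by simp_all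
      then have "min ((x - a) / (b - a)) ((c - x) / (c - b)) = (x - a) / (b - a)"
        by (intro min_absorb1) linarith
      then show ?thesis using 2 less unfolding eq by simp
    next
      case 3
      have "1 \<le> (x - a) / (b - a)" "0 \<le> (c - x) / (c - b)" "(c - x) / (c - b) \<le> 1"
        using less 3 by simp_all
      then have "min ((x - a) / (b - a)) ((c - x) / (c - b)) = (c - x) / (c - b)"
        by (intro min_absorb2) linarith
      then show ?thesis using 3 less unfolding eq by simp
    next
      case 4
      have "(c - x) / (c - b) \<le> 0" "0 \<le> (x - a) / (b - a)" using less 4 by (simp_all add: divide_le_0_iff)
      then have "min ((x - a) / (b - a)) ((c - x) / (c - b)) \<le> 0" by linarith
      then show ?thesis using 4 less unfolding eq by simp
    qed
  qed
  then have "bspline (Suc 0) t i = (\<lambda>x. max 0 (min ((x - a) / (b - a)) ((c - x) / (c - b))))"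
    by blast
  then show ?case using less by (auto intro!: continuous_intros)
next
  case (Suc m)
  have "t (i + int (Suc m) + 1) - t i \<noteq> 0" "t (i + int (Suc m) + 2) - t (i + 1) \<noteq> 0"
    using knots_less[of i "i + int (Suc m) + 1"] knots_less[of "i + 1" "i + int (Suc m) + 2"]
    by (simp_all del: knots_less)
  then show ?case
    unfolding bspline.simps(2)[of "Suc m", abs_def]
    by (intro continuous_intros Suc) auto
qed

text \<open>Both the B-spline and the candidate derivative are continuous, so the formula passes
  from the complement of the finitely many knots to the knots themselves.\<close>

lemma bspline_DERIV:
  "(bspline (Suc (Suc m)) t i has_real_derivative dbspline (Suc m) i x) (at x)"
proof (rule DERIV_of_DERIV_off_finite[of "t ` {i..i + int (Suc m) + 2}"])
  show "continuous_on UNIV (dbspline (Suc m) i)"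
    unfolding dbspline_def[abs_def]
    by (intro continuous_intros continuous_on_bspline) (simp_all add: strict_mono_eq[OF knots])
qed (use bspline_DERIV_off_knots continuous_on_bspline in auto)

lemma bspline_smooth:
  "\<exists>D. D 0 = bspline (Suc m) t i \<and> (\<forall>l<m. \<forall>x. (D l has_real_derivative D (Suc l) x) (at x))
     \<and> continuous_on UNIV (D m)"
proof (induction m arbitrary: i)
  case 0
  show ?case by (rule exI[of _ "\<lambda>_. bspline (Suc 0) t i"]) (use continuous_on_bspline in auto)
next
  case (Suc m)
  obtain D1 where D1: "D1 0 = bspline (Suc m) t i"
    "\<And>l x. l < m \<Longrightarrow> (D1 l has_real_derivative D1 (Suc l) x) (at x)" "continuous_on UNIV (D1 m)"
    using Suc[of i] by blast
  obtain D2 where D2: "D2 0 = bspline (Suc m) t (i + 1)"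
    "\<And>l x. l < m \<Longrightarrow> (D2 l has_real_derivative D2 (Suc l) x) (at x)" "continuous_on UNIV (D2 m)"
    using Suc[of "i + 1"] by blast
  define a where "a = t (i + int (Suc m) + 1) - t i"
  define b where "b = t (i + int (Suc m) + 2) - t (i + 1)"
  have ab: "a \<noteq> 0" "b \<noteq> 0" by (simp_all add: a_def b_def strict_mono_eq[OF knots])
  define D where "D = (\<lambda>l. case l of 0 \<Rightarrow> bspline (Suc (Suc m)) t i
      | Suc l \<Rightarrow> (\<lambda>x. real (Suc (Suc m)) * (D1 l x / a - D2 l x / b)))"
  have Ds: "D (Suc l) = (\<lambda>x. real (Suc (Suc m)) * (D1 l x / a - D2 l x / b))" for l
    by (simp add: D_def)
  have "(D l has_real_derivative D (Suc l) x) (at x)" if "l < Suc m" for l x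
  proof (cases l)
    case 0
    then show ?thesis
      using bspline_DERIV[of m i x] by (simp add: D_def D1 D2 dbspline_def a_def b_def)
  next
    case (Suc l')
    then have "l' < m" using that by simp
    show ?thesis
      unfolding Suc Ds
      by (intro DERIV_cmult DERIV_diff DERIV_cdivide D1(2) D2(2) \<open>l' < m\<close>)
  qed
  moreover have "continuous_on UNIV (D (Suc m))"
    unfolding Ds by (intro continuous_intros D1 D2) (use ab in auto)
  moreover have "D 0 = bspline (Suc (Suc m)) t i" by (simp add: D_def)
  ultimately show ?case by blast
qed

lemma spline_smooth:
  obtains D where "D 0 = (\<lambda>x. \<Sum>i\<in>A. c i * bspline (Suc m) t i x)"
    "\<And>l x. l < m \<Longrightarrow> (D l has_real_derivative D (Suc l) x) (at x)" "continuous_on UNIV (D m)"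
proof -
  have "\<forall>i. \<exists>D. D 0 = bspline (Suc m) t i \<and> (\<forall>l<m. \<forall>x. (D l has_real_derivative D (Suc l) x) (at x))
     \<and> continuous_on UNIV (D m)" using bspline_smooth by blast
  then obtain D where D: "\<And>i. D i 0 = bspline (Suc m) t i"
    "\<And>i l x. l < m \<Longrightarrow> (D i l has_real_derivative D i (Suc l) x) (at x)"
    "\<And>i. continuous_on UNIV (D i m)"
    by metis
  show ?thesis
  proof (rule that[of "\<lambda>l x. \<Sum>i\<in>A. c i * D i l x"])
    show "((\<lambda>x. \<Sum>i\<in>A. c i * D i l x) has_real_derivative (\<Sum>i\<in>A. c i * D i (Suc l) x)) (at x)"
      if "l < m" for l x
      by (intro DERIV_sum DERIV_cmult D that)
    show "continuous_on UNIV (\<lambda>x. \<Sum>i\<in>A. c i * D i m x)"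
      by (intro continuous_intros D)
  qed (simp add: D)
qed

lemma bspline_piece:
  "\<exists>p. degree p \<le> m \<and> (\<forall>x. t j \<le> x \<longrightarrow> x < t (j + 1) \<longrightarrow> bspline m t i x = poly p x)"
proof (induction m arbitrary: i)
  case 0
  show ?case
  proof (cases "i = j")
    case True
    then show ?thesis by (intro exI[of _ 1]) auto
  next
    case False
    have "bspline 0 t i x = 0" if x: "t j \<le> x" "x < t (j + 1)" for x
    proof (cases "i < j")
      case True
      then have "t (i + 1) \<le> t j" by simp
      from order.trans[OF this x(1)] show ?thesis by simp
    next
      case False
      then have "t (j + 1) \<le> t i" using \<open>i \<noteq> j\<close> by simp
      from order.strict_trans2[OF x(2) this] show ?thesis by simp
    qed
    then show ?thesis by (intro exI[of _ 0]) auto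
  qed
next
  case (Suc m)
  obtain p where p: "degree p \<le> m" "\<And>x. t j \<le> x \<Longrightarrow> x < t (j + 1) \<Longrightarrow> bspline m t i x = poly p x"
    using Suc[of i] by blast
  obtain q where q: "degree q \<le> m" "\<And>x. t j \<le> x \<Longrightarrow> x < t (j + 1) \<Longrightarrow> bspline m t (i + 1) x = poly q x"
    using Suc[of "i + 1"] by blast
  define a where "a = t (i + int m + 1) - t i"
  define b where "b = t (i + int m + 2) - t (i + 1)"
  define P where "P = smult (1 / a) ([:- t i, 1:] * p) + smult (1 / b) ([:t (i + int m + 2), -1:] * q)"
  have deg: "degree ([:u, v:] * p') \<le> Suc m" if "degree p' \<le> m" for u v :: real and p'
    using degree_mult_le[of "[:u, v:]" p'] that by (simp split: if_splits)
  then have "degree P \<le> Suc m"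
    unfolding P_def by (intro degree_add_le order.trans[OF degree_smult_le] deg p q)
  moreover have "bspline (Suc m) t i x = poly P x" if "t j \<le> x" "x < t (j + 1)" for x
    using p(2)[OF that] q(2)[OF that]
    by (simp add: P_def a_def b_def bspline.simps(2) algebra_simps add_divide_distrib diff_divide_distrib)
  ultimately show ?case by blast
qed

text \<open>B-splines are polynomials on half-open knot intervals; continuity carries the identity
  to the closure.\<close>

lemma spline_piece:
  assumes "finite A"
  obtains p where "degree p \<le> Suc m"
    "\<And>x. x \<in> {t j..t (j + 1)} \<Longrightarrow> (\<Sum>i\<in>A. c i * bspline (Suc m) t i x) = poly p x"
proof -
  obtain p where p: "\<And>i. degree (p i) \<le> Suc m"
    "\<And>i x. t j \<le> x \<Longrightarrow> x < t (j + 1) \<Longrightarrow> bspline (Suc m) t i x = poly (p i) x"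
    using bspline_piece[of "Suc m" j] by metis
  define P where "P = (\<Sum>i\<in>A. smult (c i) (p i))"
  let ?S = "\<lambda>x. \<Sum>i\<in>A. c i * bspline (Suc m) t i x"
  have "degree P \<le> Suc m"
    unfolding P_def by (intro degree_sum_le assms order.trans[OF degree_smult_le] p)
  moreover have "{t j..<t (j + 1)} \<subseteq> {x. ?S x = poly P x}"
    using p(2) by (auto simp: P_def poly_sum)
  then have "closure {t j..<t (j + 1)} \<subseteq> {x. ?S x = poly P x}"
    by (rule closure_minimal) (intro closed_Collect_eq continuous_intros continuous_on_bspline)
  then have "\<And>x. x \<in> {t j..t (j + 1)} \<Longrightarrow> ?S x = poly P x"
    by (subst (asm) closure_atLeastLessThan) auto
  ultimately show ?thesis using that by blast
qed

end

section \<open>One-sided local polynomials and their assembly\<close>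

lemma one_sided_poly:
  fixes D :: "nat \<Rightarrow> real \<Rightarrow> real"
  assumes der: "\<And>i x. i < r \<Longrightarrow> x \<in> {a..b} \<Longrightarrow> (D i has_real_derivative D (Suc i) x) (at x within {a..b})"
    and c: "c \<in> {a..b}"
    and q: "degree q < k" "\<And>x. x \<in> {a..b} \<Longrightarrow> \<bar>D r x - poly q x\<bar> \<le> E"
    and l: "l \<le> r" and e: "\<bar>e\<bar> = 1"
  obtains p where "degree p < k + r"
    "\<And>i. i < l \<Longrightarrow> poly ((pderiv ^^ i) p) c = D i c"
    "\<And>x. x \<in> {a..b} \<Longrightarrow> \<bar>D 0 x - poly p x\<bar> \<le> 2 * E * (b - a) ^ r"
    "\<And>x. x \<in> {c..b} \<Longrightarrow> 0 \<le> e * (poly p x - D 0 x)"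
    "\<And>x. x \<in> {a..c} \<Longrightarrow> 0 \<le> e * (-1) ^ l * (poly p x - D 0 x)"
proof -
  obtain p0 where p0: "degree p0 \<le> degree q + r"
    "\<And>i. i < r \<Longrightarrow> poly ((pderiv ^^ i) p0) c = D i c"
    "\<And>x. x \<in> {a..b} \<Longrightarrow> \<bar>D 0 x - poly p0 x\<bar> \<le> E * \<bar>x - c\<bar> ^ r"
    using taylor_poly_match[OF der c q(2)] by blast
  have E0: "E \<ge> 0" using q(2)[OF c] by linarith
  \<comment> \<open>With this factor \<open>v * \<bar>x - c\<bar> ^ l\<close> majorises the Taylor
    error \<open>E * \<bar>x - c\<bar> ^ r\<close> on all of [a, b].\<close>
  define v where "v = E * (b - a) ^ (r - l)"
  have v0: "v \<ge> 0" using E0 c by (simp add: v_def)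
  \<comment> \<open>The correction is \<open>e * v * (x - c) ^ l\<close>, written through powers of
    \<open>c - x\<close> to match \<open>higher_pderiv_linear_power\<close>.\<close>
  define p where "p = p0 + smult (e * v * (-1) ^ l) ([:c, -1:] ^ l)"
  have px: "poly p x = poly p0 x + e * v * (x - c) ^ l" for x
  proof -
    have "(-1) ^ l * (c - x) ^ l = (x - c) ^ l" by (simp flip: power_mult_distrib)
    then show ?thesis by (simp add: p_def mult.assoc)
  qed
  have close: "\<bar>D 0 x - poly p0 x\<bar> \<le> v * \<bar>x - c\<bar> ^ l" if x: "x \<in> {a..b}" for x
  proof -
    have "\<bar>x - c\<bar> ^ r = \<bar>x - c\<bar> ^ (r - l) * \<bar>x - c\<bar> ^ l"
      using l by (simp flip: power_add)
    also have "\<dots> \<le> (b - a) ^ (r - l) * \<bar>x - c\<bar> ^ l"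
      using x c by (intro mult_right_mono power_mono) auto
    finally have "E * \<bar>x - c\<bar> ^ r \<le> v * \<bar>x - c\<bar> ^ l"
      using E0 by (simp add: v_def mult.assoc mult_left_mono)
    then show ?thesis using p0(3)[OF x] by linarith
  qed
  have ee: "e * e = 1" using e by (metis abs_mult_self_eq mult_1)
  have s1: "e * (poly p x - D 0 x) = e * (poly p0 x - D 0 x) + v * (x - c) ^ l" for x
    using ee by (simp add: px algebra_simps)
  have low: "- (v * \<bar>x - c\<bar> ^ l) \<le> s * (poly p0 x - D 0 x)" if "x \<in> {a..b}" "\<bar>s\<bar> = 1" for x s
  proof -
    have "\<bar>s * (poly p0 x - D 0 x)\<bar> = \<bar>D 0 x - poly p0 x\<bar>"
      using that(2) by (simp add: abs_mult abs_minus_commute)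
    then show ?thesis using close[OF that(1)] by linarith
  qed
  show ?thesis
  proof (rule that[of p])
    have "degree (smult (e * v * (-1) ^ l) ([:c, -1:] ^ l)) \<le> l"
      by (intro order.trans[OF degree_smult_le] order.trans[OF degree_power_le]) simp
    then have "degree p \<le> max (degree q + r) l"
      unfolding p_def using p0(1) by (intro degree_add_le) auto
    then show "degree p < k + r" using q(1) l by auto
  next
    fix i assume i: "i < l"
    show "poly ((pderiv ^^ i) p) c = D i c"
      using p0(2)[of i] i l
      by (simp add: p_def higher_pderiv_add higher_pderiv_smult higher_pderiv_linear_power)
  next
    fix x assume x: "x \<in> {a..b}"
    have "\<bar>D 0 x - poly p x\<bar> \<le> \<bar>D 0 x - poly p0 x\<bar> + \<bar>e * v * (x - c) ^ l\<bar>"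
      by (simp add: px)
    also have "\<bar>e * v * (x - c) ^ l\<bar> = v * \<bar>x - c\<bar> ^ l"
      using e v0 by (simp add: abs_mult power_abs)
    also have "\<bar>D 0 x - poly p0 x\<bar> + v * \<bar>x - c\<bar> ^ l \<le> 2 * (v * \<bar>x - c\<bar> ^ l)"
      using close[OF x] by simp
    also have "\<dots> \<le> 2 * (v * (b - a) ^ l)"
      using x c v0 by (intro mult_left_mono power_mono) auto
    also have "v * (b - a) ^ l = E * (b - a) ^ r"
      using l by (simp add: v_def mult.assoc flip: power_add)
    finally show "\<bar>D 0 x - poly p x\<bar> \<le> 2 * E * (b - a) ^ r" by simp
  next
    fix x assume x: "x \<in> {c..b}"
    then have "\<bar>x - c\<bar> ^ l = (x - c) ^ l" "x \<in> {a..b}" using c by auto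
    then show "0 \<le> e * (poly p x - D 0 x)" using low[of x e] e unfolding s1 by simp
  next
    fix x assume x: "x \<in> {a..c}"
    then have "(-1) ^ l * (x - c) ^ l = \<bar>x - c\<bar> ^ l" by (simp flip: power_mult_distrib)
    then have "e * (-1) ^ l * (poly p x - D 0 x) = (e * (-1) ^ l) * (poly p0 x - D 0 x) + v * \<bar>x - c\<bar> ^ l"
      using ee s1[of x] by (metis (no_types, opaque_lifting) distrib_left mult.assoc mult.left_commute)
    moreover have "x \<in> {a..b}" "\<bar>e * (-1) ^ l\<bar> = 1" using x c e by (auto simp: abs_mult)
    ultimately show "0 \<le> e * (-1) ^ l * (poly p x - D 0 x)" using low[of x "e * (-1) ^ l"] by simp
  qed
qed

text \<open>An interpolation point may be a knot, where the spline agrees with its polynomial on one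
  side only. One-sided derivatives on a nondegenerate closed interval are unique, so this is
  enough.\<close>

lemma derivatives_eq_poly_derivatives:
  fixes D :: "nat \<Rightarrow> real \<Rightarrow> real"
  assumes der: "\<And>i x. i < m \<Longrightarrow> (D i has_real_derivative D (Suc i) x) (at x)"
    and eq: "\<And>x. x \<in> {u..v} \<Longrightarrow> D 0 x = poly p x" and uv: "u < v"
  shows "i \<le> m \<Longrightarrow> x \<in> {u..v} \<Longrightarrow> D i x = poly ((pderiv ^^ i) p) x"
proof (induction i arbitrary: x)
  case (Suc i)
  have "(D i has_real_derivative D (Suc i) x) (at x within {u..v})"
    using der[of i x] Suc.prems by (auto intro: has_field_derivative_at_within)
  moreover have "(D i has_real_derivative poly ((pderiv ^^ Suc i) p) x) (at x within {u..v})"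
    by (rule has_field_derivative_transform_within[OF has_real_derivative_higher_pderiv zero_less_one])
       (use Suc in auto)
  ultimately show ?case
    using vector_derivative_unique_within_closed_interval[OF uv, of x "D i"] Suc.prems
    by (simp add: has_real_derivative_iff_has_vector_derivative)
qed (use eq in simp)

text \<open>Each coefficient is the extremal one among those of the pieces \<open>R j\<close> whose interval lies in the
  support of the B-spline, so that the spline dominates every \<open>R j\<close> on its interval.\<close>
lemma (in knot_sequence) spline_assembly:
  fixes R :: "int \<Rightarrow> real poly" and es :: "int \<Rightarrow> real"
  assumes lohi: "lo \<le> hi"
    and deg: "\<And>j. j \<in> {lo..hi} \<Longrightarrow> degree (R j) \<le> Suc m"
    and es: "\<And>j. \<bar>es j\<bar> = 1"
    and frozen: "\<And>j0 j. j0 \<in> F \<Longrightarrow> j0 \<in> {lo..hi} \<Longrightarrow> j \<in> {lo..hi} \<Longrightarrow> \<bar>j - j0\<bar> \<le> int (Suc m) \<Longrightarrow> R j = R j0"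
    and const: "\<And>j. j \<in> {lo..<hi} \<Longrightarrow> j \<notin> F \<Longrightarrow> j + 1 \<notin> F \<Longrightarrow> es j = es (j + 1)"
  obtains c where
    "\<And>j x. j \<in> {lo..hi} \<Longrightarrow> j \<in> F \<Longrightarrow> x \<in> {t j..t (j + 1)} \<Longrightarrow>
        (\<Sum>i\<in>{lo - int (Suc m)..hi}. c i * bspline (Suc m) t i x) = poly (R j) x"
    "\<And>j x. j \<in> {lo..hi} \<Longrightarrow> x \<in> {t j..t (j + 1)} \<Longrightarrow>
        0 \<le> es j * ((\<Sum>i\<in>{lo - int (Suc m)..hi}. c i * bspline (Suc m) t i x) - poly (R j) x)"
    "\<And>j x M. j \<in> {lo..hi} \<Longrightarrow> x \<in> {t j..t (j + 1)} \<Longrightarrow>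
       (\<And>i j'. i \<in> {j - int (Suc m)..j} \<Longrightarrow> j' \<in> {lo..hi} \<Longrightarrow> \<bar>j' - j\<bar> \<le> int (Suc m)
         \<Longrightarrow> \<bar>bcoeff (Suc m) t i (R j' - R j)\<bar> \<le> M)
       \<Longrightarrow> \<bar>(\<Sum>i\<in>{lo - int (Suc m)..hi}. c i * bspline (Suc m) t i x) - poly (R j) x\<bar> \<le> M"
proof -
  let ?m = "int (Suc m)"
  \<comment> \<open>\<open>A i\<close> holds the knot intervals of the support inside the range, and
    \<open>e i\<close> is the sign wanted on the leftmost of them. Multiplying by \<open>e i\<close>
    before and after \<open>Max\<close> makes \<open>c i\<close> a maximum or a minimum.\<close>
  define A where "A = (\<lambda>i. {max i lo..min (i + ?m) hi})"
  define e where "e = (\<lambda>i. es (max i lo))"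
  define g where "g = (\<lambda>i j. bcoeff (Suc m) t i (R j))"
  define c where "c = (\<lambda>i. e i * Max ((\<lambda>j. e i * g i j) ` A i))"
  have ee: "e i * e i = 1" for i
    using es[of "max i lo"] by (metis abs_mult_self_eq e_def mult_1)
  have ex: "\<exists>j'\<in>A i. c i = g i j'" if "A i \<noteq> {}" for i
  proof -
    have "Max ((\<lambda>j. e i * g i j) ` A i) \<in> (\<lambda>j. e i * g i j) ` A i"
      using that by (intro Max_in) (auto simp: A_def)
    then obtain j' where "j' \<in> A i" "Max ((\<lambda>j. e i * g i j) ` A i) = e i * g i j'" by auto
    then show ?thesis using ee[of i] by (auto simp: c_def mult.assoc[symmetric])
  qed
  have ge: "0 \<le> e i * (c i - g i j)" if "j \<in> A i" for i j
  proof -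
    have "e i * g i j \<le> Max ((\<lambda>j. e i * g i j) ` A i)"
      using that by (intro Max_ge) (auto simp: A_def)
    also have "\<dots> = e i * c i" by (simp add: c_def ee mult.assoc[symmetric])
    finally show ?thesis by (simp add: algebra_simps)
  qed
  \<comment> \<open>Any two indices in \<open>A i\<close> differ by at most \<open>Suc m\<close>,
    the range over which a frozen polynomial is kept.\<close>
  have eqF: "c i = g i j" if j0: "j0 \<in> F" "j0 \<in> A i" "j \<in> A i" for i j j0
  proof -
    obtain j' where j': "j' \<in> A i" "c i = g i j'" using ex[of i] j0(2) by blast
    have "R j' = R j0" "R j = R j0"
      using j0 j' by (intro frozen; auto simp: A_def)+
    then show ?thesis using j' by (simp add: g_def)
  qed
  \<comment> \<open>Either a frozen interval lies in the support and the coefficient is exact, or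
    none does and \<open>es\<close> is constant along \<open>A i\<close>, hence equal to
    \<open>e i\<close>.\<close>
  have sgn: "0 \<le> es j * (c i - g i j)" if j: "j \<in> A i" for i j
  proof (cases "\<exists>j0\<in>F. j0 \<in> A i")
    case True
    then show ?thesis using eqF j by auto
  next
    case False
    have "es l = e i" if "max i lo \<le> l" "l \<le> min (i + ?m) hi" for l
      using that
    proof (induction l rule: int_ge_induct)
      case (step l)
      have "es l = es (l + 1)"
        by (rule const) (use step.prems step.hyps False in \<open>auto simp: A_def\<close>)
      then show ?case using step by simp
    qed (simp add: e_def)
    then have "es j = e i" using j by (simp add: A_def)
    then show ?thesis using ge[OF j] by simp
  qed
  define S where "S x = (\<Sum>i\<in>{lo - ?m..hi}. c i * bspline (Suc m) t i x)" for x
  have diff: "S x - poly (R j) x = (\<Sum>i\<in>{j - ?m..j}. (c i - g i j) * bspline (Suc m) t i x)"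
    if "j \<in> {lo..hi}" "x \<in> {t j..t (j + 1)}" for j x
  proof -
    have "S x = (\<Sum>i\<in>{j - ?m..j}. c i * bspline (Suc m) t i x)"
      unfolding S_def by (rule sum_bspline_restrict) (use that in auto)
    moreover have "poly (R j) x = (\<Sum>i\<in>{j - ?m..j}. g i j * bspline (Suc m) t i x)"
      unfolding g_def by (rule bspline_reproduces_poly[symmetric]) (use that deg in auto)
    ultimately show ?thesis by (simp add: left_diff_distrib sum_subtractf)
  qed
  have act: "j \<in> A i" if "j \<in> {lo..hi}" "i \<in> {j - ?m..j}" for i j
    using that by (auto simp: A_def)
  show ?thesis
  proof (rule that[of c], unfold S_def[symmetric])
    fix j x assume j: "j \<in> {lo..hi}" "j \<in> F" and x: "x \<in> {t j..t (j + 1)}"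
    have "S x - poly (R j) x = 0"
      unfolding diff[OF j(1) x] by (intro sum.neutral ballI) (use eqF[OF j(2)] act[OF j(1)] in auto)
    then show "S x = poly (R j) x" by simp
  next
    fix j x assume j: "j \<in> {lo..hi}" and x: "x \<in> {t j..t (j + 1)}"
    show "0 \<le> es j * (S x - poly (R j) x)"
      unfolding diff[OF j x] sum_distrib_left mult.assoc[symmetric]
      by (intro sum_nonneg mult_nonneg_nonneg sgn act j bspline_nonneg)
  next
    fix j x M assume j: "j \<in> {lo..hi}" and x: "x \<in> {t j..t (j + 1)}"
      and M: "\<And>i j'. i \<in> {j - int (Suc m)..j} \<Longrightarrow> j' \<in> {lo..hi} \<Longrightarrow> \<bar>j' - j\<bar> \<le> int (Suc m)
         \<Longrightarrow> \<bar>bcoeff (Suc m) t i (R j' - R j)\<bar> \<le> M"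
    have "\<bar>c i - g i j\<bar> \<le> M" if i: "i \<in> {j - ?m..j}" for i
    proof -
      obtain j' where j': "j' \<in> A i" "c i = g i j'" using ex[of i] act[OF j i] by auto
      have "\<bar>bcoeff (Suc m) t i (R j' - R j)\<bar> \<le> M"
        by (rule M) (use i j j' in \<open>auto simp: A_def\<close>)
      then show ?thesis by (simp add: j' g_def bcoeff_diff)
    qed
    then have "\<bar>S x - poly (R j) x\<bar> \<le> (\<Sum>i\<in>{j - ?m..j}. M * bspline (Suc m) t i x)"
      unfolding diff[OF j x]
      by (intro order.trans[OF sum_abs] sum_mono)
         (auto simp: abs_mult bspline_nonneg intro!: mult_right_mono)
    also have "\<dots> = M"
      unfolding sum_distrib_left[symmetric] using x by (subst sum_bspline_eq_1) auto
    finally show "\<bar>S x - poly (R j) x\<bar> \<le> M" .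
  qed
qed

section \<open>Locating points and comparing lengths in a graded knot sequence\<close>

lemma (in knot_sequence) exists_knot_interval:
  assumes "lo < hi" "t lo \<le> x" "x \<le> t hi"
  shows "\<exists>j\<in>{lo..<hi}. x \<in> {t j..t (j + 1)}"
proof -
  have "lo + 1 \<le> hi" using assms(1) by simp
  then show ?thesis using assms(3)
  proof (induction hi rule: int_ge_induct)
    case base
    then show ?case using assms(2) by auto
  next
    case (step hi)
    then show ?case
      by (cases "x \<le> t hi") (force, intro bexI[of _ hi], auto)
  qed
qed

locale graded_knots = knot_sequence +
  fixes P :: real
  assumes P: "P \<ge> 1"
    and ratio_up: "t (j + 2) - t (j + 1) \<le> P * (t (j + 1) - t j)"
    and ratio_down: "t (j + 1) - t j \<le> P * (t (j + 2) - t (j + 1))"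
begin

lemma knot_gap_up: "t (j + int d + 1) - t (j + int d) \<le> P ^ d * (t (j + 1) - t j)"
proof (induction d)
  case (Suc d)
  have "t (j + int d + 2) - t (j + int d + 1) \<le> P * (t (j + int d + 1) - t (j + int d))"
    by (rule ratio_up)
  also have "\<dots> \<le> P * (P ^ d * (t (j + 1) - t j))"
    using P by (intro mult_left_mono Suc) auto
  finally show ?case by (simp add: add_ac)
qed simp

lemma knot_gap_down: "t (j - int d + 1) - t (j - int d) \<le> P ^ d * (t (j + 1) - t j)"
proof (induction d)
  case (Suc d)
  have "t (j - int (Suc d) + 1) - t (j - int (Suc d)) \<le> P * (t (j - int d + 1) - t (j - int d))"
    using ratio_down[of "j - int (Suc d)"] by (simp add: algebra_simps)
  also have "\<dots> \<le> P * (P ^ d * (t (j + 1) - t j))"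
    using P by (intro mult_left_mono Suc) auto
  finally show ?case by simp
qed simp

text \<open>There are 2N + 1 intervals in the range, each at most P^N times as long as the central
  one.\<close>

lemma knot_range_le:
  "t (j + 1 + int N) - t (j - int N) \<le> (2 * real N + 1) * P ^ N * (t (j + 1) - t j)"
proof (induction N)
  case (Suc N)
  let ?h = "t (j + 1) - t j"
  have h: "?h \<ge> 0" by simp
  have "t (j + 1 + int (Suc N)) - t (j + 1 + int N) \<le> P ^ Suc N * ?h"
    using knot_gap_up[of j "Suc N"] by (simp add: add_ac)
  moreover have "t (j - int N) - t (j - int (Suc N)) \<le> P ^ Suc N * ?h"
    using knot_gap_down[of j "Suc N"] by (simp add: algebra_simps)
  moreover have "t (j + 1 + int N) - t (j - int N) \<le> (2 * real N + 1) * (P ^ Suc N * ?h)"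
  proof -
    have "P ^ N * ?h \<le> P ^ Suc N * ?h"
      using P h by (intro mult_right_mono power_increasing) auto
    then have "(2 * real N + 1) * (P ^ N * ?h) \<le> (2 * real N + 1) * (P ^ Suc N * ?h)"
      by (intro mult_left_mono) auto
    then show ?thesis using Suc.IH by (simp only: mult.assoc)
  qed
  ultimately have "t (j + 1 + int (Suc N)) - t (j - int (Suc N))
      \<le> (2 * real N + 1) * (P ^ Suc N * ?h) + P ^ Suc N * ?h + P ^ Suc N * ?h"
    by linarith
  also have "\<dots> = (2 * real (Suc N) + 1) * P ^ Suc N * ?h"
    by (simp only: of_nat_Suc) (simp add: algebra_simps)
  finally show ?case .
qed simp

end

text \<open>The interval [-1, 1] corresponds to knot indices from -n to 0. The constants
  \<open>Cw\<close> and \<open>Cb\<close> are parameters so that they can be fixed before the data.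
  \<open>J b\<close> selects one closed knot interval containing \<open>b\<close>, either neighbour
  if \<open>b\<close> is an interior knot, and the last assumption keeps the neighbourhoods of
  radius \<open>Suc m\<close> around these intervals disjoint.\<close>

locale one_sided_problem = graded_knots +
  fixes k r m n :: nat and Cw Cb :: real and f :: "real \<Rightarrow> real" and D :: "nat \<Rightarrow> real \<Rightarrow> real"
    and Y A :: "real set" and J :: "real \<Rightarrow> int"
  assumes k1: "k \<ge> 1" and r1: "r \<ge> 1" and m: "k + r = m + 2"
    and n1: "n \<ge> 1" and t0: "t 0 = 1" and tn: "t (- int n) = -1"
    and Cw0: "Cw \<ge> 0"
    and Cw: "\<And>g a b. a < b \<Longrightarrow> continuous_on {a..b} g \<Longrightarrow>
      \<exists>q. degree q < k \<and> (\<forall>x\<in>{a..b}. \<bar>g x - poly q x\<bar> \<le> Cw * omega k g (b - a) a b)"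
    and Cb0: "Cb \<ge> 0"
    and Cb: "\<And>i q a h K M. degree q \<le> Suc m \<Longrightarrow> 0 < h \<Longrightarrow> 0 \<le> K \<Longrightarrow> (\<And>x. x \<in> {a..a + h} \<Longrightarrow> \<bar>poly q x\<bar> \<le> M)
      \<Longrightarrow> (\<And>l. l < Suc m \<Longrightarrow> \<bar>t (i + int l + 1) - a\<bar> \<le> K * h)
      \<Longrightarrow> \<bar>bcoeff (Suc m) t i q\<bar> \<le> Cb * (K + 1) ^ Suc m * M"
    and Cm: "Cm_on r {-1..1} f D"
    and finY: "finite Y" and Y: "Y \<subseteq> {-1<..<1}" and A: "A \<subseteq> {-1..1}" and YA: "Y \<inter> A = {}"
    and J: "b \<in> insert 1 (insert (-1) (Y \<union> A)) \<Longrightarrow> J b \<in> {- int n..-1} \<and> b \<in> {t (J b)..t (J b + 1)}"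
    and sep: "b \<in> insert 1 (insert (-1) (Y \<union> A)) \<Longrightarrow> b' \<in> insert 1 (insert (-1) (Y \<union> A)) \<Longrightarrow> b < b' \<Longrightarrow>
      J b + 2 * int (Suc m) + 2 \<le> J b'"
begin

abbreviation "d \<equiv> int (Suc m)"
abbreviation "B \<equiv> insert 1 (insert (-1) (Y \<union> A))"

text \<open>The sign wanted for S - f at \<open>x\<close>. Between consecutive points of
  \<open>Y\<close> the exponent is the index of the interval in \<open>Delta0\<close>; at a point of
  \<open>Y\<close> it is the sign wanted to the right.\<close>

definition sg :: "real \<Rightarrow> real" where "sg x = (-1) ^ card {y \<in> Y. y > x}"
text \<open>The midpoint is taken because \<open>sg\<close> may jump at a knot.\<close>

definition es :: "int \<Rightarrow> real" where "es j = sg ((t j + t (j + 1)) / 2)"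
text \<open>Knots outside [-1, 1] are auxiliary; clamping the index keeps windows inside the domain
  of \<open>f\<close>.\<close>

definition tc :: "int \<Rightarrow> real" where "tc i = t (max (- int n) (min 0 i))"
definition Q :: "int \<Rightarrow> int \<Rightarrow> real" where
  "Q w j = 2 * (Cw * omega k (D r) (tc (j + 1 + w) - tc (j - w)) (tc (j - w)) (tc (j + 1 + w)))
     * (tc (j + 1 + w) - tc (j - w)) ^ r"

text \<open>The number of derivatives interpolated at \<open>b\<close>; its parity decides whether the error changes sign.\<close>
definition mult_at :: "real \<Rightarrow> nat" where
  "mult_at b = (if b = 1 \<or> b = -1 then r else if odd r = (b \<in> Y) then r else r - 1)"

lemma abs_sg: "\<bar>sg x\<bar> = 1" by (simp add: sg_def)
lemma abs_es: "\<bar>es x\<bar> = 1" by (simp add: es_def abs_sg)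

lemma tc_mono: "i \<le> j \<Longrightarrow> tc i \<le> tc j"
  by (auto simp: tc_def)

lemma tc_bounds: "-1 \<le> tc i" "tc i \<le> 1"
proof -
  have "t (- int n) \<le> tc i" "tc i \<le> t 0" by (auto simp: tc_def)
  then show "-1 \<le> tc i" "tc i \<le> 1" by (simp_all add: t0 tn)
qed

lemma tc_window: "j \<in> {- int n..-1} \<Longrightarrow> 0 \<le> w \<Longrightarrow> \<bar>j - j'\<bar> \<le> w \<Longrightarrow> tc (j' - w) \<le> t j"
  "j \<in> {- int n..-1} \<Longrightarrow> 0 \<le> w \<Longrightarrow> \<bar>j - j'\<bar> \<le> w \<Longrightarrow> t (j + 1) \<le> tc (j' + 1 + w)"
  by (auto simp: tc_def)

lemma sg_cong: "(\<And>y. y \<in> Y \<Longrightarrow> y > x \<longleftrightarrow> y > x') \<Longrightarrow> sg x = sg x'"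
  by (auto simp: sg_def intro!: arg_cong[of _ _ "\<lambda>S. (-1) ^ card S"])

lemma sg_left_of_Y:
  assumes "b \<in> Y" "x < b" "\<And>y. y \<in> Y \<Longrightarrow> y \<noteq> b \<Longrightarrow> y > x \<longleftrightarrow> y > b"
  shows "sg x = - sg b"
proof -
  have "{y \<in> Y. y > x} = insert b {y \<in> Y. y > b}" using assms by auto
  moreover have "finite {y \<in> Y. y > b}" using finY by simp
  ultimately show ?thesis by (simp add: sg_def)
qed

text \<open>The window extends \<open>2 * d\<close> intervals to either side: a polynomial centred
  at one interval is used up to \<open>d\<close> intervals away, and is compared there with
  \<open>f\<close> on intervals at most \<open>d\<close> further off.\<close>

lemma local_poly:
  assumes j: "j \<in> {- int n..-1}" and c: "c \<in> {tc (j - 2 * d)..tc (j + 1 + 2 * d)}"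
    and l: "l \<le> r" and e: "\<bar>e\<bar> = 1"
  obtains p where "degree p \<le> Suc m"
    "\<And>i. i < l \<Longrightarrow> poly ((pderiv ^^ i) p) c = D i c"
    "\<And>x. x \<in> {tc (j - 2 * d)..tc (j + 1 + 2 * d)} \<Longrightarrow> \<bar>f x - poly p x\<bar> \<le> Q (2 * d) j"
    "\<And>x. x \<in> {c..tc (j + 1 + 2 * d)} \<Longrightarrow> 0 \<le> e * (poly p x - f x)"
    "\<And>x. x \<in> {tc (j - 2 * d)..c} \<Longrightarrow> 0 \<le> e * (-1) ^ l * (poly p x - f x)"
proof -
  let ?a = "tc (j - 2 * d)" and ?b = "tc (j + 1 + 2 * d)"
  have sub: "{?a..?b} \<subseteq> {-1..1}" using tc_bounds by (meson atLeastatMost_subset_iff)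
  have "?a \<le> t j" "t (j + 1) \<le> ?b" using j by (intro tc_window; simp)+
  moreover have "t j < t (j + 1)" by simp
  ultimately have ab: "?a < ?b" by linarith
  have f: "D 0 x = f x" if "x \<in> {?a..?b}" for x
    using Cm that sub unfolding Cm_on_def by blast
  have cont: "continuous_on {?a..?b} (D r)"
    using Cm sub unfolding Cm_on_def by (blast intro: continuous_on_subset)
  have der: "(D i has_real_derivative D (Suc i) x) (at x within {?a..?b})" if "i < r" "x \<in> {?a..?b}" for i x
    using Cm sub that unfolding Cm_on_def by (blast intro: DERIV_subset)
  obtain q where q: "degree q < k"
    "\<And>x. x \<in> {?a..?b} \<Longrightarrow> \<bar>D r x - poly q x\<bar> \<le> Cw * omega k (D r) (?b - ?a) ?a ?b"
    using Cw[OF ab cont] by blast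
  obtain p where p: "degree p < k + r"
    "\<And>i. i < l \<Longrightarrow> poly ((pderiv ^^ i) p) c = D i c"
    "\<And>x. x \<in> {?a..?b} \<Longrightarrow> \<bar>D 0 x - poly p x\<bar> \<le> 2 * (Cw * omega k (D r) (?b - ?a) ?a ?b) * (?b - ?a) ^ r"
    "\<And>x. x \<in> {c..?b} \<Longrightarrow> 0 \<le> e * (poly p x - D 0 x)"
    "\<And>x. x \<in> {?a..c} \<Longrightarrow> 0 \<le> e * (-1) ^ l * (poly p x - D 0 x)"
    using one_sided_poly[OF der c q l e] by blast
  show ?thesis
  proof (rule that[of p])
    show "degree p \<le> Suc m" using p(1) m by simp
  qed (use p c f in \<open>auto simp: Q_def\<close>)
qed

lemma Y_near:
  assumes b: "b \<in> B" and y: "y \<in> Y" and j: "\<bar>j - J b\<bar> \<le> d"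
  shows "y < b \<Longrightarrow> y < t j" "b < y \<Longrightarrow> t (j + 1) < y"
proof -
  assume "y < b"
  then have "J y + 2 * d + 2 \<le> J b" using sep[of y b] y b by auto
  then have "t (J y + 1) < t j" using j by simp
  moreover have "y \<le> t (J y + 1)" using J[of y] y by auto
  ultimately show "y < t j" by linarith
next
  assume "b < y"
  then have "J b + 2 * d + 2 \<le> J y" using sep[of b y] y b by auto
  then have "t (j + 1) < t (J y)" using j by simp
  moreover have "t (J y) \<le> y" using J[of y] y by auto
  ultimately show "t (j + 1) < y" by linarith
qed

text \<open>No other point of \<open>Y\<close> is near \<open>b\<close>, so \<open>sg\<close> is
  constant on each side of \<open>b\<close> there and changes exactly if \<open>b\<close> is in
  \<open>Y\<close>; \<open>mult_at b\<close> is odd in that case and even for the remaining points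
  other than 1 and -1. Points of \<open>Y\<close> are excluded from the sign claim since
  \<open>sg\<close> is one-sided at them.\<close>

lemma beta_poly:
  assumes b: "b \<in> B"
  shows "\<exists>p. degree p \<le> Suc m \<and> (\<forall>i<mult_at b. poly ((pderiv ^^ i) p) b = D i b)
    \<and> (\<forall>x\<in>{tc (J b - 2 * d)..tc (J b + 1 + 2 * d)}. \<bar>f x - poly p x\<bar> \<le> Q (2 * d) (J b))
    \<and> (\<forall>j x. j \<in> {- int n..-1} \<longrightarrow> \<bar>j - J b\<bar> \<le> d \<longrightarrow> x \<in> {t j..t (j + 1)} \<longrightarrow> x \<notin> Y
        \<longrightarrow> 0 \<le> sg x * (poly p x - f x))"
proof -
  let ?a = "tc (J b - 2 * d)" and ?b = "tc (J b + 1 + 2 * d)"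
  \<comment> \<open>\<open>e\<close> is the sign to the right of \<open>b\<close>. At 1 only the
    left side matters, and there the sign of the correction carries the extra factor
    \<open>(-1) ^ r\<close>.\<close>
  define e where "e = (if b = 1 then (-1) ^ r * sg b else sg b)"
  have e1: "\<bar>e\<bar> = 1" by (simp add: e_def abs_mult abs_sg)
  have Jb: "J b \<in> {- int n..-1}" "b \<in> {t (J b)..t (J b + 1)}" using J[OF b] by auto
  have win: "x \<in> {?a..?b}" if "j \<in> {- int n..-1}" "\<bar>j - J b\<bar> \<le> d" "x \<in> {t j..t (j + 1)}" for j x
    using that tc_window[of j "2 * d" "J b"] by auto
  have c: "b \<in> {?a..?b}" using win[OF Jb(1) _ Jb(2)] by simp
  have l: "mult_at b \<le> r" by (simp add: mult_at_def)
  obtain p where p: "degree p \<le> Suc m" "\<And>i. i < mult_at b \<Longrightarrow> poly ((pderiv ^^ i) p) b = D i b"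
    "\<And>x. x \<in> {?a..?b} \<Longrightarrow> \<bar>f x - poly p x\<bar> \<le> Q (2 * d) (J b)"
    "\<And>x. x \<in> {b..?b} \<Longrightarrow> 0 \<le> e * (poly p x - f x)"
    "\<And>x. x \<in> {?a..b} \<Longrightarrow> 0 \<le> e * (-1) ^ mult_at b * (poly p x - f x)"
    using local_poly[OF Jb(1) c l e1] by blast
  have "0 \<le> sg x * (poly p x - f x)"
    if j: "j \<in> {- int n..-1}" "\<bar>j - J b\<bar> \<le> d" and x: "x \<in> {t j..t (j + 1)}" "x \<notin> Y" for j x
  proof -
    have near: "y > x \<longleftrightarrow> y > b" if "y \<in> Y" "y \<noteq> b" for y
      using Y_near[OF b that(1) j(2)] that x by (cases "y < b") auto
    have xw: "x \<in> {?a..?b}" using win[OF j x(1)] .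
    have x1: "-1 \<le> x" "x \<le> 1" using xw tc_bounds[of "J b - 2 * d"] tc_bounds[of "J b + 1 + 2 * d"] by auto
    consider (R) "b = 1" | (L) "b = -1" | (Y) "b \<in> Y" "b \<noteq> 1" "b \<noteq> -1" | (A) "b \<notin> Y" "b \<noteq> 1" "b \<noteq> -1"
      by blast
    then show ?thesis
    proof cases
      case R
      have "b \<notin> Y" using R Y by auto
      then have "sg x = sg b" using near by (intro sg_cong) metis
      moreover have "e * (-1) ^ mult_at b = sg b"
        using R by (simp add: e_def mult_at_def mult.commute flip: power_add mult_2)
      ultimately show ?thesis using p(5)[of x] xw x1 R by simp
    next
      case L
      have "b \<notin> Y" using L Y by auto
      then have "sg x = sg b" using near by (intro sg_cong) metis
      then show ?thesis using p(4)[of x] xw x1 L by (simp add: e_def)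
    next
      case Y
      have odd: "odd (mult_at b)" using Y r1 by (auto simp: mult_at_def)
      have xb: "x \<noteq> b" using x(2) Y by auto
      show ?thesis
      proof (cases "x < b")
        case True
        then have "sg x = - sg b" by (intro sg_left_of_Y Y near)
        then show ?thesis using p(5)[of x] xw True Y odd by (simp add: e_def)
      next
        case False
        then have "sg x = sg b" using near xb by (intro sg_cong) (metis not_less_iff_gr_or_eq)
        then show ?thesis using p(4)[of x] xw False Y by (simp add: e_def)
      qed
    next
      case A
      have "sg x = sg b" using near A by (intro sg_cong) metis
      moreover have "even (mult_at b)" using A r1 by (auto simp: mult_at_def)
      ultimately show ?thesis using p(4)[of x] p(5)[of x] xw A by (cases "x < b") (auto simp: e_def)
    qed
  qed
  then show ?thesis using p by blast
qed

text \<open>With \<open>l = 0\<close> the correction is a constant shift, which gives one sign on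
  both sides; the base point \<open>t j\<close> is then an arbitrary choice.\<close>

lemma generic_poly:
  assumes j: "j \<in> {- int n..-1}"
  shows "\<exists>p. degree p \<le> Suc m
    \<and> (\<forall>x\<in>{tc (j - 2 * d)..tc (j + 1 + 2 * d)}. \<bar>f x - poly p x\<bar> \<le> Q (2 * d) j)
    \<and> (\<forall>x\<in>{t j..t (j + 1)}. 0 \<le> es j * (poly p x - f x))"
proof -
  have w: "tc (j - 2 * d) \<le> t j" "t (j + 1) \<le> tc (j + 1 + 2 * d)" using j by (intro tc_window; simp)+
  have "t j < t (j + 1)" by simp
  then have c: "t j \<in> {tc (j - 2 * d)..tc (j + 1 + 2 * d)}"
    using w unfolding atLeastAtMost_iff by linarith
  obtain p where p: "degree p \<le> Suc m"
    "\<And>i. i < 0 \<Longrightarrow> poly ((pderiv ^^ i) p) (t j) = D i (t j)"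
    "\<And>x. x \<in> {tc (j - 2 * d)..tc (j + 1 + 2 * d)} \<Longrightarrow> \<bar>f x - poly p x\<bar> \<le> Q (2 * d) j"
    "\<And>x. x \<in> {t j..tc (j + 1 + 2 * d)} \<Longrightarrow> 0 \<le> es j * (poly p x - f x)"
    "\<And>x. x \<in> {tc (j - 2 * d)..t j} \<Longrightarrow> 0 \<le> es j * (-1) ^ 0 * (poly p x - f x)"
    by (rule local_poly[OF j c le0 abs_es[of j]]) blast
  have "\<forall>x\<in>{t j..t (j + 1)}. 0 \<le> es j * (poly p x - f x)"
    using p(4) w(2) by (meson atLeastAtMost_iff order.trans)
  then show ?thesis using p(1,3) by blast
qed

lemma J_eq_of_interior: "y \<in> Y \<Longrightarrow> t j < y \<Longrightarrow> y < t (j + 1) \<Longrightarrow> J y = j"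
proof -
  assume y: "y \<in> Y" "t j < y" "y < t (j + 1)"
  then have "t (J y) \<le> y" "y \<le> t (J y + 1)" using J[of y] by auto
  then have "t (J y) < t (j + 1)" "t j < t (J y + 1)" using y by linarith+
  then show ?thesis by simp
qed

lemma Y_outside: "j \<notin> J ` B \<Longrightarrow> y \<in> Y \<Longrightarrow> y \<le> t j \<or> t (j + 1) \<le> y"
  using J_eq_of_interior[of y j] by force

lemma sg_eq_es:
  assumes "j \<notin> J ` B" "x \<in> {t j..t (j + 1)}" "x \<notin> Y"
  shows "sg x = es j"
  unfolding es_def
proof (rule sg_cong)
  fix y assume y: "y \<in> Y"
  have "t j < t (j + 1)" by simp
  moreover have "x \<noteq> y" using assms y by auto
  ultimately show "y > x \<longleftrightarrow> y > (t j + t (j + 1)) / 2"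
    using Y_outside[OF assms(1) y] assms(2) by auto
qed

text \<open>A point of \<open>Y\<close> in the interior of either interval, or at their common knot,
  would force \<open>J\<close> of it to be \<open>j\<close> or \<open>j + 1\<close>.\<close>

lemma es_step:
  assumes "j \<notin> J ` B" "j + 1 \<notin> J ` B"
  shows "es j = es (j + 1)"
  unfolding es_def
proof (rule sg_cong)
  fix y assume y: "y \<in> Y"
  have less: "t j < t (j + 1)" "t (j + 1) < t (j + 1 + 1)" by simp_all
  have "y \<noteq> t (j + 1)"
  proof
    assume "y = t (j + 1)"
    then have "t (J y) \<le> t (j + 1)" "t (j + 1) \<le> t (J y + 1)" using J[of y] y by auto
    then have "J y = j \<or> J y = j + 1" by auto
    then show False using assms y by force
  qed
  then have "y \<le> t j \<or> t (j + 1 + 1) \<le> y"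
    using Y_outside[OF assms(1) y] Y_outside[OF assms(2) y] by (metis order_antisym)
  then show "y > (t j + t (j + 1)) / 2 \<longleftrightarrow> y > (t (j + 1) + t (j + 1 + 1)) / 2"
  proof
    assume "y \<le> t j"
    moreover have "\<not> y > (u + v) / 2 \<and> \<not> y > (v + w) / 2" if "u < v" "v < w" "y \<le> u" for u v w
      using that by simp
    ultimately show ?thesis using less by blast
  next
    assume "t (j + 1 + 1) \<le> y"
    moreover have "y > (u + v) / 2 \<and> y > (v + w) / 2" if "u < v" "v < w" "w \<le> y" for u v w
      using that by simp
    ultimately show ?thesis using less by blast
  qed
qed

end

section \<open>Global assembly and the error estimate\<close>

context one_sided_problem
begin

lemma mult_at_endpoints: "mult_at 1 = r" "mult_at (-1) = r"
  by (simp_all add: mult_at_def)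

lemma mult_at_Y:
  assumes "b \<in> Y"
  shows "mult_at b = (if odd r then r else r - 1)" "0 < mult_at b"
proof -
  have "b \<noteq> 1" "b \<noteq> -1" using assms Y by auto
  then show "mult_at b = (if odd r then r else r - 1)" using assms by (simp add: mult_at_def)
  then show "0 < mult_at b" using r1 by (auto elim: evenE)
qed

text \<open>An inequality only, because \<open>A\<close> may contain 1 or -1, where \<open>r\<close>
  conditions hold for either parity.\<close>

lemma mult_at_not_Y: "b \<notin> Y \<Longrightarrow> (if even r then r else r - 1) \<le> mult_at b"
  by (simp add: mult_at_def)

text \<open>The index \<open>i\<close> is the centre of the window on which \<open>p\<close> was
  built: \<open>j\<close> itself for a generic piece, \<open>J b\<close> for a piece inherited from
  a nearby \<open>b\<close>. The sign is recorded only off \<open>J\<close>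
  B\<open>; on the intervals of\<close>J \<open>B\<close> the spline coincides with its piece and
  the sign comes from \<open>sg\<close> directly.\<close>

definition piece :: "int \<Rightarrow> real poly \<Rightarrow> bool" where
  "piece j p \<longleftrightarrow> degree p \<le> Suc m
    \<and> (\<exists>i\<in>{- int n..-1}. \<bar>i - j\<bar> \<le> d
        \<and> (\<forall>x\<in>{tc (i - 2 * d)..tc (i + 1 + 2 * d)}. \<bar>f x - poly p x\<bar> \<le> Q (2 * d) i))
    \<and> (\<forall>x\<in>{t j..t (j + 1)}. x \<notin> Y \<longrightarrow> j \<notin> J ` B \<longrightarrow> 0 \<le> es j * (poly p x - f x))"

lemma exists_pieces:
  obtains R where "\<And>j. j \<in> {- int n..-1} \<Longrightarrow> piece j (R j)"
    "\<And>b j. b \<in> B \<Longrightarrow> j \<in> {- int n..-1} \<Longrightarrow> \<bar>j - J b\<bar> \<le> d \<Longrightarrow> R j = R (J b)"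
    "\<And>b i. b \<in> B \<Longrightarrow> i < mult_at b \<Longrightarrow> poly ((pderiv ^^ i) (R (J b))) b = D i b"
    "\<And>b x. b \<in> B \<Longrightarrow> x \<in> {t (J b)..t (J b + 1)} \<Longrightarrow> x \<notin> Y \<Longrightarrow> 0 \<le> sg x * (poly (R (J b)) x - f x)"
proof -
  define bp where "bp b p \<longleftrightarrow> degree p \<le> Suc m \<and> (\<forall>i<mult_at b. poly ((pderiv ^^ i) p) b = D i b)
    \<and> (\<forall>x\<in>{tc (J b - 2 * d)..tc (J b + 1 + 2 * d)}. \<bar>f x - poly p x\<bar> \<le> Q (2 * d) (J b))
    \<and> (\<forall>j x. j \<in> {- int n..-1} \<longrightarrow> \<bar>j - J b\<bar> \<le> d \<longrightarrow> x \<in> {t j..t (j + 1)} \<longrightarrow> x \<notin> Y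
        \<longrightarrow> 0 \<le> sg x * (poly p x - f x))" for b p
  have "\<forall>b\<in>B. \<exists>p. bp b p"
    unfolding bp_def by (intro ballI beta_poly)
  from bchoice[OF this] obtain pb where "\<forall>b\<in>B. bp b (pb b)" ..
  then have bp: "bp b (pb b)" if "b \<in> B" for b using that by (rule bspec)
  note pb = bp[unfolded bp_def, THEN conjunct1]
    bp[unfolded bp_def, THEN conjunct2, THEN conjunct1, rule_format]
    bp[unfolded bp_def, THEN conjunct2, THEN conjunct2, THEN conjunct1, THEN bspec]
    bp[unfolded bp_def, THEN conjunct2, THEN conjunct2, THEN conjunct2, rule_format]
  define gp where "gp j p \<longleftrightarrow> degree p \<le> Suc m
    \<and> (\<forall>x\<in>{tc (j - 2 * d)..tc (j + 1 + 2 * d)}. \<bar>f x - poly p x\<bar> \<le> Q (2 * d) j)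
    \<and> (\<forall>x\<in>{t j..t (j + 1)}. 0 \<le> es j * (poly p x - f x))" for j p
  have "\<forall>j\<in>{- int n..-1}. \<exists>p. gp j p"
    unfolding gp_def by (intro ballI generic_poly)
  from bchoice[OF this] obtain G where "\<forall>j\<in>{- int n..-1}. gp j (G j)" ..
  then have gp: "gp j (G j)" if "j \<in> {- int n..-1}" for j using that by (rule bspec)
  note G = gp[unfolded gp_def]
  define R where "R = (\<lambda>j. if \<exists>b\<in>B. \<bar>j - J b\<bar> \<le> d then pb (SOME b. b \<in> B \<and> \<bar>j - J b\<bar> \<le> d) else G j)"
  \<comment> \<open>The separation leaves only one candidate within distance \<open>d\<close> of
    \<open>j\<close>, so the choice in \<open>R\<close> is determined.\<close>
  have near: "R j = pb b" if b: "b \<in> B" "\<bar>j - J b\<bar> \<le> d" for b j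
  proof -
    have "b' = b" if b': "b' \<in> B" "\<bar>j - J b'\<bar> \<le> d" for b'
    proof (rule linorder_cases[of b' b])
      assume "b' < b"
      from sep[OF b'(1) b(1) this] show ?thesis using b b' by simp
    next
      assume "b < b'"
      from sep[OF b(1) b'(1) this] show ?thesis using b b' by simp
    qed
    note unique = this
    have "(SOME b. b \<in> B \<and> \<bar>j - J b\<bar> \<le> d) = b"
    proof (rule some_equality)
      show "b \<in> B \<and> \<bar>j - J b\<bar> \<le> d" using b by (rule conjI)
    qed (elim conjE, rule unique)
    moreover have "\<exists>b\<in>B. \<bar>j - J b\<bar> \<le> d" using b by (rule bexI[rotated])
    ultimately show ?thesis by (simp only: R_def if_True)
  qed
  show ?thesis
  proof (rule that[of R])
    fix j assume j: "j \<in> {- int n..-1}"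
    show "piece j (R j)"
    proof (cases "\<exists>b\<in>B. \<bar>j - J b\<bar> \<le> d")
      case True
      then obtain b where b: "b \<in> B" "\<bar>j - J b\<bar> \<le> d" by blast
      have Jb: "J b \<in> {- int n..-1}" "\<bar>J b - j\<bar> \<le> d" using J[OF b(1)] b(2) by auto
      have "0 \<le> es j * (poly (pb b) x - f x)" if "x \<in> {t j..t (j + 1)}" "x \<notin> Y" "j \<notin> J ` B" for x
        using pb(4)[OF b(1) j b(2) that(1,2)] sg_eq_es[OF that(3,1,2)] by simp
      then show ?thesis
        unfolding near[OF b] piece_def
        by (intro conjI pb(1)[OF b(1)] bexI[OF _ Jb(1)] Jb(2) ballI pb(3)[OF b(1)] impI)
    next
      case False
      then have "R j = G j" by (simp only: R_def if_False)
      moreover have "piece j (G j)"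
        unfolding piece_def using G[OF j] by (intro conjI bexI[OF _ j]) auto
      ultimately show ?thesis by simp
    qed
  next
    fix b j assume "b \<in> B" "j \<in> {- int n..-1}" "\<bar>j - J b\<bar> \<le> d"
    then show "R j = R (J b)" using near[of b j] near[of b "J b"] by simp
  next
    fix b i assume "b \<in> B" "i < mult_at b"
    then show "poly ((pderiv ^^ i) (R (J b))) b = D i b" using near[of b "J b"] pb(2) by simp
  next
    fix b x assume b: "b \<in> B" "x \<in> {t (J b)..t (J b + 1)}" "x \<notin> Y"
    have "J b \<in> {- int n..-1}" using J[OF b(1)] by blast
    then show "0 \<le> sg x * (poly (R (J b)) x - f x)" using near[of b "J b"] pb(4)[OF b(1) _ _ b(2,3)] b by simp
  qed
qed

text \<open>The constant of \<open>knot_range_le\<close> for N = 4 (m + 1), the widest window that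
  occurs.\<close>

definition K :: real where "K = (8 * real (Suc m) + 1) * P ^ (4 * Suc m)"

lemma K_nonneg: "0 \<le> K" using P by (simp add: K_def)

lemma knots_near:
  "t (j + 1 + 4 * d) - t (j - 4 * d) \<le> K * (t (j + 1) - t j)"
  using knot_range_le[of j "4 * Suc m"] by (simp add: K_def algebra_simps)

text \<open>A piece relevant to interval \<open>j\<close> is centred at most \<open>2 * d\<close>
  intervals away and has a window of \<open>2 * d\<close> more, hence the reach
  \<open>4 * d\<close>. The length of that window is replaced by its bound in terms of the single
  interval \<open>j\<close>.\<close>

definition bound :: "int \<Rightarrow> real" where
  "bound j = 2 * Cw * omega k (D r) (tc (j + 1 + 4 * d) - tc (j - 4 * d)) (tc (j - 4 * d)) (tc (j + 1 + 4 * d))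
     * (K * (t (j + 1) - t j)) ^ r"

lemma Q_le_bound:
  assumes j: "j \<in> {- int n..-1}" and i: "i \<in> {- int n..-1}" "\<bar>i - j\<bar> \<le> 2 * d"
  shows "Q (2 * d) i \<le> bound j"
proof -
  let ?a = "tc (i - 2 * d)" and ?b = "tc (i + 1 + 2 * d)" and ?a' = "tc (j - 4 * d)" and ?b' = "tc (j + 1 + 4 * d)"
  have ab: "?a' \<le> ?a" "?b \<le> ?b'" using i by (intro tc_mono; simp)+
  have "?a \<le> t i" "t (i + 1) \<le> ?b" using i by (intro tc_window; simp)+
  moreover have "t i < t (i + 1)" by simp
  ultimately have lt: "?a < ?b" by linarith
  have "{?a'..?b'} \<subseteq> {-1..1}" using tc_bounds by (meson atLeastatMost_subset_iff)
  then have cont: "continuous_on {?a'..?b'} (D r)"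
    using Cm unfolding Cm_on_def by (blast intro: continuous_on_subset)
  have "?a' \<ge> t (j - 4 * d)" "?b' \<le> t (j + 1 + 4 * d)"
    using j by (auto simp: tc_def)
  then have len: "?b - ?a \<le> K * (t (j + 1) - t j)"
    using knots_near[of j] ab by linarith
  have "omega k (D r) (?b - ?a) ?a ?b \<le> omega k (D r) (?b' - ?a') ?a' ?b'"
    using ab by (intro omega_mono[OF cont]) auto
  moreover have "(?b - ?a) ^ r \<le> (K * (t (j + 1) - t j)) ^ r"
    using lt len by (intro power_mono) auto
  moreover have "0 \<le> omega k (D r) (?b' - ?a') ?a' ?b'" by (rule omega_nonneg[OF cont])
  ultimately have "2 * Cw * omega k (D r) (?b - ?a) ?a ?b * (?b - ?a) ^ r \<le> bound j"
    unfolding bound_def using Cw0 lt by (intro mult_mono mult_left_mono) auto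
  then show ?thesis by (simp add: Q_def mult.assoc)
qed

lemma piece_close:
  assumes j: "j \<in> {- int n..-1}" and j': "j' \<in> {- int n..-1}" "\<bar>j' - j\<bar> \<le> d"
    and p: "piece j' p" and x: "x \<in> {t j..t (j + 1)}"
  shows "\<bar>f x - poly p x\<bar> \<le> bound j"
proof -
  obtain i where i: "i \<in> {- int n..-1}" "\<bar>i - j'\<bar> \<le> d"
    "\<And>x. x \<in> {tc (i - 2 * d)..tc (i + 1 + 2 * d)} \<Longrightarrow> \<bar>f x - poly p x\<bar> \<le> Q (2 * d) i"
    using p unfolding piece_def by blast
  have near: "\<bar>i - j\<bar> \<le> 2 * d" "\<bar>j - i\<bar> \<le> 2 * d" using i(2) j'(2) by (auto simp: abs_le_iff)
  have "tc (i - 2 * d) \<le> t j" "t (j + 1) \<le> tc (i + 1 + 2 * d)"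
    using j near by (intro tc_window; simp)+
  then have "x \<in> {tc (i - 2 * d)..tc (i + 1 + 2 * d)}"
    using x unfolding atLeastAtMost_iff by linarith
  from i(3)[OF this] show ?thesis using Q_le_bound[OF j i(1) near(1)] by linarith
qed

theorem exists_one_sided_spline:
  obtains S :: "real \<Rightarrow> real" and DS :: "nat \<Rightarrow> real \<Rightarrow> real" where
    "\<And>j. \<exists>q. degree q \<le> Suc m \<and> (\<forall>x\<in>{t j..t (j + 1)}. S x = poly q x)"
    "DS 0 = S" "\<And>l x. l < m \<Longrightarrow> (DS l has_real_derivative DS (Suc l) x) (at x)" "continuous_on UNIV (DS m)"
    "\<And>x. x \<in> {-1..1} \<Longrightarrow> x \<notin> Y \<Longrightarrow> 0 \<le> sg x * (S x - f x)"
    "\<And>b i. b \<in> B \<Longrightarrow> i < mult_at b \<Longrightarrow> DS i b = D i b"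
    "\<And>j x. j \<in> {- int n..-1} \<Longrightarrow> x \<in> {t j..t (j + 1)} \<Longrightarrow>
       \<bar>f x - S x\<bar> \<le> (1 + 2 * Cb * (K + 1) ^ Suc m) * bound j"
proof -
  obtain R where R: "\<And>j. j \<in> {- int n..-1} \<Longrightarrow> piece j (R j)"
    "\<And>b j. b \<in> B \<Longrightarrow> j \<in> {- int n..-1} \<Longrightarrow> \<bar>j - J b\<bar> \<le> d \<Longrightarrow> R j = R (J b)"
    "\<And>b i. b \<in> B \<Longrightarrow> i < mult_at b \<Longrightarrow> poly ((pderiv ^^ i) (R (J b))) b = D i b"
    "\<And>b x. b \<in> B \<Longrightarrow> x \<in> {t (J b)..t (J b + 1)} \<Longrightarrow> x \<notin> Y \<Longrightarrow> 0 \<le> sg x * (poly (R (J b)) x - f x)"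
    using exists_pieces by blast
  have n1': "- int n \<le> -1" using n1 by simp
  have deg: "degree (R j) \<le> Suc m" if "j \<in> {- int n..-1}" for j
    using R(1)[OF that] by (simp add: piece_def)
  have frozen: "R j = R j0" if "j0 \<in> J ` B" "j0 \<in> {- int n..-1}" "j \<in> {- int n..-1}" "\<bar>j - j0\<bar> \<le> d" for j j0
    using R(2)[OF _ that(3)] that(1,4) by blast
  have const: "es j = es (j + 1)" if "j \<in> {- int n..<-1}" "j \<notin> J ` B" "j + 1 \<notin> J ` B" for j
    using es_step that(2,3) .
  show ?thesis
  proof (rule spline_assembly[where F = "J ` B" and es = es and R = R and m = m, OF n1'], goal_cases)
    case (1 j)
    then show ?case by (rule deg)
  next
    case 2
    show ?case by (rule abs_es)
  next
    case (3 j0 j)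
    then show ?case by (rule frozen)
  next
    case (4 j)
    then show ?case by (rule const)
  next
    case c: (5 c)
    define S where "S x = (\<Sum>i\<in>{- int n - d..-1}. c i * bspline (Suc m) t i x)" for x
    note c = c[folded S_def]
    obtain DS where DS: "DS 0 = (\<lambda>x. \<Sum>i\<in>{- int n - d..-1}. c i * bspline (Suc m) t i x)"
      "\<And>l x. l < m \<Longrightarrow> (DS l has_real_derivative DS (Suc l) x) (at x)" "continuous_on UNIV (DS m)"
      by (rule spline_smooth[where c = c and m = m and A = "{- int n - d..-1}"]) blast
    have DS0: "DS 0 = S" by (rule ext) (simp only: DS(1) S_def)
    show ?thesis
    proof (rule that[of S DS])
      fix j
      show "\<exists>q. degree q \<le> Suc m \<and> (\<forall>x\<in>{t j..t (j + 1)}. S x = poly q x)"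
        unfolding S_def
        by (rule spline_piece[where c = c and m = m and j = j and A = "{- int n - d..-1}"]) blast+
    next
      fix x :: real assume x: "x \<in> {-1..1}" "x \<notin> Y"
      obtain j where j: "j \<in> {- int n..<0}" "x \<in> {t j..t (j + 1)}"
        using exists_knot_interval[of "- int n" 0 x] n1 x t0 tn by auto
      then have j1: "j \<in> {- int n..-1}" by simp
      show "0 \<le> sg x * (S x - f x)"
      proof (cases "j \<in> J ` B")
        case True
        then obtain b where b: "b \<in> B" "j = J b" by blast
        then show ?thesis using c(1)[OF j1 True j(2)] R(4)[OF b(1)] j x by simp
      next
        case False
        have "0 \<le> es j * (S x - poly (R j) x)" by (rule c(2)[OF j1 j(2)])
        moreover have "0 \<le> es j * (poly (R j) x - f x)"
          using R(1)[OF j1] j(2) x(2) False unfolding piece_def by blast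
        ultimately have "0 \<le> es j * (S x - f x)" by (simp add: right_diff_distrib)
        then show ?thesis using sg_eq_es[OF False j(2) x(2)] by simp
      qed
    next
      fix b i assume b: "b \<in> B" and i: "i < mult_at b"
      \<comment> \<open>Here i < r \<le> m + 1 because k \<ge> 1, so the derivative lies within the
        smoothness of the spline.\<close>
      have "i \<le> m" using i m k1 by (auto simp: mult_at_def split: if_splits)
      moreover have Jb: "J b \<in> {- int n..-1}" "b \<in> {t (J b)..t (J b + 1)}" using J[OF b] by auto
      moreover have "DS 0 x = poly (R (J b)) x" if "x \<in> {t (J b)..t (J b + 1)}" for x
        unfolding DS0 using c(1)[OF Jb(1) _ that] b by blast
      ultimately have "DS i b = poly ((pderiv ^^ i) (R (J b))) b"
        using derivatives_eq_poly_derivatives[of m DS "t (J b)" "t (J b + 1)" "R (J b)" i b] DS(2) by simp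
      then show "DS i b = D i b" using R(3)[OF b i] by simp
    next
      fix j x assume j: "j \<in> {- int n..-1}" and x: "x \<in> {t j..t (j + 1)}"
      \<comment> \<open>Both pieces are within \<open>bound j\<close> of \<open>f\<close> on the
        interval \<open>j\<close>, so their difference is at most \<open>2 * bound j\<close> there,
        which is the interval used for the coefficient bound.\<close>
      have "\<bar>bcoeff (Suc m) t i (R j' - R j)\<bar> \<le> Cb * (K + 1) ^ Suc m * (2 * bound j)"
        if i: "i \<in> {j - d..j}" and j': "j' \<in> {- int n..-1}" "\<bar>j' - j\<bar> \<le> d" for i j'
      proof (rule Cb[where a = "t j" and h = "t (j + 1) - t j"])
        show "degree (R j' - R j) \<le> Suc m" using deg j j' by (intro degree_diff_le) auto
        fix u assume "u \<in> {t j..t j + (t (j + 1) - t j)}"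
        then have u: "u \<in> {t j..t (j + 1)}" by simp
        show "\<bar>poly (R j' - R j) u\<bar> \<le> 2 * bound j"
          using piece_close[OF j j' R(1)[OF j'(1)] u] piece_close[OF j j _ R(1)[OF j] u] by simp
      next
        fix l assume l: "l < Suc m"
        have "t (j - 4 * d) \<le> t (i + int l + 1)" "t (i + int l + 1) \<le> t (j + 1 + 4 * d)"
          "t (j - 4 * d) \<le> t j" "t j \<le> t (j + 1 + 4 * d)"
          using i l by simp_all
        then show "\<bar>t (i + int l + 1) - t j\<bar> \<le> K * (t (j + 1) - t j)"
          using knots_near[of j] by linarith
      qed (auto simp: K_nonneg)
      from c(3)[OF j x this]
      have "\<bar>S x - poly (R j) x\<bar> \<le> Cb * (K + 1) ^ Suc m * (2 * bound j)" by simp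
      moreover have "\<bar>f x - poly (R j) x\<bar> \<le> bound j"
        by (rule piece_close[OF j j _ R(1)[OF j] x]) simp
      ultimately show "\<bar>f x - S x\<bar> \<le> (1 + 2 * Cb * (K + 1) ^ Suc m) * bound j"
        by (simp add: algebra_simps)
    qed (use DS DS0 in auto)
  qed
qed

end

section \<open>The interpolation problem\<close>

text \<open>Repeating the first and the last gap indefinitely gives strictly increasing knots whose
  new neighbouring gaps have ratio 1, so the grading is governed by the interior knots.\<close>

definition ext_knots :: "(nat \<Rightarrow> real) \<Rightarrow> nat \<Rightarrow> int \<Rightarrow> real" where
  "ext_knots z n i = (if i > 0 then 1 + real_of_int i * (z 0 - z 1)
     else if i < - int n then -1 + real_of_int (i + int n) * (z (n - 1) - z n)
     else z (nat (- i)))"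

lemma decreasing_chain:
  fixes y :: "nat \<Rightarrow> real"
  assumes "\<forall>i\<in>{a..<b}. y (Suc i) < y i" "a \<le> i" "i < j" "j \<le> b"
  shows "y j < y i"
  using assms(3,4)
proof (induction j)
  case (Suc j)
  have "y (Suc j) < y j" using assms(1,2) Suc.prems by auto
  then show ?case using Suc by (cases "i = j") auto
qed simp

context
  fixes z :: "nat \<Rightarrow> real" and n :: nat
  assumes z0: "z 0 = 1" and zn: "z n = -1" and dec: "\<forall>j<n. z (Suc j) < z j"
begin

lemma n_pos: "n \<ge> 1"
  using z0 zn by (cases n) auto

lemma ext_knots_nat: "i \<le> n \<Longrightarrow> ext_knots z n (- int i) = z i"
  by (simp add: ext_knots_def)

lemma ext_knots_nat_pred: "1 \<le> i \<Longrightarrow> i \<le> n \<Longrightarrow> ext_knots z n (1 - int i) = z (i - 1)"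
  using ext_knots_nat[of "i - 1"] by (simp add: of_nat_diff)

lemma ext_knots_gap_right: "i \<ge> -1 \<Longrightarrow> ext_knots z n (i + 1) - ext_knots z n i = z 0 - z 1"
proof -
  assume i: "i \<ge> -1"
  consider "i = -1" | "i = 0" | "i > 0" using i by linarith
  then show ?thesis
  proof cases
    case 1
    then show ?thesis using ext_knots_nat[of 1] ext_knots_nat[of 0] n_pos by simp
  next
    case 2
    then show ?thesis using ext_knots_nat[of 0] z0 by (simp add: ext_knots_def)
  qed (simp add: ext_knots_def algebra_simps)
qed

lemma ext_knots_gap_left: "i \<le> - int n \<Longrightarrow> ext_knots z n (i + 1) - ext_knots z n i = z (n - 1) - z n"
proof -
  assume i: "i \<le> - int n"
  consider "i = - int n" | "i = - int n - 1" | "i < - int n - 1" using i by linarith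
  then show ?thesis
  proof cases
    case 1
    then show ?thesis using ext_knots_nat[of n] ext_knots_nat_pred[of n] n_pos by simp
  next
    case 2
    then show ?thesis using ext_knots_nat[of n] zn by (simp add: ext_knots_def)
  qed (use n_pos in \<open>simp add: ext_knots_def algebra_simps\<close>)
qed

lemma Jlen_eq: "1 \<le> i \<Longrightarrow> i \<le> n \<Longrightarrow> Jlen z n (int i) = ext_knots z n (- int i + 1) - ext_knots z n (- int i)"
proof -
  assume i: "1 \<le> i" "i \<le> n"
  then have "nat (int i - 1) = i - 1" by simp
  then show ?thesis
    using i by (simp add: Jlen_def zext_def ext_knots_nat ext_knots_nat_pred)
qed

lemma Jlen_pos: "1 \<le> i \<Longrightarrow> i \<le> n \<Longrightarrow> Jlen z n (int i) > 0"
  using dec[rule_format, of "i - 1"] by (simp add: Jlen_eq ext_knots_nat ext_knots_nat_pred)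

lemma knot_sequence_ext_knots: "knot_sequence (ext_knots z n)"
proof
  have step: "ext_knots z n i < ext_knots z n (i + 1)" for i
  proof -
    consider "i \<ge> -1" | "i \<le> - int n" | "- int n < i" "i < -1" by linarith
    then show ?thesis
    proof cases
      case 1
      then show ?thesis using ext_knots_gap_right[of i] dec[rule_format, of 0] n_pos by simp
    next
      case 2
      then show ?thesis using ext_knots_gap_left[of i] dec[rule_format, of "n - 1"] n_pos by simp
    next
      case 3
      then show ?thesis using Jlen_eq[of "nat (- i)"] Jlen_pos[of "nat (- i)"] by simp
    qed
  qed
  have "ext_knots z n i < ext_knots z n j" if "i + 1 \<le> j" for i j
    using that
  proof (induction j rule: int_ge_induct)
    case (step j)
    then show ?case using \<open>\<And>i. ext_knots z n i < ext_knots z n (i + 1)\<close>[of j] by linarith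
  qed (rule step)
  then show "strict_mono (ext_knots z n)" by (auto intro: strict_monoI)
qed

lemma Jlen_ratio:
  assumes "1 \<le> i" "i < n"
  shows "Jlen z n (int i) \<le> rho z n * Jlen z n (int i + 1)" "Jlen z n (int i + 1) \<le> rho z n * Jlen z n (int i)"
proof -
  let ?S = "(\<lambda>i. Jlen z n (i - 1) / Jlen z n i) ` {1..int n} \<union> (\<lambda>i. Jlen z n (i + 1) / Jlen z n i) ` {1..int n}"
  have "Jlen z n (int i) / Jlen z n (int i + 1) \<in> ?S"
    using assms by (intro UnI1 image_eqI[of _ _ "int i + 1"]) auto
  then have 1: "Jlen z n (int i) / Jlen z n (int i + 1) \<le> rho z n"
    unfolding rho_def by (intro Max_ge) auto
  have "Jlen z n (int i + 1) / Jlen z n (int i) \<in> ?S"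
    using assms by (intro UnI2 image_eqI[of _ _ "int i"]) auto
  then have 2: "Jlen z n (int i + 1) / Jlen z n (int i) \<le> rho z n"
    unfolding rho_def by (intro Max_ge) auto
  have "Jlen z n (int i) > 0" "Jlen z n (int i + 1) > 0"
    using Jlen_pos[of i] Jlen_pos[of "Suc i"] assms by (simp_all add: add.commute)
  with 1 2 show "Jlen z n (int i) \<le> rho z n * Jlen z n (int i + 1)" "Jlen z n (int i + 1) \<le> rho z n * Jlen z n (int i)"
    by (simp_all add: pos_divide_le_eq)
qed

text \<open>The maximum with 1 covers the equal gaps at the ends: for a single interval, say,
  \<open>rho\<close> is 0, because the neighbours of J_1 are degenerate.\<close>

lemma graded_knots_ext_knots: "graded_knots (ext_knots z n) (max 1 (rho z n))"
proof -
  interpret knot_sequence "ext_knots z n" by (rule knot_sequence_ext_knots)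
  let ?t = "ext_knots z n" and ?P = "max 1 (rho z n)"
  have P: "x \<le> ?P * x" if "x \<ge> 0" for x :: real
    using mult_right_mono[of 1 ?P x] that by simp
  have "?t (j + 2) - ?t (j + 1) \<le> ?P * (?t (j + 1) - ?t j) \<and> ?t (j + 1) - ?t j \<le> ?P * (?t (j + 2) - ?t (j + 1))" for j
  proof -
    have eq: "j + 1 + 1 = j + 2" by simp
    have nonneg: "?t (j + 1) - ?t j \<ge> 0" by simp
    consider "j \<ge> -1" | "j \<le> - int n - 1" | "- int n \<le> j" "j \<le> -2" by linarith
    then show ?thesis
    proof cases
      case 1
      then show ?thesis
        using ext_knots_gap_right[of j] ext_knots_gap_right[of "j + 1"] P[OF nonneg] unfolding eq by simp
    next
      case 2
      then show ?thesis
        using ext_knots_gap_left[of j] ext_knots_gap_left[of "j + 1"] P[OF nonneg] unfolding eq by simp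
    next
      case 3
      define i where "i = nat (- j) - 1"
      have i: "1 \<le> i" "i < n" "- int i = j + 1" "- int (Suc i) = j" using 3 by (auto simp: i_def)
      have a: "Jlen z n (int i) = ?t (j + 2) - ?t (j + 1)"
        using Jlen_eq[of i] i by (simp add: add.commute)
      have b: "Jlen z n (int i + 1) = ?t (j + 1) - ?t j"
        using Jlen_eq[of "Suc i", unfolded i(4)] i(1,2) by (simp add: add.commute)
      have pos: "?t (j + 2) - ?t (j + 1) \<ge> 0" by simp
      have "?t (j + 2) - ?t (j + 1) \<le> rho z n * (?t (j + 1) - ?t j)"
        "?t (j + 1) - ?t j \<le> rho z n * (?t (j + 2) - ?t (j + 1))"
        using Jlen_ratio[OF i(1,2)] unfolding a b by auto
      moreover have "rho z n * (?t (j + 1) - ?t j) \<le> ?P * (?t (j + 1) - ?t j)"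
        "rho z n * (?t (j + 2) - ?t (j + 1)) \<le> ?P * (?t (j + 2) - ?t (j + 1))"
        using nonneg pos by (intro mult_right_mono; simp)+
      ultimately show ?thesis by linarith
    qed
  qed
  then show ?thesis by unfold_locales auto
qed

end

section \<open>Enumeration of the interpolation points, and the sign pattern\<close>

context
  fixes B :: "real set"
  assumes fin: "finite B" and sub: "B \<subseteq> {-1..1}"
begin

text \<open>Not strict, since 1 or -1 may itself belong to \<open>B\<close> and is then listed
  twice.\<close>

lemma beta_antimono:
  assumes "i \<le> j" "j \<le> card B + 1"
  shows "beta B j \<le> beta B i"
proof -
  let ?L = "rev (sorted_list_of_set B)"
  have len: "length ?L = card B" by simp
  have mem: "?L ! l \<in> {-1..1}" if "l < card B" for l
    using nth_mem[of l ?L] that len sub fin by auto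
  have mono: "?L ! l' \<le> ?L ! l" if "l \<le> l'" "l' < card B" for l l'
    using sorted_rev_nth_mono[of ?L l l'] that len by simp
  consider "i = j" | "i = 0" "0 < j" "j \<le> card B" | "0 < i" "i < j" "j \<le> card B" | "i = 0" "j = card B + 1"
    | "0 < i" "i \<le> card B" "j = card B + 1"
    using assms by linarith
  then show ?thesis
  proof cases
    case 2
    then show ?thesis using mem[of "j - 1"] by (auto simp: beta_def)
  next
    case 3
    then show ?thesis using mono[of "i - 1" "j - 1"] by (auto simp: beta_def)
  next
    case 5
    then show ?thesis using mem[of "i - 1"] by (auto simp: beta_def)
  qed (auto simp: beta_def)
qed

lemma beta_surj:
  assumes "b \<in> insert 1 (insert (-1) B)"
  shows "\<exists>j\<le>card B + 1. beta B j = b"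
proof -
  consider "b = 1" | "b = -1" | "b \<in> B" using assms by auto
  then show ?thesis
  proof cases
    case 1
    then show ?thesis by (intro exI[of _ 0]) (simp add: beta_def)
  next
    case 2
    then show ?thesis by (intro exI[of _ "card B + 1"]) (simp add: beta_def)
  next
    case 3
    then have "b \<in> set (rev (sorted_list_of_set B))" using fin by simp
    then obtain l where "l < card B" "rev (sorted_list_of_set B) ! l = b"
      by (metis in_set_conv_nth length_rev length_sorted_list_of_set)
    then show ?thesis by (intro exI[of _ "Suc l"]) (simp add: beta_def)
  qed
qed

text \<open>The least index whose point lies below b' is preceded by an occurrence of b' itself.
  This picks a nonempty gap adjacent to b' even when an end point is repeated, and that gap lies
  between b and b'.\<close>

lemma card_knots_between:
  assumes gaps: "\<forall>j\<in>{1..card B + 1}. beta B j < beta B (j - 1) \<longrightarrow>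
      N \<le> card {i \<in> {0..n::nat}. beta B j < z i \<and> z i < beta B (j - 1)}"
    and b: "b \<in> insert 1 (insert (-1) B)" "b' \<in> insert 1 (insert (-1) B)" "b < b'"
  shows "N \<le> card {i \<in> {0..n}. b < z i \<and> z i < b'}"
proof -
  obtain jb where jb: "jb \<le> card B + 1" "beta B jb = b" using beta_surj[OF b(1)] by blast
  obtain jb' where jb': "jb' \<le> card B + 1" "beta B jb' = b'" using beta_surj[OF b(2)] by blast
  define j where "j = (LEAST j. beta B j < b')"
  have j: "beta B j < b'" unfolding j_def by (rule LeastI[of _ jb]) (use jb b(3) in simp)
  have jle: "j \<le> jb" unfolding j_def by (rule Least_le) (use jb b(3) in simp)
  have "jb' < j"
  proof (rule ccontr)
    assume "\<not> jb' < j"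
    then have "beta B jb' \<le> beta B j" using jb' by (intro beta_antimono) auto
    then show False using j jb' by simp
  qed
  then have "beta B (j - 1) \<le> b'"
    using beta_antimono[of jb' "j - 1"] jle jb jb' by simp
  moreover have "\<not> beta B (j - 1) < b'"
    using not_less_Least[of "j - 1" "\<lambda>j. beta B j < b'"] \<open>jb' < j\<close> by (simp add: j_def)
  ultimately have up: "beta B (j - 1) = b'" by simp
  have low: "b \<le> beta B j" using beta_antimono[OF jle] jb by simp
  have "N \<le> card {i \<in> {0..n}. beta B j < z i \<and> z i < beta B (j - 1)}"
    using gaps[rule_format, of j] \<open>jb' < j\<close> jle jb j up by simp
  also have "\<dots> \<le> card {i \<in> {0..n}. b < z i \<and> z i < b'}"
    using low up by (intro card_mono) auto
  finally show ?thesis .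
qed

end

text \<open>Links the counting definition of \<open>sg\<close> with the indexed sign condition of
  \<open>Delta0\<close>.\<close>

lemma sign_pattern:
  fixes y :: "nat \<Rightarrow> real"
  assumes dec: "\<forall>i\<in>{1..<s}. y (Suc i) < y i" and i: "i \<le> s"
    and x: "x \<in> {yext y s (Suc i)..yext y s i}" "x \<notin> y ` {1..s}"
  shows "card {v \<in> y ` {1..s}. v > x} = i"
proof -
  have less: "y l < y j" if "1 \<le> j" "j < l" "l \<le> s" for j l
    using decreasing_chain[OF dec that] .
  have "{v \<in> y ` {1..s}. v > x} = y ` {1..i}"
  proof (intro equalityI subsetI)
    fix v assume "v \<in> {v \<in> y ` {1..s}. v > x}"
    then obtain j where j: "1 \<le> j" "j \<le> s" "v = y j" "v > x" by auto
    have "j \<le> i"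
    proof (rule ccontr)
      assume "\<not> j \<le> i"
      then have "y j \<le> y (Suc i)" using less[of "Suc i" j] j by (cases "j = Suc i") auto
      moreover have "y (Suc i) \<le> x" using x(1) \<open>\<not> j \<le> i\<close> j by (simp add: yext_def)
      ultimately show False using j by simp
    qed
    then show "v \<in> y ` {1..i}" using j by auto
  next
    fix v assume "v \<in> y ` {1..i}"
    then obtain j where j: "1 \<le> j" "j \<le> i" "v = y j" by auto
    then have "y i \<le> y j" using less[of j i] i by (cases "j = i") auto
    moreover have "x \<le> y i" using x(1) j i by (simp add: yext_def)
    moreover have "y j \<in> y ` {1..s}" using j i by auto
    ultimately show "v \<in> {v \<in> y ` {1..s}. v > x}" using x(2) j by (auto simp: order.strict_iff_order)
  qed
  moreover have "inj_on y {1..i}"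
  proof (rule inj_onI)
    fix j l assume "j \<in> {1..i}" "l \<in> {1..i}" "y j = y l"
    then show "j = l" using less[of j l] less[of l j] i by (cases j l rule: linorder_cases) auto
  qed
  ultimately show ?thesis by (simp add: card_image)
qed

lemma continuous_on_0_of_smooth:
  fixes D :: "nat \<Rightarrow> real \<Rightarrow> real"
  assumes "\<And>l x. l < m \<Longrightarrow> (D l has_real_derivative D (Suc l) x) (at x)" "continuous_on UNIV (D m)"
  shows "continuous_on UNIV (D 0)"
proof (cases m)
  case (Suc m')
  then show ?thesis using assms(1)[of 0] by (intro DERIV_continuous_on) (auto intro: has_field_derivative_at_within)
qed (use assms in simp)

theorem theorem4p10:
  fixes k r :: nat and m1 m2 m3 :: int
  assumes hk: "k \<ge> 1"
    and hr: "(int r, m1, m2, m3) \<in>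
       {(2 * int j, 2 * int j - 1, 2 * int j - 2, 2 * int j - 1) | j. j \<ge> 1}
     \<union> {(2 * int j + 1, 2 * int j - 1, 2 * int j, 2 * int j) | j. True}"
  shows "\<exists>C :: real \<Rightarrow> real. \<forall>(s::nat) (p::nat) (y::nat \<Rightarrow> real) (\<alpha>::nat \<Rightarrow> real)
     (f::real \<Rightarrow> real) (Df::nat \<Rightarrow> real \<Rightarrow> real) (n::nat) (z::nat \<Rightarrow> real).
     p \<ge> 1
     \<and> (\<forall>i\<in>{1..s}. -1 < y i \<and> y i < 1) \<and> (\<forall>i\<in>{1..<s}. y (Suc i) < y i)
     \<and> (\<forall>i\<in>{1..p}. -1 \<le> \<alpha> i \<and> \<alpha> i \<le> 1) \<and> (\<forall>i\<in>{1..<p}. \<alpha> (Suc i) < \<alpha> i)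
     \<and> y ` {1..s} \<inter> \<alpha> ` {1..p} = {}
     \<and> Cm_on r {-1..1} f Df
     \<and> z 0 = 1 \<and> z n = -1 \<and> (\<forall>j<n. z (Suc j) < z j)
     \<and> (\<forall>j\<in>{1..s+p+1}.
          beta (y ` {1..s} \<union> \<alpha> ` {1..p}) j < beta (y ` {1..s} \<union> \<alpha> ` {1..p}) (j - 1) \<longrightarrow>
          card {i\<in>{0..n}. beta (y ` {1..s} \<union> \<alpha> ` {1..p}) j < z i
                          \<and> z i < beta (y ` {1..s} \<union> \<alpha> ` {1..p}) (j - 1)}
            \<ge> 4 * (k + r - 1) ^ 2)
     \<longrightarrow> (\<exists>S DS. S \<in> Sigma (k + r) z n \<and> Cm_on (k + r - 2) {-1..1} S DS
          \<and> Delta0 y s (\<lambda>x. S x - f x)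
          \<and> (\<forall>a\<in>\<alpha> ` {1..p}. \<forall>i::nat. int i \<le> m1 \<longrightarrow> DS i a = Df i a)
          \<and> (\<forall>b\<in>y ` {1..s}. \<forall>i::nat. int i \<le> m2 \<longrightarrow> DS i b = Df i b)
          \<and> (\<forall>i::nat. int i \<le> m3 \<longrightarrow> DS i 1 = Df i 1 \<and> DS i (-1) = Df i (-1))
          \<and> (\<forall>i\<in>{0..<n}. \<exists>a b. a \<le> b
               \<and> zext z n (int i + int (6 * (k + r - 1) ^ 2)) \<le> a \<and> a \<le> zext z n (int i)
               \<and> zext z n (int i - 1) \<le> b \<and> b \<le> zext z n (int i - int (6 * (k + r - 1) ^ 2))
               \<and> (\<forall>x\<in>{zext z n (int i)..zext z n (int i - 1)}.
                    \<bar>f x - S x\<bar> \<le> C (rho z n) * (Jlen z n (int i)) ^ r * omega k (Df r) (b - a) a b)))"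
proof -
  \<comment> \<open>For even r the points of A carry r conditions and those of Y carry r - 1; for
    odd r it is the other way round. These are the counts in \<open>mult_at\<close>.\<close>
  have parity: "r \<ge> 1"
    "even r \<Longrightarrow> m1 = int r - 1" "even r \<Longrightarrow> m2 = int r - 2"
    "odd r \<Longrightarrow> m1 = int r - 2" "odd r \<Longrightarrow> m2 = int r - 1" "m3 = int r - 1"
    using hr by (auto; presburger)+
  define m where "m = k + r - 2"
  have km: "k + r = m + 2" "k + r - 1 = Suc m" "k + r - 2 = m" using hk parity(1) by (auto simp: m_def)
  \<comment> \<open>Both constants are obtained before any data, so C depends on k, r and the mesh
    ratio only.\<close>
  obtain Cw where Cw: "Cw \<ge> 0" "\<And>g a b. a < b \<Longrightarrow> continuous_on {a..b} g \<Longrightarrow>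
      \<exists>q. degree q < k \<and> (\<forall>x\<in>{a..b}. \<bar>g x - poly q x\<bar> \<le> Cw * omega k g (b - a) a b)"
    by (rule whitney[OF hk]) blast
  obtain Cb where Cb: "Cb \<ge> 0"
    "\<And>t i q a h K M. degree q \<le> Suc m \<Longrightarrow> 0 < h \<Longrightarrow> 0 \<le> K \<Longrightarrow> (\<And>x. x \<in> {a..a + h} \<Longrightarrow> \<bar>poly q x\<bar> \<le> M)
      \<Longrightarrow> (\<And>l. l < Suc m \<Longrightarrow> \<bar>t (i + int l + 1) - a\<bar> \<le> K * h)
      \<Longrightarrow> \<bar>bcoeff (Suc m) t i q\<bar> \<le> Cb * (K + 1) ^ Suc m * M"
    by (rule bcoeff_bound[where m = "Suc m"]) blast
  define KK where "KK = (\<lambda>\<rho>::real. (8 * real (Suc m) + 1) * max 1 \<rho> ^ (4 * Suc m))"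
  define C where "C = (\<lambda>\<rho>. (1 + 2 * Cb * (KK \<rho> + 1) ^ Suc m) * (2 * Cw * KK \<rho> ^ r))"
  show ?thesis
    unfolding km(2,3) unfolding km(1)
  proof (rule exI[of _ C], intro allI impI, elim conjE, goal_cases)
    case hyps: (1 s p y \<alpha> f Df n z)
    let ?Y = "y ` {1..s}" and ?A = "\<alpha> ` {1..p}"
    let ?B = "insert 1 (insert (-1) (?Y \<union> ?A))"
    let ?t = "ext_knots z n" and ?d = "int (Suc m)"
    note ydec = hyps(3) and adec = hyps(5) and z = hyps(8,9,10)
    have Y: "?Y \<subseteq> {-1<..<1}" and A: "?A \<subseteq> {-1..1}" using hyps(2,4) by auto
    have n1: "n \<ge> 1" by (rule n_pos[OF z])
    interpret graded_knots ?t "max 1 (rho z n)" by (rule graded_knots_ext_knots[OF z])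
    have t0: "?t 0 = 1" and tn: "?t (- int n) = -1"
      using ext_knots_nat[OF z, of 0] ext_knots_nat[OF z, of n] z by simp_all
    have card: "card (?Y \<union> ?A) = s + p"
    proof -
      have "inj_on y {1..s}"
      proof (rule linorder_inj_onI)
        fix i j assume "i < j" "i \<in> {1..s}" "j \<in> {1..s}"
        then show "y i \<noteq> y j" using decreasing_chain[OF ydec, of i j] by simp
      qed auto
      moreover have "inj_on \<alpha> {1..p}"
      proof (rule linorder_inj_onI)
        fix i j assume "i < j" "i \<in> {1..p}" "j \<in> {1..p}"
        then show "\<alpha> i \<noteq> \<alpha> j" using decreasing_chain[OF adec, of i j] by simp
      qed auto
      ultimately show ?thesis using hyps(6) by (simp add: card_Un_disjoint card_image)
    qed
    have Bsub: "?B \<subseteq> {-1..1}" using Y A by (auto simp: subset_iff less_imp_le)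
    have "\<forall>b\<in>?B. \<exists>j. j \<in> {- int n..-1} \<and> b \<in> {?t j..?t (j + 1)}"
    proof
      fix b assume "b \<in> ?B"
      then have "?t (- int n) \<le> b" "b \<le> ?t 0" using Bsub t0 tn by auto
      then obtain j where "j \<in> {- int n..<0}" "b \<in> {?t j..?t (j + 1)}"
        using exists_knot_interval[of "- int n" 0 b] n1 by auto
      then show "\<exists>j. j \<in> {- int n..-1} \<and> b \<in> {?t j..?t (j + 1)}" by (intro exI[of _ j]) auto
    qed
    from bchoice[OF this] obtain J where J: "\<forall>b\<in>?B. J b \<in> {- int n..-1} \<and> b \<in> {?t (J b)..?t (J b + 1)}" ..
    \<comment> \<open>Each knot strictly between b and b' has its index in
      \<open>{J b + 1..J b'}\<close>. With q = k + r - 1 \<ge> 1 the assumed 4 q^2 knots give at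
      least the 2 q + 2 indices needed.\<close>
    have sep: "J b + 2 * ?d + 2 \<le> J b'" if b: "b \<in> ?B" "b' \<in> ?B" "b < b'" for b b'
    proof -
      let ?I = "{i \<in> {0..n}. b < z i \<and> z i < b'}"
      have "4 * (Suc m)\<^sup>2 \<le> card ?I"
      proof (rule card_knots_between[OF _ _ _ b])
        show "?Y \<union> ?A \<subseteq> {-1..1}" using Bsub by blast
      qed (use hyps(11) card in simp_all)
      also have "card ?I \<le> card {J b + 1..J b'}"
      proof (rule card_inj_on_le[of "\<lambda>i. - int i"])
        show "(\<lambda>i. - int i) ` ?I \<subseteq> {J b + 1..J b'}"
        proof
          fix l assume "l \<in> (\<lambda>i. - int i) ` ?I"
          then obtain i where i: "l = - int i" "i \<le> n" "b < z i" "z i < b'" by auto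
          then have "?t l = z i" using ext_knots_nat[OF z, of i] by simp
          then have "?t (J b) < ?t l" "?t l < ?t (J b' + 1)"
            using J[rule_format, OF b(1)] J[rule_format, OF b(2)] i by auto
          then show "l \<in> {J b + 1..J b'}" by simp
        qed
      qed (auto intro: inj_onI)
      finally have "4 * (Suc m)\<^sup>2 \<le> nat (J b' - J b)" by simp
      moreover have "2 * Suc m + 2 \<le> 4 * (Suc m)\<^sup>2" by (simp add: power2_eq_square)
      ultimately show ?thesis by linarith
    qed
    interpret one_sided_problem ?t "max 1 (rho z n)" k r m n Cw Cb f Df ?Y ?A J
    proof (unfold_locales, goal_cases)
      case (8 g a b) then show ?case by (rule Cw(2))
    next
      case (10 i q a h K M) then show ?case by (rule Cb(2))
    next
      case (16 b) then show ?case using J by blast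
    next
      case (17 b b') then show ?case by (rule sep)
    qed (use hk parity km n1 t0 tn Cw(1) Cb(1) hyps(6,7) Y A in auto)
    obtain S DS where S: "\<And>j. \<exists>q. degree q \<le> Suc m \<and> (\<forall>x\<in>{?t j..?t (j + 1)}. S x = poly q x)"
      "DS 0 = S" "\<And>l x. l < m \<Longrightarrow> (DS l has_real_derivative DS (Suc l) x) (at x)" "continuous_on UNIV (DS m)"
      "\<And>x. x \<in> {-1..1} \<Longrightarrow> x \<notin> ?Y \<Longrightarrow> 0 \<le> sg x * (S x - f x)"
      "\<And>b i. b \<in> ?B \<Longrightarrow> i < mult_at b \<Longrightarrow> DS i b = Df i b"
      "\<And>j x. j \<in> {- int n..-1} \<Longrightarrow> x \<in> {?t j..?t (j + 1)} \<Longrightarrow>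
         \<bar>f x - S x\<bar> \<le> (1 + 2 * Cb * (K + 1) ^ Suc m) * bound j"
      by (rule exists_one_sided_spline) blast
    have f0: "Df 0 x = f x" if "x \<in> {-1..1}" for x
      using hyps(7) that by (simp add: Cm_on_def)
    have sigma: "S \<in> Sigma (m + 2) z n"
      unfolding Sigma_def
    proof (intro CollectI conjI ballI)
      show "continuous_on {-1..1} S"
        unfolding S(2)[symmetric]
        by (rule continuous_on_subset[OF continuous_on_0_of_smooth subset_UNIV]) (rule S(3,4), assumption?)+
      fix j assume j: "j \<in> {1..n}"
      have "?t (- int j) = z j" "?t (- int j + 1) = z (j - 1)"
        using j ext_knots_nat[OF z, of j] ext_knots_nat_pred[OF z, of j] by simp_all
      then show "\<exists>q. degree q \<le> m + 2 - 1 \<and> (\<forall>x\<in>{z j..z (j - 1)}. S x = poly q x)"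
        using S(1)[of "- int j"] by simp
    qed
    have smooth: "Cm_on m {-1..1} S DS"
      unfolding Cm_on_def
      using S(2,3) by (auto intro: has_field_derivative_at_within continuous_on_subset[OF S(4)])
    have delta: "Delta0 y s (\<lambda>x. S x - f x)"
      unfolding Delta0_def
    proof (intro allI impI ballI)
      fix i x assume i: "i \<le> s" and x: "x \<in> {yext y s (Suc i)..yext y s i}"
      have "yext y s l \<in> {-1..1}" if "l \<le> s + 1" for l
      proof (cases "l \<in> {1..s}")
        case True
        then show ?thesis using bspec[OF hyps(2) True] by (auto simp: yext_def)
      next
        case False
        then have "l = 0 \<or> l = s + 1" using that by auto
        then show ?thesis by (auto simp: yext_def)
      qed
      from this[of "Suc i"] this[of i] have x1: "x \<in> {-1..1}" using i x by auto
      show "0 \<le> (-1) ^ i * (S x - f x)"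
      proof (cases "x \<in> ?Y")
        case True
        then have "DS 0 x = Df 0 x" by (intro S(6) mult_at_Y) blast+
        then have "S x = f x" using S(2) f0[OF x1] by simp
        then show ?thesis by simp
      next
        case False
        then have "sg x = (-1) ^ i" by (simp only: sg_def sign_pattern[OF ydec i x False])
        then show ?thesis using S(5)[OF x1 False] by simp
      qed
    qed
    have "DS i a = Df i a" if a: "a \<in> ?A" and i: "int i \<le> m1" for a i
    proof (rule S(6))
      have "a \<notin> ?Y" using hyps(6) a by blast
      then show "i < mult_at a"
        using mult_at_not_Y[of a] i parity by (cases "even r") (auto split: if_splits)
    qed (use a in blast)
    then have int_A: "\<forall>a\<in>?A. \<forall>i. int i \<le> m1 \<longrightarrow> DS i a = Df i a" by (intro ballI allI impI)
    have "DS i b = Df i b" if b: "b \<in> ?Y" and i: "int i \<le> m2" for b i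
    proof (rule S(6))
      show "i < mult_at b" using mult_at_Y(1)[OF b] i parity by (cases "even r") auto
    qed (use b in blast)
    then have int_Y: "\<forall>b\<in>?Y. \<forall>i. int i \<le> m2 \<longrightarrow> DS i b = Df i b" by (intro ballI allI impI)
    have "DS i 1 = Df i 1 \<and> DS i (-1) = Df i (-1)" if i: "int i \<le> m3" for i
    proof (intro conjI S(6))
      show "i < mult_at 1" "i < mult_at (-1)" using i parity(6) unfolding mult_at_endpoints by simp_all
    qed blast+
    then have int_1: "\<forall>i. int i \<le> m3 \<longrightarrow> DS i 1 = Df i 1 \<and> DS i (-1) = Df i (-1)" by (intro allI impI)
    have error: "\<exists>a b. a \<le> b
        \<and> zext z n (int i + int (6 * (Suc m)\<^sup>2)) \<le> a \<and> a \<le> zext z n (int i)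
        \<and> zext z n (int i - 1) \<le> b \<and> b \<le> zext z n (int i - int (6 * (Suc m)\<^sup>2))
        \<and> (\<forall>x\<in>{zext z n (int i)..zext z n (int i - 1)}.
             \<bar>f x - S x\<bar> \<le> C (rho z n) * Jlen z n (int i) ^ r * omega k (Df r) (b - a) a b)"
      if i: "i \<in> {0..<n}" for i
    proof -
      have zext_tc: "zext z n l = tc (- l)" for l
      proof -
        consider "l < 0" | "l > int n" | "0 \<le> l" "l \<le> int n" by linarith
        then show ?thesis
        proof cases
          case 3
          then show ?thesis using ext_knots_nat[OF z, of "nat l"] by (simp add: tc_def zext_def)
        qed (simp_all add: zext_def tc_def t0 tn)
      qed
      \<comment> \<open>The extra 1 is for the right end: the window reaches
        \<open>j + 1 + 4 * d\<close>, whereas the theorem counts from the index of the left end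
        point of J_i.\<close>
      have big: "4 * ?d + 1 \<le> int (6 * (Suc m)\<^sup>2)" by (simp add: power2_eq_square algebra_simps)
      show ?thesis
      proof (cases "i = 0")
        \<comment> \<open>J_0 is the single point 1 and has length 0, so the right-hand side is 0
          because r \<ge> 1; interpolation at 1 makes the error vanish as well.\<close>
        case True
        have z10: "zext z n 0 = 1" "zext z n (-1) = 1" using z by (simp_all add: zext_def)
        have "S 1 = f 1" using S(2) S(6)[of 1 0] f0[of 1] parity(1) unfolding mult_at_endpoints by simp
        moreover have "Jlen z n 0 = 0" by (simp add: Jlen_def z10)
        moreover have "zext z n (int (6 * (Suc m)\<^sup>2)) \<le> 1"
          unfolding zext_tc by (rule tc_bounds)
        moreover have "zext z n (- int (6 * (Suc m)\<^sup>2)) = 1"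
          unfolding zext_tc by (simp add: tc_def t0)
        ultimately show ?thesis
          using True parity(1) by (intro exI[of _ 1]) (simp add: z10 power_0_left del: of_nat_mult of_nat_power)
      next
        case False
        define j where "j = - int i"
        have j: "j \<in> {- int n..-1}" using False i by (auto simp: j_def)
        have tj: "zext z n (int i) = ?t j" "zext z n (int i - 1) = ?t (j + 1)"
          using j by (auto simp: zext_tc tc_def j_def)
        have len: "Jlen z n (int i) = ?t (j + 1) - ?t j" by (simp add: Jlen_def tj)
        let ?a = "tc (j - 4 * ?d)" and ?b = "tc (j + 1 + 4 * ?d)"
        have "\<bar>f x - S x\<bar> \<le> C (rho z n) * Jlen z n (int i) ^ r * omega k (Df r) (?b - ?a) ?a ?b"
          if "x \<in> {?t j..?t (j + 1)}" for x
        proof -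
          have "K = KK (rho z n)" by (simp add: K_def KK_def)
          then have "(1 + 2 * Cb * (K + 1) ^ Suc m) * bound j
              = C (rho z n) * Jlen z n (int i) ^ r * omega k (Df r) (?b - ?a) ?a ?b"
            unfolding bound_def C_def len power_mult_distrib by (simp only: mult_ac)
          with S(7)[OF j that] show ?thesis by (simp only:)
        qed
        moreover have "zext z n (int i + int (6 * (Suc m)\<^sup>2)) \<le> ?a" "?b \<le> zext z n (int i - int (6 * (Suc m)\<^sup>2))"
          unfolding zext_tc using big by (intro tc_mono; simp add: j_def)+
        moreover have "?a \<le> ?t j" "?t (j + 1) \<le> ?b" using j by (intro tc_window; simp)+
        moreover have "?a \<le> ?b" by (intro tc_mono) simp
        ultimately show ?thesis unfolding tj by blast
      qed
    qed
    show ?case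
      by (rule exI[of _ S], rule exI[of _ DS], intro conjI sigma smooth delta int_A int_Y int_1 ballI)
         (rule error)
  qed
qed

end
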